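(* Assume that $\widehat{\mathcal{D}}$ contains a countable family that is dense in both $Y_1$ (for $\|\cdot\|_{Y_1}$) and $Y$ (for $\|\cdot\|$), and assume (A0), (A1), (A2), (A3). Then $\widehat{\Gamma}$ is a $\mathcal{B}(Y)$-contraction regular inhomogeneous $Y$-semigroup. Further, for every countable family $\{f_k\}_{k\in\mathbb N} \subseteq Y$ and every $s \in J$, as $\epsilon\to0$ we have the weak convergence in the Skorohod topology of $D(J(s),Y^\infty)$: \[ (V_{\epsilon}(s,\cdot)f_k: k \in \mathbb{N}) \Rightarrow (\widehat{\Gamma}(s, \cdot)f_k: k \in \mathbb{N}). \]
   Context: Banach spaces: $(Y,\|\cdot\|)$ real separable, $(Y_1,\|\cdot\|_{Y_1})$ real separable continuously embedded in $Y$; $Y^\infty$ is the countable product with product topology. $J$ is $\mathbb{R}^+$ or $[0,T_\infty]$, $\Delta_J=\{(s,t)\in J^2:s\le t\}$, $J(s)=\{t\in J:t\ge s\}$; $D(J(s),E)$ is the Skorohod space of RCLL functions; $\Rightarrow$ is convergence in distribution. An inhomogeneous $Y$-semigroup is $\Gamma:\Delta_J\to\mathcal B(Y)$ with $\Gamma(t,t)=I$, $\Gamma(s,r)\Gamma(r,t)=\Gamma(s,t)$ for $s\le r\le t$; it is a $\mathcal B(Y)$-contraction if $\sup_{(s,t)}\|\Gamma(s,t)\|_{\mathcal B(Y)}\le1$. Its generator $A_\Gamma(t)f$ is the common value of $\lim_{h\downarrow0}h^{-1}(\Gamma(t,t+h)-I)f$ and $\lim_{h\downarrow0}h^{-1}(\Gamma(t-h,t)-I)f$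 on the set $\mathcal D(A_\Gamma(t))$ where both exist and agree; $\mathcal D(A_\Gamma)=\bigcap_t\mathcal D(A_\Gamma(t))$. $\Gamma$ is regular if $Y_1\subseteq\mathcal D(A_\Gamma)$, $\Gamma(s,t)Y_1\subseteq Y_1$ and $u\mapsto\Gamma(u,t)f$ is $\|\cdot\|_{Y_1}$-continuous for $f\in Y_1$, $u\mapsto\Gamma(s,u)f$ is $Y$-continuous on $J(s)$ for $f\in Y$, and $u\mapsto\Gamma(s,u)A_\Gamma(u)f$ is Bochner integrable on $[s,t]$ for $f\in Y_1$. Probabilistic setting: $(\Omega,\mathcal F,\mathbb P)$ complete; $X$ finite; $(x_n,T_n)_{n\ge0}$ an ergodic Markov renewal process ($x_n\in X$, $T_0=0<T_1<\dots$) with semi-Markov kernel $Q$ (i.e. $\mathbb P[x_{n+1}=y,T_{n+1}-T_n\le t\mid x_k,T_k,k\le n]=Q(x_n,y,t)$), whose embedded chain, with transition matrix $P(x,y)=\lim_{t\to\infty}Q(x,y,t)$, is aperiodic and uniformly ergodic with stationary distribution $\rho$ ($\|P^n-\Pi\|\to0$, $\Pi g(x)=\sum_y\rho_yg(y)$); $F(x,t)=\sum_yQ(x,y,t)$, $m_1(x)=\int_0^\infty tF(x,dt)$, $M_\rho=\sum_x\rho_xm_1(x)$. $N(t)=\sup\{n:T_n\le t\}$ (finite everywhere after restricting $\Omega$ to a full-measure event); $x(t)=x_{N(t)}$; $N_s(t)=N(t)-N(s)$, $T_0(s)=s$, $T_n(s)=T_{N(s)+n}$ ($n\ge1$), $x_n(s)=x(T_n(s))$.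 $(\Gamma_x)_{x\in X}$ inhomogeneous $Y$-semigroups with generators $A_x$, jointly measurable in $(r,t,x,f)$. $(D^\epsilon(x,y))_{x,y\in X,\epsilon\in(0,1]}\subseteq\mathcal B(Y)$ with $(x,y,f)\mapsto D^\epsilon(x,y)f$ measurable, $D^0(x,y):=I$. $\mathcal D(D_1)$: set of $f\in Y$ such that $D^\epsilon_1(x,y)f:=\lim_{h\to0,\epsilon+h\in[0,1]}h^{-1}(D^{\epsilon+h}(x,y)f-D^\epsilon(x,y)f)$ exists for all $\epsilon\in[0,1]$, $x,y$; $\mathcal D(D_2)$, $D_2^\epsilon$ the analogous second derivative; $\mathcal D(D^0_1\in Y_1)=\{f\in\mathcal D(D_1)\cap Y_1:D_1^0(x,y)f\in Y_1\ \forall x,y\}$. $A'_x(t)f$ is the $\|\cdot\|_{Y_1}$-limit of $h^{-1}(A_x(t+h)f-A_x(t)f)$, $\mathcal D(A'_x)$ the set of $f\in\mathcal D(A_x)\cap Y_1$ with $A_x(t)f\in Y_1$ for all $t$ for which this limit exists in $Y_1$ for all $t$. $\widehat{\mathcal D}:=\bigcap_x\mathcal D(A'_x)\cap\mathcal D(D_2)\cap\mathcal D(D^0_1\in Y_1)$. Rescaled random evolution: $t^{\epsilon,s}=s+\epsilon(t-s)$, $T^{\epsilon,s}_k(s)=s+\epsilon(T_k(s)-s)$, $V_\epsilon(s,t)=\big[\prod_{k=1}^{N_s(t^{1/\epsilon,s})}\Gamma_{x_{k-1}(s)}(T^{\epsilon,s}_{k-1}(s),T^{\epsilon,s}_k(s))D^\epsilon(x_{k-1}(s),x_k(s))\big]\Gamma_{x(t^{1/\epsilon,s})}(T^{\epsilon,s}_{N_s(t^{1/\epsilon,s})}(s),t)$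 (ordered left to right, empty product $I$), $\epsilon\in(0,1]$. Averaged generator: for $f\in Y_1$, $a(x,t)f:=M_\rho^{-1}(m_1(x)A_x(t)f+\sum_yP(x,y)D^0_1(x,y)f)$ and $\widehat A(t)f:=\sum_x\rho_xa(x,t)f$. (A0): (a) $Y_1\subseteq\mathcal D(D_1)$; (b) every $\Gamma_x$ regular; (c) $t\mapsto A_x(t)f$ continuous into $Y$ for $f\in Y_1$; (d) there is $\bar\tau>0$ with $Q(x,y,(\bar\tau,\infty))=0$ for all $x,y$; (e) all $\Gamma_x(s,t)$, $D^\epsilon(x,y)$ have $\mathcal B(Y)$-norm $\le1$; (f) $A_x(t)\in\mathcal B(Y_1,Y)$ and $\sup_u\|A_x(u)\|_{\mathcal B(Y_1,Y)}<\infty$; (g) $\sup_{u,x}\|A'_x(u)f\|<\infty$, $\sup_{u,x}\|A_x(u)f\|_{Y_1}<\infty$ for $f\in\bigcap_x\mathcal D(A'_x)$; (h) $\sup_{\epsilon,x,y}\|D_1^\epsilon(x,y)f\|<\infty$ for $f\in\mathcal D(D_1)$; (i) $\sup_{\epsilon,x,y}\|D^\epsilon_2(x,y)f\|<\infty$ for $f\in\mathcal D(D_2)$. (A1): for every $f\in Y_1$, $s\in J$, $\Delta\in(0,1]$, $T\in J(s)$ there is a compact $K\subseteq Y$ with $\liminf_{\epsilon\to0}\mathbb P[V_\epsilon(s,t)f\in K\ \forall t\in[s,T]]\ge1-\Delta$. (A2): for every $s\in J$, $f\in\widehat{\mathcal D}$, $\Delta\in(0,1]$, $T\in J(s)$ there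 is a compact $K\subseteq Y$ with $\liminf_{\epsilon\to0}\mathbb P[V_\epsilon(s,t)\widehat A(t)f\in K\ \forall t\in[s,T]]\ge1-\Delta$. (A3): $\widehat A$ is the generator of a regular inhomogeneous $Y$-semigroup $\widehat\Gamma$. *)

theory Defs
  imports "HOL-Analysis.Analysis" "HOL-Probability.Probability"
begin

definition time_domain :: "real set \<Rightarrow> bool" where
  "time_domain J \<longleftrightarrow> J = {0..} \<or> (\<exists>Tinf>0. J = {0..Tinf})"

definition DeltaJ :: "real set \<Rightarrow> (real \<times> real) set" where
  "DeltaJ J = {(s, t). s \<in> J \<and> t \<in> J \<and> s \<le> t}"

definition Jfrom :: "real set \<Rightarrow> real \<Rightarrow> real set" where
  "Jfrom J s = {t \<in> J. s \<le> t}"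

text \<open>Y1 is modelled as a Banach space of its own type, continuously and injectively embedded
  into Y by the bounded linear map iota.\<close>
definition Y1 :: "('z::real_normed_vector \<Rightarrow>\<^sub>L 'y::real_normed_vector) \<Rightarrow> 'y set" where
  "Y1 iota = range (blinfun_apply iota)"

text \<open>The Y1-element corresponding to f in Y1 (so that the Y1-norm of f is norm (toZ iota f)).\<close>
definition toZ :: "('z::real_normed_vector \<Rightarrow>\<^sub>L 'y::real_normed_vector) \<Rightarrow> 'y \<Rightarrow> 'z" where
  "toZ iota f = inv (blinfun_apply iota) f"

definition inhom_semigroup ::
  "real set \<Rightarrow> (real \<Rightarrow> real \<Rightarrow> 'y::real_normed_vector \<Rightarrow>\<^sub>L 'y) \<Rightarrow> bool" where
  "inhom_semigroup J G \<longleftrightarrow>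
     (\<forall>t\<in>J. G t t = id_blinfun) \<and>
     (\<forall>s r t. s \<in> J \<and> r \<in> J \<and> t \<in> J \<and> s \<le> r \<and> r \<le> t \<longrightarrow> G s r o\<^sub>L G r t = G s t)"

definition contraction_semigroup ::
  "real set \<Rightarrow> (real \<Rightarrow> real \<Rightarrow> 'y::real_normed_vector \<Rightarrow>\<^sub>L 'y) \<Rightarrow> bool" where
  "contraction_semigroup J G \<longleftrightarrow> (\<forall>(s, t)\<in>DeltaJ J. norm (G s t) \<le> 1)"

definition gen_at ::
  "real set \<Rightarrow> (real \<Rightarrow> real \<Rightarrow> 'y::real_normed_vector \<Rightarrow>\<^sub>L 'y) \<Rightarrow> real \<Rightarrow> 'y \<Rightarrow> 'y \<Rightarrow> bool" where
  "gen_at J G t f g \<longleftrightarrow>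
     ((\<lambda>h. (1 / h) *\<^sub>R (G t (t + h) f - f)) \<longlongrightarrow> g) (at 0 within {h. 0 < h \<and> t + h \<in> J}) \<and>
     ((\<lambda>h. (1 / h) *\<^sub>R (G (t - h) t f - f)) \<longlongrightarrow> g) (at 0 within {h. 0 < h \<and> t - h \<in> J})"

definition gen_dom ::
  "real set \<Rightarrow> (real \<Rightarrow> real \<Rightarrow> 'y::real_normed_vector \<Rightarrow>\<^sub>L 'y) \<Rightarrow> real \<Rightarrow> 'y set" where
  "gen_dom J G t = {f. \<exists>g. gen_at J G t f g}"

definition gen_dom_all ::
  "real set \<Rightarrow> (real \<Rightarrow> real \<Rightarrow> 'y::real_normed_vector \<Rightarrow>\<^sub>L 'y) \<Rightarrow> 'y set" where
  "gen_dom_all J G = (\<Inter>t\<in>J. gen_dom J G t)"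

definition gen ::
  "real set \<Rightarrow> (real \<Rightarrow> real \<Rightarrow> 'y::real_normed_vector \<Rightarrow>\<^sub>L 'y) \<Rightarrow> real \<Rightarrow> 'y \<Rightarrow> 'y" where
  "gen J G t f = (THE g. gen_at J G t f g)"

definition regular ::
  "real set \<Rightarrow> ('z::real_normed_vector \<Rightarrow>\<^sub>L 'y::{banach, second_countable_topology})
     \<Rightarrow> (real \<Rightarrow> real \<Rightarrow> 'y \<Rightarrow>\<^sub>L 'y) \<Rightarrow> bool" where
  "regular J iota G \<longleftrightarrow>
     Y1 iota \<subseteq> gen_dom_all J G \<and>
     (\<forall>(s, t)\<in>DeltaJ J. blinfun_apply (G s t) ` Y1 iota \<subseteq> Y1 iota) \<and>
     (\<forall>t\<in>J. \<forall>f\<in>Y1 iota. continuous_on {u \<in> J. u \<le> t} (\<lambda>u. toZ iota (G u t f))) \<and>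
     (\<forall>s\<in>J. \<forall>f. continuous_on (Jfrom J s) (\<lambda>u. G s u f)) \<and>
     (\<forall>(s, t)\<in>DeltaJ J. \<forall>f\<in>Y1 iota. set_integrable lborel {s..t} (\<lambda>u. G s u (gen J G u f)))"

definition Aprime_at ::
  "real set \<Rightarrow> ('z::real_normed_vector \<Rightarrow>\<^sub>L 'y::real_normed_vector)
     \<Rightarrow> (real \<Rightarrow> real \<Rightarrow> 'y \<Rightarrow>\<^sub>L 'y) \<Rightarrow> real \<Rightarrow> 'y \<Rightarrow> 'z \<Rightarrow> bool" where
  "Aprime_at J iota G t f g \<longleftrightarrow>
     ((\<lambda>h. (1 / h) *\<^sub>R (toZ iota (gen J G (t + h) f) - toZ iota (gen J G t f))) \<longlongrightarrow> g)
       (at 0 within {h. t + h \<in> J})"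

definition Aprime_dom ::
  "real set \<Rightarrow> ('z::real_normed_vector \<Rightarrow>\<^sub>L 'y::real_normed_vector)
     \<Rightarrow> (real \<Rightarrow> real \<Rightarrow> 'y \<Rightarrow>\<^sub>L 'y) \<Rightarrow> 'y set" where
  "Aprime_dom J iota G =
     {f \<in> gen_dom_all J G \<inter> Y1 iota.
        (\<forall>t\<in>J. gen J G t f \<in> Y1 iota) \<and> (\<forall>t\<in>J. \<exists>g. Aprime_at J iota G t f g)}"

definition Aprime ::
  "real set \<Rightarrow> ('z::real_normed_vector \<Rightarrow>\<^sub>L 'y::real_normed_vector)
     \<Rightarrow> (real \<Rightarrow> real \<Rightarrow> 'y \<Rightarrow>\<^sub>L 'y) \<Rightarrow> real \<Rightarrow> 'y \<Rightarrow> 'y" where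
  "Aprime J iota G t f = iota (THE g. Aprime_at J iota G t f g)"

definition D1_at :: "(real \<Rightarrow> 'x \<Rightarrow> 'x \<Rightarrow> 'y::real_normed_vector \<Rightarrow>\<^sub>L 'y)
     \<Rightarrow> real \<Rightarrow> 'x \<Rightarrow> 'x \<Rightarrow> 'y \<Rightarrow> 'y \<Rightarrow> bool" where
  "D1_at D e x y f g \<longleftrightarrow>
     ((\<lambda>h. (1 / h) *\<^sub>R (D (e + h) x y f - D e x y f)) \<longlongrightarrow> g) (at 0 within {h. e + h \<in> {0..1}})"

definition D1dom :: "(real \<Rightarrow> 'x \<Rightarrow> 'x \<Rightarrow> 'y::real_normed_vector \<Rightarrow>\<^sub>L 'y) \<Rightarrow> 'y set" where
  "D1dom D = {f. \<forall>e\<in>{0..1}. \<forall>x y. \<exists>g. D1_at D e x y f g}"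

definition D1 :: "(real \<Rightarrow> 'x \<Rightarrow> 'x \<Rightarrow> 'y::real_normed_vector \<Rightarrow>\<^sub>L 'y) \<Rightarrow> real \<Rightarrow> 'x \<Rightarrow> 'x \<Rightarrow> 'y \<Rightarrow> 'y" where
  "D1 D e x y f = (THE g. D1_at D e x y f g)"

definition D2_at :: "(real \<Rightarrow> 'x \<Rightarrow> 'x \<Rightarrow> 'y::real_normed_vector \<Rightarrow>\<^sub>L 'y)
     \<Rightarrow> real \<Rightarrow> 'x \<Rightarrow> 'x \<Rightarrow> 'y \<Rightarrow> 'y \<Rightarrow> bool" where
  "D2_at D e x y f g \<longleftrightarrow>
     ((\<lambda>h. (1 / h) *\<^sub>R (D1 D (e + h) x y f - D1 D e x y f)) \<longlongrightarrow> g) (at 0 within {h. e + h \<in> {0..1}})"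

definition D2dom :: "(real \<Rightarrow> 'x \<Rightarrow> 'x \<Rightarrow> 'y::real_normed_vector \<Rightarrow>\<^sub>L 'y) \<Rightarrow> 'y set" where
  "D2dom D = {f \<in> D1dom D. \<forall>e\<in>{0..1}. \<forall>x y. \<exists>g. D2_at D e x y f g}"

definition D2 :: "(real \<Rightarrow> 'x \<Rightarrow> 'x \<Rightarrow> 'y::real_normed_vector \<Rightarrow>\<^sub>L 'y) \<Rightarrow> real \<Rightarrow> 'x \<Rightarrow> 'x \<Rightarrow> 'y \<Rightarrow> 'y" where
  "D2 D e x y f = (THE g. D2_at D e x y f g)"

definition D01_in_Y1 :: "('z::real_normed_vector \<Rightarrow>\<^sub>L 'y::real_normed_vector)
     \<Rightarrow> (real \<Rightarrow> 'x \<Rightarrow> 'x \<Rightarrow> 'y \<Rightarrow>\<^sub>L 'y) \<Rightarrow> 'y set" where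
  "D01_in_Y1 iota D = {f \<in> D1dom D \<inter> Y1 iota. \<forall>x y. D1 D 0 x y f \<in> Y1 iota}"

definition Dhat :: "real set \<Rightarrow> ('z::real_normed_vector \<Rightarrow>\<^sub>L 'y::real_normed_vector)
     \<Rightarrow> ('x \<Rightarrow> real \<Rightarrow> real \<Rightarrow> 'y \<Rightarrow>\<^sub>L 'y) \<Rightarrow> (real \<Rightarrow> 'x \<Rightarrow> 'x \<Rightarrow> 'y \<Rightarrow>\<^sub>L 'y) \<Rightarrow> 'y set" where
  "Dhat J iota Gs D = (\<Inter>x. Aprime_dom J iota (Gs x)) \<inter> D2dom D \<inter> D01_in_Y1 iota D"

definition conv_at_top :: "(real \<Rightarrow> real) \<Rightarrow> bool" where
  "conv_at_top g \<longleftrightarrow> (\<exists>l. (g \<longlongrightarrow> l) at_top)"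

definition semi_markov_kernel :: "('x::finite \<Rightarrow> 'x \<Rightarrow> real \<Rightarrow> real) \<Rightarrow> bool" where
  "semi_markov_kernel Q \<longleftrightarrow>
     (\<forall>x y. mono (Q x y) \<and> (\<forall>t. continuous (at_right t) (Q x y)) \<and> (\<forall>t<0. Q x y t = 0)
            \<and> conv_at_top (Q x y)) \<and>
     (\<forall>x. (\<Sum>y\<in>UNIV. Lim at_top (Q x y)) = 1)"


definition past_events ::
  "'w measure \<Rightarrow> (nat \<Rightarrow> 'w \<Rightarrow> 'x) \<Rightarrow> (nat \<Rightarrow> 'w \<Rightarrow> real) \<Rightarrow> nat \<Rightarrow> 'w set set" where
  "past_events M x T n = sigma_sets (space M)
     ((\<Union>k\<in>{..n}. {x k -` {a} \<inter> space M | a. True}) \<union>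
      (\<Union>k\<in>{..n}. {T k -` A \<inter> space M | A. A \<in> sets borel}))"

text \<open>(x_n, T_n) is a Markov renewal process with semi-Markov kernel Q:
  P[x_{n+1} = y, T_{n+1} - T_n <= t | x_k, T_k, k <= n] = Q(x_n, y, t), written out via the
  defining property of conditional probability. T_0 = 0 < T_1 < ... and N(t) finite
  (on the restricted full-measure sample space).\<close>
definition markov_renewal_process ::
  "'w measure \<Rightarrow> (nat \<Rightarrow> 'w \<Rightarrow> 'x) \<Rightarrow> (nat \<Rightarrow> 'w \<Rightarrow> real) \<Rightarrow> ('x \<Rightarrow> 'x \<Rightarrow> real \<Rightarrow> real) \<Rightarrow> bool" where
  "markov_renewal_process M x T Q \<longleftrightarrow>
     (\<forall>n. x n \<in> measurable M (count_space UNIV)) \<and> (\<forall>n. T n \<in> borel_measurable M) \<and>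
     (\<forall>\<omega>\<in>space M. T 0 \<omega> = 0 \<and> (\<forall>n. T n \<omega> < T (Suc n) \<omega>) \<and> (\<forall>t. finite {n. T n \<omega> \<le> t})) \<and>
     (\<forall>n y t. \<forall>B\<in>past_events M x T n.
        measure M ({\<omega>\<in>space M. x (Suc n) \<omega> = y \<and> T (Suc n) \<omega> - T n \<omega> \<le> t} \<inter> B)
          = (LINT \<omega>:B|M. Q (x n \<omega>) y t))"

definition emb_P :: "('x \<Rightarrow> 'x \<Rightarrow> real \<Rightarrow> real) \<Rightarrow> 'x \<Rightarrow> 'x \<Rightarrow> real" where
  "emb_P Q x y = Lim at_top (Q x y)"

primrec mpow :: "('x::finite \<Rightarrow> 'x \<Rightarrow> real) \<Rightarrow> nat \<Rightarrow> 'x \<Rightarrow> 'x \<Rightarrow> real" where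
  "mpow P 0 = (\<lambda>x y. if x = y then 1 else 0)"
| "mpow P (Suc n) = (\<lambda>x y. \<Sum>z\<in>UNIV. mpow P n x z * P z y)"

text \<open>Embedded chain aperiodic and uniformly ergodic with stationary distribution rho:
  || P^n - Pi || -> 0 (operator norm on bounded functions with the sup norm, i.e. max absolute
  row sum), where Pi(x,y) = rho_y.\<close>
definition embedded_chain_ergodic :: "('x::finite \<Rightarrow> 'x \<Rightarrow> real) \<Rightarrow> ('x \<Rightarrow> real) \<Rightarrow> bool" where
  "embedded_chain_ergodic P rho \<longleftrightarrow>
     (\<forall>y. 0 \<le> rho y) \<and> (\<Sum>y\<in>UNIV. rho y) = 1 \<and> (\<forall>y. (\<Sum>x\<in>UNIV. rho x * P x y) = rho y) \<and>
     (\<forall>x. Gcd {n. 0 < n \<and> 0 < mpow P n x x} = 1) \<and>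
     ((\<lambda>n. Max (range (\<lambda>x. \<Sum>y\<in>UNIV. \<bar>mpow P n x y - rho y\<bar>))) \<longlonglongrightarrow> 0)"

definition Ncount :: "(nat \<Rightarrow> 'w \<Rightarrow> real) \<Rightarrow> real \<Rightarrow> 'w \<Rightarrow> nat" where
  "Ncount T t \<omega> = Sup {n. T n \<omega> \<le> t}"

definition xproc :: "(nat \<Rightarrow> 'w \<Rightarrow> 'x) \<Rightarrow> (nat \<Rightarrow> 'w \<Rightarrow> real) \<Rightarrow> real \<Rightarrow> 'w \<Rightarrow> 'x" where
  "xproc x T t \<omega> = x (Ncount T t \<omega>) \<omega>"

definition Tfrom :: "(nat \<Rightarrow> 'w \<Rightarrow> real) \<Rightarrow> real \<Rightarrow> nat \<Rightarrow> 'w \<Rightarrow> real" where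
  "Tfrom T s k \<omega> = (if k = 0 then s else T (Ncount T s \<omega> + k) \<omega>)"

definition xfrom :: "(nat \<Rightarrow> 'w \<Rightarrow> 'x) \<Rightarrow> (nat \<Rightarrow> 'w \<Rightarrow> real) \<Rightarrow> real \<Rightarrow> nat \<Rightarrow> 'w \<Rightarrow> 'x" where
  "xfrom x T s k \<omega> = xproc x T (Tfrom T s k \<omega>) \<omega>"

primrec lprod :: "(nat \<Rightarrow> 'a::real_normed_vector \<Rightarrow>\<^sub>L 'a) \<Rightarrow> nat \<Rightarrow> 'a \<Rightarrow>\<^sub>L 'a" where
  "lprod B 0 = id_blinfun"
| "lprod B (Suc n) = lprod B n o\<^sub>L B (Suc n)"

definition Veps :: "('x \<Rightarrow> real \<Rightarrow> real \<Rightarrow> 'y::real_normed_vector \<Rightarrow>\<^sub>L 'y) \<Rightarrow> (real \<Rightarrow> 'x \<Rightarrow> 'x \<Rightarrow> 'y \<Rightarrow>\<^sub>L 'y)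
     \<Rightarrow> (nat \<Rightarrow> 'w \<Rightarrow> 'x) \<Rightarrow> (nat \<Rightarrow> 'w \<Rightarrow> real) \<Rightarrow> real \<Rightarrow> real \<Rightarrow> real \<Rightarrow> 'w \<Rightarrow> 'y \<Rightarrow>\<^sub>L 'y" where
  "Veps Gs D x T e s t \<omega> =
     (let tr = s + (t - s) / e;
          n = Ncount T tr \<omega> - Ncount T s \<omega>;
          Te = (\<lambda>k. s + e * (Tfrom T s k \<omega> - s));
          xs = (\<lambda>k. xfrom x T s k \<omega>)
      in lprod (\<lambda>k. Gs (xs (k - 1)) (Te (k - 1)) (Te k) o\<^sub>L D e (xs (k - 1)) (xs k)) n
           o\<^sub>L Gs (xproc x T tr \<omega>) (Te n) t)"

definition Fdist :: "('x::finite \<Rightarrow> 'x \<Rightarrow> real \<Rightarrow> real) \<Rightarrow> 'x \<Rightarrow> real \<Rightarrow> real" where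
  "Fdist Q x t = (\<Sum>y\<in>UNIV. Q x y t)"

definition m1 :: "('x::finite \<Rightarrow> 'x \<Rightarrow> real \<Rightarrow> real) \<Rightarrow> 'x \<Rightarrow> real" where
  "m1 Q x = (\<integral>t. t \<partial>(interval_measure (Fdist Q x)))"

definition Mrho :: "('x::finite \<Rightarrow> 'x \<Rightarrow> real \<Rightarrow> real) \<Rightarrow> ('x \<Rightarrow> real) \<Rightarrow> real" where
  "Mrho Q rho = (\<Sum>x\<in>UNIV. rho x * m1 Q x)"

definition a_avg :: "real set \<Rightarrow> ('x::finite \<Rightarrow> real \<Rightarrow> real \<Rightarrow> 'y::real_normed_vector \<Rightarrow>\<^sub>L 'y)
     \<Rightarrow> (real \<Rightarrow> 'x \<Rightarrow> 'x \<Rightarrow> 'y \<Rightarrow>\<^sub>L 'y) \<Rightarrow> ('x \<Rightarrow> 'x \<Rightarrow> real \<Rightarrow> real) \<Rightarrow> ('x \<Rightarrow> real)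
     \<Rightarrow> 'x \<Rightarrow> real \<Rightarrow> 'y \<Rightarrow> 'y" where
  "a_avg J Gs D Q rho x t f =
     (1 / Mrho Q rho) *\<^sub>R (m1 Q x *\<^sub>R gen J (Gs x) t f + (\<Sum>y\<in>UNIV. emb_P Q x y *\<^sub>R D1 D 0 x y f))"

definition Ahat :: "real set \<Rightarrow> ('x::finite \<Rightarrow> real \<Rightarrow> real \<Rightarrow> 'y::real_normed_vector \<Rightarrow>\<^sub>L 'y)
     \<Rightarrow> (real \<Rightarrow> 'x \<Rightarrow> 'x \<Rightarrow> 'y \<Rightarrow>\<^sub>L 'y) \<Rightarrow> ('x \<Rightarrow> 'x \<Rightarrow> real \<Rightarrow> real) \<Rightarrow> ('x \<Rightarrow> real)
     \<Rightarrow> real \<Rightarrow> 'y \<Rightarrow> 'y" where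
  "Ahat J Gs D Q rho t f = (\<Sum>x\<in>UNIV. rho x *\<^sub>R a_avg J Gs D Q rho x t f)"

definition A0 :: "real set \<Rightarrow> ('z::real_normed_vector \<Rightarrow>\<^sub>L 'y::{banach, second_countable_topology})
     \<Rightarrow> ('x::finite \<Rightarrow> real \<Rightarrow> real \<Rightarrow> 'y \<Rightarrow>\<^sub>L 'y) \<Rightarrow> (real \<Rightarrow> 'x \<Rightarrow> 'x \<Rightarrow> 'y \<Rightarrow>\<^sub>L 'y)
     \<Rightarrow> ('x \<Rightarrow> 'x \<Rightarrow> real \<Rightarrow> real) \<Rightarrow> bool" where
  "A0 J iota Gs D Q \<longleftrightarrow>
     \<comment> \<open>(a)\<close> Y1 iota \<subseteq> D1dom D \<and>
     \<comment> \<open>(b)\<close> (\<forall>x. regular J iota (Gs x)) \<and>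
     \<comment> \<open>(c)\<close> (\<forall>x. \<forall>f\<in>Y1 iota. continuous_on J (\<lambda>t. gen J (Gs x) t f)) \<and>
     \<comment> \<open>(d) Q(x,y,(tau,oo)) = 0\<close> (\<exists>tau>0. \<forall>x y. Q x y tau = emb_P Q x y) \<and>
     \<comment> \<open>(e)\<close> (\<forall>x. \<forall>(s, t)\<in>DeltaJ J. norm (Gs x s t) \<le> 1) \<and>
             (\<forall>e\<in>{0<..1}. \<forall>x y. norm (D e x y) \<le> 1) \<and>
     \<comment> \<open>(f)\<close> (\<forall>x. (\<forall>u\<in>J. bounded_linear (\<lambda>z. gen J (Gs x) u (iota z))) \<and>
                 (\<exists>C. \<forall>u\<in>J. \<forall>z. norm (gen J (Gs x) u (iota z)) \<le> C * norm z)) \<and>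
     \<comment> \<open>(g)\<close> (\<forall>f\<in>(\<Inter>x. Aprime_dom J iota (Gs x)).
                (\<exists>C. \<forall>u\<in>J. \<forall>x. norm (Aprime J iota (Gs x) u f) \<le> C) \<and>
                (\<exists>C. \<forall>u\<in>J. \<forall>x. norm (toZ iota (gen J (Gs x) u f)) \<le> C)) \<and>
     \<comment> \<open>(h)\<close> (\<forall>f\<in>D1dom D. \<exists>C. \<forall>e\<in>{0..1}. \<forall>x y. norm (D1 D e x y f) \<le> C) \<and>
     \<comment> \<open>(i)\<close> (\<forall>f\<in>D2dom D. \<exists>C. \<forall>e\<in>{0..1}. \<forall>x y. norm (D2 D e x y f) \<le> C)"

definition A1 :: "real set \<Rightarrow> ('z::real_normed_vector \<Rightarrow>\<^sub>L 'y::real_normed_vector) \<Rightarrow> 'w measure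
     \<Rightarrow> ('x \<Rightarrow> real \<Rightarrow> real \<Rightarrow> 'y \<Rightarrow>\<^sub>L 'y) \<Rightarrow> (real \<Rightarrow> 'x \<Rightarrow> 'x \<Rightarrow> 'y \<Rightarrow>\<^sub>L 'y)
     \<Rightarrow> (nat \<Rightarrow> 'w \<Rightarrow> 'x) \<Rightarrow> (nat \<Rightarrow> 'w \<Rightarrow> real) \<Rightarrow> bool" where
  "A1 J iota M Gs D x T \<longleftrightarrow>
     (\<forall>f\<in>Y1 iota. \<forall>s\<in>J. \<forall>\<Delta>\<in>{0<..1}. \<forall>Tm\<in>Jfrom J s. \<exists>K. compact K \<and>
        Liminf (at_right 0)
          (\<lambda>e. ereal (measure M {\<omega>\<in>space M. \<forall>t\<in>{s..Tm}. Veps Gs D x T e s t \<omega> f \<in> K}))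
        \<ge> ereal (1 - \<Delta>))"

definition A2 :: "real set \<Rightarrow> ('z::real_normed_vector \<Rightarrow>\<^sub>L 'y::real_normed_vector) \<Rightarrow> 'w measure
     \<Rightarrow> ('x::finite \<Rightarrow> real \<Rightarrow> real \<Rightarrow> 'y \<Rightarrow>\<^sub>L 'y) \<Rightarrow> (real \<Rightarrow> 'x \<Rightarrow> 'x \<Rightarrow> 'y \<Rightarrow>\<^sub>L 'y)
     \<Rightarrow> (nat \<Rightarrow> 'w \<Rightarrow> 'x) \<Rightarrow> (nat \<Rightarrow> 'w \<Rightarrow> real) \<Rightarrow> ('x \<Rightarrow> 'x \<Rightarrow> real \<Rightarrow> real) \<Rightarrow> ('x \<Rightarrow> real)
     \<Rightarrow> bool" where
  "A2 J iota M Gs D x T Q rho \<longleftrightarrow>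
     (\<forall>s\<in>J. \<forall>f\<in>Dhat J iota Gs D. \<forall>\<Delta>\<in>{0<..1}. \<forall>Tm\<in>Jfrom J s. \<exists>K. compact K \<and>
        Liminf (at_right 0)
          (\<lambda>e. ereal (measure M {\<omega>\<in>space M. \<forall>t\<in>{s..Tm}.
                 Veps Gs D x T e s t \<omega> (Ahat J Gs D Q rho t f) \<in> K}))
        \<ge> ereal (1 - \<Delta>))"

definition A3 :: "real set \<Rightarrow> ('z::real_normed_vector \<Rightarrow>\<^sub>L 'y::{banach, second_countable_topology})
     \<Rightarrow> ('x::finite \<Rightarrow> real \<Rightarrow> real \<Rightarrow> 'y \<Rightarrow>\<^sub>L 'y) \<Rightarrow> (real \<Rightarrow> 'x \<Rightarrow> 'x \<Rightarrow> 'y \<Rightarrow>\<^sub>L 'y)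
     \<Rightarrow> ('x \<Rightarrow> 'x \<Rightarrow> real \<Rightarrow> real) \<Rightarrow> ('x \<Rightarrow> real) \<Rightarrow> (real \<Rightarrow> real \<Rightarrow> 'y \<Rightarrow>\<^sub>L 'y) \<Rightarrow> bool" where
  "A3 J iota Gs D Q rho Gh \<longleftrightarrow>
     inhom_semigroup J Gh \<and> regular J iota Gh \<and>
     (\<forall>t\<in>J. \<forall>f\<in>Y1 iota. gen_at J Gh t f (Ahat J Gs D Q rho t f))"

definition rcll :: "real set \<Rightarrow> (real \<Rightarrow> 'a::topological_space) \<Rightarrow> bool" where
  "rcll I p \<longleftrightarrow>
     (\<forall>t\<in>I. continuous (at t within (I \<inter> {t..})) p \<and> (\<exists>l. (p \<longlongrightarrow> l) (at t within (I \<inter> {..<t}))))"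

definition time_changes :: "real set \<Rightarrow> (real \<Rightarrow> real) set" where
  "time_changes I = {lam. strict_mono_on I lam \<and> continuous_on I lam \<and> lam ` I = I}"

text \<open>Convergence in the Skorohod J1 topology (Ethier-Kurtz, Prop. 3.5.3; for a compact
  interval this is Billingsley's characterisation, taking T the right end point).\<close>
definition skorohod_conv :: "real set \<Rightarrow> (nat \<Rightarrow> real \<Rightarrow> 'a::metric_space) \<Rightarrow> (real \<Rightarrow> 'a) \<Rightarrow> bool" where
  "skorohod_conv I ps p \<longleftrightarrow>
     (\<exists>lam. (\<forall>n. lam n \<in> time_changes I) \<and>
        (\<forall>T\<in>I. \<forall>d>0. eventually (\<lambda>n. \<forall>t\<in>I. t \<le> T \<longrightarrow>
              \<bar>lam n t - t\<bar> < d \<and> dist (ps n t) (p (lam n t)) < d) sequentially))"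

text \<open>h is continuous on the Skorohod space D(I, E) (metrisable, so sequential continuity).\<close>
definition skorohod_continuous :: "real set \<Rightarrow> ((real \<Rightarrow> 'a::metric_space) \<Rightarrow> real) \<Rightarrow> bool" where
  "skorohod_continuous I h \<longleftrightarrow>
     (\<forall>ps p. (\<forall>n. rcll I (ps n)) \<and> rcll I p \<and> skorohod_conv I ps p \<longrightarrow> (\<lambda>n. h (ps n)) \<longlonglongrightarrow> h p)"

definition conv_distr_skorohod :: "'w measure \<Rightarrow> real set
     \<Rightarrow> (real \<Rightarrow> 'w \<Rightarrow> real \<Rightarrow> 'a::metric_space) \<Rightarrow> ('w \<Rightarrow> real \<Rightarrow> 'a) \<Rightarrow> bool" where
  "conv_distr_skorohod M I Xe X \<longleftrightarrow>
     (\<forall>e\<in>{0<..1}. \<forall>\<omega>\<in>space M. rcll I (Xe e \<omega>)) \<and> (\<forall>\<omega>\<in>space M. rcll I (X \<omega>)) \<and>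
     (\<forall>h. (\<exists>B. \<forall>p. rcll I p \<longrightarrow> \<bar>h p\<bar> \<le> B) \<and> skorohod_continuous I h \<longrightarrow>
        ((\<lambda>e. \<integral>\<omega>. h (Xe e \<omega>) \<partial>M) \<longlongrightarrow> (\<integral>\<omega>. h (X \<omega>) \<partial>M)) (at_right 0))"

end

theory Submission
  imports Defs
begin

text \<open>The convergence is established pathwise. By a strong law of large numbers for the Markov
  renewal process, on almost every path the rescaled occupation times and jump counts grow linearly
  with the averaged rates. On such a path the increment of \<open>V\<^sub>\<epsilon>(s, \<cdot>)f\<close> over a short interval
  \<open>[a, b]\<close> equals \<open>(b - a) V\<^sub>\<epsilon>(s, a) A(b) f\<close>, with \<open>A\<close> the averaged generator, up to an error
  that is small compared with \<open>b - a\<close> as \<open>\<epsilon> \<rightarrow> 0\<close>, for \<open>f\<close> in Dhat. Since \<open>V\<^sub>\<epsilon>\<close> is a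
  contraction, telescoping \<open>u \<mapsto> V\<^sub>\<epsilon>(s, u) \<Gamma>(u, t) f\<close>, with \<open>\<Gamma>\<close> the semigroup generated by
  \<open>A\<close>, turns this consistency into convergence \<open>V\<^sub>\<epsilon>(s, t) f \<rightarrow> \<Gamma>(s, t) f\<close>, uniformly on compact
  time intervals, and \<open>\<Gamma>\<close> inherits contractivity. Weak convergence follows by dominated
  convergence. A Skorohod continuous functional of the path is measurable because
  right-continuous paths with left limits are Skorohod limits of their step function
  discretisations on a grid, which depend continuously on countably many marginals.\<close>

text \<open>The obstacle is that consistency holds vector by vector, for vectors of Dhat, with a
  mesh depending on the vector. Dhat helps because the generator values and the \<open>D1\<close>
  values at 0 lie in \<open>Y1\<close>: the evolution moves them only slightly, so the operator in
  front of them can be frozen at the left end of an interval. Jumps cost no time but act by a vector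
  of order \<open>e\<close>, so local errors are measured in the clock \<open>u + e * N\<close>,
  whose increments converge to \<open>1 + 1 / mu\<close> times the length. Accuracy, net and mesh
  are chosen before \<open>e\<close>; only finitely many intervals then occur, hence finitely many
  thresholds for \<open>e\<close>. No uniform norm bound on the averaged semigroup is available
  beforehand, so the telescoping keeps \<open>V\<close> on the left and uses a backward expansion of
  the semigroup that involves no such bound. Passing from \<open>Y1\<close> to \<open>Y\<close>
  waits until contractivity is known. Measurability is a genuine point: weak convergence is stated
  with Bochner integrals of functionals assumed only bounded and sequentially continuous on regular
  paths.\<close>

section \<open>Analytic preliminaries\<close>

text \<open>A mean value inequality without derivatives, since generators provide only one-sided
  difference quotients. The slack \<open>e\<close> lets the last point at which the bound holds be
  pushed further to the right unless it is already \<open>b\<close>.\<close>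

lemma norm_diff_le_of_right_increments:
  fixes F :: "real \<Rightarrow> 'a::real_normed_vector"
  assumes ab: "a \<le> b" and cont: "continuous_on {a..b} F"
    and inc: "\<And>t e. a \<le> t \<Longrightarrow> t < b \<Longrightarrow> e > 0 \<Longrightarrow>
        eventually (\<lambda>u. norm (F u - F t) \<le> (B + e) * (u - t)) (at_right t)"
  shows "norm (F b - F a) \<le> B * (b - a)"
proof (rule field_le_epsilon)
  fix e' :: real assume e': "e' > 0"
  \<comment> \<open>The summand 1 keeps the quotient meaningful when \<open>a = b\<close>.\<close>
  define e where "e = e' / (b - a + 1)"
  have e: "e > 0" using e' ab by (simp add: e_def)
  define S where "S = {t \<in> {a..b}. norm (F t - F a) \<le> (B + e) * (t - a)}"
  have "closed S" unfolding S_def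
    by (intro continuous_closed_preimage_constant continuous_on_closed_Collect_le closed_atLeastAtMost
        continuous_intros cont)
  moreover have "a \<in> S" using ab by (simp add: S_def)
  moreover have bdd: "bdd_above S" by (auto simp: S_def bdd_above_def)
  ultimately have c: "Sup S \<in> S" using closed_contains_Sup by blast
  define c where "c = Sup S"
  have cS: "c \<in> S" using c by (simp add: c_def)
  have "c = b"
  proof (rule ccontr)
    assume "c \<noteq> b"
    with cS have cb: "a \<le> c" "c < b" by (auto simp: S_def)
    have "eventually (\<lambda>u. norm (F u - F c) \<le> (B + e) * (u - c) \<and> u < b \<and> c < u) (at_right c)"
      using inc[OF cb e] eventually_at_right_less[of c] cb
      by (auto simp: eventually_conj_iff eventually_at_right intro: exI[of _ b])
    then obtain u where u: "norm (F u - F c) \<le> (B + e) * (u - c)" "u < b" "c < u"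
      using eventually_happens[of _ "at_right c"] trivial_limit_at_right_real by blast
    have "norm (F u - F a) \<le> norm (F u - F c) + norm (F c - F a)"
      using norm_triangle_ineq[of "F u - F c" "F c - F a"] by simp
    also have "\<dots> \<le> (B + e) * (u - c) + (B + e) * (c - a)" using u cS by (auto simp: S_def)
    also have "\<dots> = (B + e) * (u - a)" by (simp add: algebra_simps)
    finally have "u \<in> S" using u cb by (auto simp: S_def)
    then have "u \<le> c" using bdd by (simp add: c_def cSup_upper)
    then show False using u by simp
  qed
  then have "norm (F b - F a) \<le> B * (b - a) + e * (b - a)"
    using cS by (simp add: S_def algebra_simps)
  also have "e * (b - a) \<le> e'" using e' ab by (simp add: e_def field_simps)
  finally show "norm (F b - F a) \<le> B * (b - a) + e'" by simp
qed

text \<open>By Baire, the open sets \<open>G n\<close> on which some operator exceeds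
  \<open>n\<close> cannot all be dense, since a common point would violate the pointwise bound.
  Hence the family is bounded by some \<open>n\<close> on a ball, and differences of points of that
  ball carry the bound to every direction.\<close>

lemma banach_steinhaus:
  fixes L :: "'i \<Rightarrow> 'a::banach \<Rightarrow> 'b::real_normed_vector"
  assumes lin: "\<And>i. i \<in> A \<Longrightarrow> bounded_linear (L i)"
    and ptw: "\<And>z. \<exists>C. \<forall>i\<in>A. norm (L i z) \<le> C"
  shows "\<exists>C\<ge>0. \<forall>i\<in>A. \<forall>z. norm (L i z) \<le> C * norm z"
proof -
  define G where "G n = (\<Union>i\<in>A. {z. norm (L i z) > real n})" for n :: nat
  have opn: "open (G n)" for n unfolding G_def
    by (intro open_UN ballI open_Collect_less continuous_intros linear_continuous_on lin)
  have "\<exists>n. closure (G n) \<noteq> UNIV"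
  proof (rule ccontr)
    assume "\<not> ?thesis"
    then have d: "closure (G n) = UNIV" for n by auto
    have "(euclidean :: 'a topology) closure_of \<Inter>(range G) = topspace euclidean"
      by (rule Baire_category) (use opn d in \<open>auto simp: completely_metrizable_space_euclidean\<close>)
    then have "\<Inter>(range G) \<noteq> {}" by auto
    then obtain z where z: "\<And>n. z \<in> G n" by blast
    obtain C where C: "\<forall>i\<in>A. norm (L i z) \<le> C" using ptw by blast
    obtain n where "C \<le> real n" using real_arch_simple by blast
    then show False using z[of n] C by (force simp: G_def)
  qed
  then obtain n z0 where "z0 \<notin> closure (G n)" by blast
  then obtain r where r: "r > 0" "ball z0 r \<inter> G n = {}"
    unfolding closure_approachable by (force simp: dist_commute)
  have b: "norm (L i z) \<le> real n" if "i \<in> A" "z \<in> ball z0 r" for i z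
    using r that by (force simp: G_def)
  have "norm (L i w) \<le> (4 * real n / r) * norm w" if i: "i \<in> A" for i w
  proof (cases "w = 0")
    case True then show ?thesis using lin[OF i] by (simp add: linear_simps)
  next
    case False
    \<comment> \<open>Moves \<open>z0\<close> by exactly \<open>r / 2\<close>, inside the ball;
      dividing \<open>2 * n\<close> by this factor gives \<open>4 * n / r\<close> times
      \<open>norm w\<close>.\<close>
    define k where "k = r / (2 * norm w)"
    have k: "k > 0" using r False by (simp add: k_def)
    have "z0 + k *\<^sub>R w \<in> ball z0 r" using r False by (simp add: dist_norm k_def)
    then have "norm (L i (z0 + k *\<^sub>R w)) \<le> real n" "norm (L i z0) \<le> real n" using b i r by auto
    then have "norm (k *\<^sub>R L i w) \<le> 2 * real n"
      using lin[OF i] norm_triangle_ineq4[of "L i (z0 + k *\<^sub>R w)" "L i z0"] by (simp add: linear_simps)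
    then have "k * norm (L i w) \<le> 2 * real n" using k by simp
    then show ?thesis using r False by (simp add: k_def field_simps)
  qed
  then show ?thesis using r by (intro exI[of _ "4 * real n / r"]) auto
qed

section \<open>Convergence in countable products\<close>

lemma tendsto_fun_iff:
  fixes f :: "'a \<Rightarrow> 'i \<Rightarrow> 'b::topological_space"
  shows "(f \<longlongrightarrow> l) F \<longleftrightarrow> (\<forall>i. ((\<lambda>a. f a i) \<longlongrightarrow> l i) F)"
  using limitin_componentwise[of "\<lambda>_. euclidean" UNIV f l F]
  by (simp add: euclidean_product_topology)

text \<open>The product metric is at most twice the largest distance among the first coordinates
  plus a geometric tail, so distances below \<open>d / 4\<close> in finitely many coordinates and a
  tail below \<open>d / 2\<close> suffice.\<close>

lemma eventually_uniformly_dist_fun_less: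
  fixes f :: "'a \<Rightarrow> 'c \<Rightarrow> nat \<Rightarrow> 'b::metric_space"
  assumes "\<And>k d. d > 0 \<Longrightarrow> eventually (\<lambda>n. \<forall>t\<in>S. dist (f n t k) (g t k) < d) F" and d: "d > 0"
  shows "eventually (\<lambda>n. \<forall>t\<in>S. dist (f n t) (g t) < d) F"
proof -
  obtain m :: nat where m: "(1/2)^m < d / 2" using d real_arch_pow_inv[of "d/2" "1/2"] by auto
  have "eventually (\<lambda>n. \<forall>j\<in>{..m}. \<forall>t\<in>S. dist (f n t (from_nat j)) (g t (from_nat j)) < d / 4) F"
    using assms(1)[of "d/4"] d by (intro eventually_ball_finite) auto
  then show ?thesis
  proof eventually_elim
    case (elim n)
    show ?case
    proof
      fix t assume t: "t \<in> S"
      have "Max {dist (f n t (from_nat j)) (g t (from_nat j)) |j. j \<le> m} < d / 4"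
        using elim t by (subst Max_less_iff) auto
      then show "dist (f n t) (g t) < d"
        using dist_fun_le_dist_first_terms[of "f n t" "g t" m] m by linarith
    qed
  qed
qed

section \<open>Skorohod convergence and measurability\<close>

text \<open>\<open>skorohod_conv\<close> asks for one sequence of time changes serving every horizon
  and every precision. A diagonal choice produces it: at index \<open>n\<close>, take a time change
  for the best level up to \<open>n\<close> that is attained there.\<close>

lemma skorohod_convI:
  assumes "\<And>T d. d > 0 \<Longrightarrow> eventually (\<lambda>n. \<exists>lam\<in>time_changes I. \<forall>t\<in>I. t \<le> T \<longrightarrow>
              \<bar>lam t - t\<bar> < d \<and> dist (ps n t) (p (lam t)) < d) sequentially"
  shows "skorohod_conv I ps p"
proof -
  define R where "R n j lam \<longleftrightarrow> lam \<in> time_changes I \<and> (\<forall>t\<in>I. t \<le> real j \<longrightarrow>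
      \<bar>lam t - t\<bar> < 1 / (real j + 1) \<and> dist (ps n t) (p (lam t)) < 1 / (real j + 1))" for n j lam
  have id: "(\<lambda>t. t) \<in> time_changes I" by (auto simp: time_changes_def strict_mono_on_def)
  have ev: "eventually (\<lambda>n. \<exists>lam. R n j lam) sequentially" for j
    using assms[of "1 / (real j + 1)" "real j"] by (simp add: R_def Bex_def)
  \<comment> \<open>The bound \<open>j \<le> n\<close> makes the set finite and the inserted 0 makes
    it nonempty; level 0 itself need not be attained.\<close>
  define k where "k n = Max (insert 0 {j. j \<le> n \<and> (\<exists>lam. R n j lam)})" for n
  \<comment> \<open>The identity is the default while no level is attained.\<close>
  have "\<exists>lam\<in>time_changes I. (\<exists>lam. R n (k n) lam) \<longrightarrow> R n (k n) lam" for n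
    using id by (cases "\<exists>lam. R n (k n) lam") (auto simp: R_def)
  then obtain L where L: "\<And>n. L n \<in> time_changes I" "\<And>n. (\<exists>lam. R n (k n) lam) \<Longrightarrow> R n (k n) (L n)"
    by metis
  have "eventually (\<lambda>n. \<forall>t\<in>I. t \<le> T \<longrightarrow> \<bar>L n t - t\<bar> < d \<and> dist (ps n t) (p (L n t)) < d) sequentially"
    if d: "d > 0" for T d
  proof -
    obtain j1 j2 :: nat where j1: "T \<le> real j1" and j2: "1 / (real j2 + 1) < d"
      using real_arch_simple[of T] nat_approx_posE[OF d] by (metis add.commute of_nat_Suc)
    define j where "j = max j1 j2"
    have jd: "1 / (real i + 1) < d" if "i \<ge> j" for i
    proof -
      have "1 / (real i + 1) \<le> 1 / (real j2 + 1)" using that by (intro divide_left_mono) (auto simp: j_def)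
      then show ?thesis using j2 by simp
    qed
    show ?thesis using ev[of j] eventually_ge_at_top[of j]
    proof eventually_elim
      case (elim n)
      have fin: "finite (insert 0 {j. j \<le> n \<and> (\<exists>lam. R n j lam)})" by auto
      have kj: "k n \<ge> j" unfolding k_def using elim fin by (intro Max_ge) auto
      have "k n \<in> insert 0 {j. j \<le> n \<and> (\<exists>lam. R n j lam)}" unfolding k_def using fin by (intro Max_in) auto
      then have "\<exists>lam. R n (k n) lam" using elim kj by auto
      then have R: "R n (k n) (L n)" by (rule L)
      show ?case
      proof (intro ballI impI)
        fix t assume "t \<in> I" "t \<le> T"
        moreover have "T \<le> real (k n)" using kj j1 by (simp add: j_def)
        ultimately show "\<bar>L n t - t\<bar> < d \<and> dist (ps n t) (p (L n t)) < d"
          using R jd[OF kj] unfolding R_def by force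
      qed
    qed
  qed
  then show ?thesis using L(1) unfolding skorohod_conv_def by blast
qed

lemma skorohod_conv_uniform:
  assumes "\<And>T d. d > 0 \<Longrightarrow> eventually (\<lambda>n. \<forall>t\<in>I. t \<le> T \<longrightarrow> dist (ps n t) (p t) < d) sequentially"
  shows "skorohod_conv I ps p"
proof (rule skorohod_convI)
  fix T d :: real assume "d > 0"
  then show "eventually (\<lambda>n. \<exists>lam\<in>time_changes I. \<forall>t\<in>I. t \<le> T \<longrightarrow>
              \<bar>lam t - t\<bar> < d \<and> dist (ps n t) (p (lam t)) < d) sequentially"
    using assms[of d T]
    by (auto elim!: eventually_mono intro!: bexI[of _ "\<lambda>t. t"] simp: time_changes_def strict_mono_on_def)
qed

lemma skorohod_continuousD:
  assumes "skorohod_continuous I F" "\<And>n. rcll I (ps n)" "rcll I p" "skorohod_conv I ps p"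
  shows "(\<lambda>n. F (ps n)) \<longlonglongrightarrow> F p"
  using assms by (simp add: skorohod_continuous_def)

text \<open>A path with left limits has finitely many large oscillations on a compact interval;
  bisection reduces this to one point, where the right value controls one side and the left limit
  the other. The interval is half-open because the value at a jump belongs to the piece on its
  right.\<close>

lemma rcll_finite_partition:
  fixes p :: "real \<Rightarrow> 'a::metric_space"
  assumes p: "rcll I p" and ab: "a \<le> b" "{a..b} \<subseteq> I" and d: "d > 0"
  shows "\<exists>A. finite A \<and> (\<forall>u v. a \<le> u \<and> u \<le> v \<and> v \<le> b \<and> {u<..v} \<inter> A = {} \<longrightarrow> dist (p u) (p v) < d)"
proof -
  \<comment> \<open>Bisection also produces local intervals that stick out of \<open>{a..b}\<close>,
    hence the restriction on \<open>u\<close> and \<open>v\<close>.\<close>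
  define P where "P a' b' \<longleftrightarrow> (\<exists>A. finite A \<and> (\<forall>u v. u \<in> {a..b} \<and> v \<in> {a..b} \<and> a' \<le> u \<and> u \<le> v \<and> v \<le> b'
      \<and> {u<..v} \<inter> A = {} \<longrightarrow> dist (p u) (p v) < d))" for a' b'
  have "P a b" using ab(1)
  proof (induction rule: Bolzano)
    case (trans x y z)
    then obtain A B where A: "finite A" "\<And>u v. u \<in> {a..b} \<Longrightarrow> v \<in> {a..b} \<Longrightarrow> x \<le> u \<Longrightarrow> u \<le> v \<Longrightarrow> v \<le> y
      \<Longrightarrow> {u<..v} \<inter> A = {} \<Longrightarrow> dist (p u) (p v) < d"
      and B: "finite B" "\<And>u v. u \<in> {a..b} \<Longrightarrow> v \<in> {a..b} \<Longrightarrow> y \<le> u \<Longrightarrow> u \<le> v \<Longrightarrow> v \<le> z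
      \<Longrightarrow> {u<..v} \<inter> B = {} \<Longrightarrow> dist (p u) (p v) < d"
      unfolding P_def by metis
    show ?case unfolding P_def
    proof (intro exI[of _ "insert y (A \<union> B)"] conjI allI impI)
      show "finite (insert y (A \<union> B))" using A B by simp
      fix u v assume uv: "u \<in> {a..b} \<and> v \<in> {a..b} \<and> x \<le> u \<and> u \<le> v \<and> v \<le> z \<and> {u<..v} \<inter> insert y (A \<union> B) = {}"
      then have "y \<notin> {u<..v}" by blast
      then consider "v \<le> y" | "y \<le> u" using uv by fastforce
      then show "dist (p u) (p v) < d"
      proof cases
        case 1 show ?thesis by (rule A(2)) (use uv 1 in auto)
      next
        case 2 show ?thesis by (rule B(2)) (use uv 2 in auto)
      qed
    qed
  next
    case (local y)
    then have yI: "y \<in> I" using ab by auto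
    then obtain l where r: "continuous (at y within (I \<inter> {y..})) p" and l: "(p \<longlongrightarrow> l) (at y within (I \<inter> {..<y}))"
      using p by (auto simp: rcll_def)
    obtain d1 where d1: "d1 > 0" "\<And>u. u \<in> I \<Longrightarrow> u \<ge> y \<Longrightarrow> dist u y < d1 \<Longrightarrow> dist (p u) (p y) < d / 2"
      using r d unfolding continuous_within_eps_delta by (metis IntI atLeast_iff half_gt_zero)
    have "eventually (\<lambda>u. dist (p u) l < d / 2) (at y within (I \<inter> {..<y}))"
      using l d unfolding tendsto_iff by (meson half_gt_zero)
    then obtain d2 where d2: "d2 > 0" "\<And>u. u \<in> I \<Longrightarrow> u < y \<Longrightarrow> dist u y < d2 \<Longrightarrow> dist (p u) l < d / 2"
      unfolding eventually_at by auto
    show ?case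
    proof (intro exI[of _ "min d1 d2"] conjI allI impI)
      show "0 < min d1 d2" using d1 d2 by simp
      fix a' b' assume asm: "a' \<le> y \<and> y \<le> b' \<and> b' - a' < min d1 d2"
      show "P a' b'" unfolding P_def
      proof (intro exI[of _ "{y}"] conjI allI impI)
        fix u v assume uv: "u \<in> {a..b} \<and> v \<in> {a..b} \<and> a' \<le> u \<and> u \<le> v \<and> v \<le> b' \<and> {u<..v} \<inter> {y} = {}"
        have I: "u \<in> I" "v \<in> I" using uv ab by auto
        have du: "dist u y < min d1 d2" "dist v y < min d1 d2" using uv asm by (auto simp: dist_real_def)
        have "y \<notin> {u<..v}" using uv by blast
        then consider "v < y" | "y \<le> u" using uv by fastforce
        then show "dist (p u) (p v) < d"
        proof cases
          case 1
          then have "dist (p u) l < d / 2" "dist (p v) l < d / 2" using d2(2) I uv du by auto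
          then show ?thesis using dist_triangle_half_l by blast
        next
          case 2
          then have "dist (p u) (p y) < d / 2" "dist (p v) (p y) < d / 2" using d1(2) I uv du by auto
          then show ?thesis using dist_triangle_half_l by blast
        qed
      qed simp
    qed
  qed
  then obtain A where A: "finite A" "\<And>u v. u \<in> {a..b} \<Longrightarrow> v \<in> {a..b} \<Longrightarrow> a \<le> u \<Longrightarrow> u \<le> v \<Longrightarrow> v \<le> b
      \<Longrightarrow> {u<..v} \<inter> A = {} \<Longrightarrow> dist (p u) (p v) < d" unfolding P_def by metis
  show ?thesis by (rule exI[of _ A]) (use A in auto)
qed

text \<open>Here \<open>g \<alpha>\<close> stands for the first grid point at or after the partition
  point \<open>\<alpha>\<close>. Moving it back to \<open>\<alpha>\<close> aligns the jumps of a
  discretised path with those of the path itself; a compact interval must keep its right end fixed,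
  hence the condition on \<open>b\<close>.\<close>

lemma time_change_shift:
  fixes A :: "real set" and g :: "real \<Rightarrow> real"
  assumes I: "I = {s..} \<or> (\<exists>b\<ge>s. I = {s..b} \<and> b \<in> A \<and> g b = b)"
    and A: "finite A" "s \<in> A" "g s = s"
    and g: "\<And>\<alpha>. \<alpha> \<in> A \<Longrightarrow> \<alpha> \<le> g \<alpha>" "\<And>\<alpha>. \<alpha> \<in> A \<Longrightarrow> g \<alpha> - \<alpha> \<le> h" "h > 0"
    and w: "w > 0" "\<And>\<alpha> \<beta>. \<alpha> \<in> A \<Longrightarrow> \<beta> \<in> A \<Longrightarrow> \<alpha> \<noteq> \<beta> \<Longrightarrow> 2 * w \<le> \<bar>\<alpha> - \<beta>\<bar>"
    and h: "h \<le> w" "real (card A) * h < w"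
  shows "\<exists>lam\<in>time_changes I. strict_mono lam \<and> (\<forall>\<alpha>\<in>A. lam (g \<alpha>) = \<alpha>) \<and>
           (\<forall>t. lam t \<le> t \<and> t - lam t \<le> real (card A) * h)"
proof -
  \<comment> \<open>The shift is a sum of tents centred at the points g \<open>\<alpha>\<close>. Its Lipschitz constant is below 1,
    so subtracting it from the identity preserves strict monotonicity.\<close>
  define hat where "hat \<alpha> t = max 0 (1 - \<bar>t - g \<alpha>\<bar> / w)" for \<alpha> t
  define \<phi> where "\<phi> t = (\<Sum>\<alpha>\<in>A. (g \<alpha> - \<alpha>) * hat \<alpha> t)" for t
  have hat01: "0 \<le> hat \<alpha> t" "hat \<alpha> t \<le> 1" for \<alpha> t using w by (auto simp: hat_def)
  have hat_lip: "\<bar>hat \<alpha> t - hat \<alpha> u\<bar> \<le> \<bar>t - u\<bar> / w" for \<alpha> t u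
  proof -
    have "\<bar>hat \<alpha> t - hat \<alpha> u\<bar> \<le> \<bar>\<bar>t - g \<alpha>\<bar> / w - \<bar>u - g \<alpha>\<bar> / w\<bar>"
      unfolding hat_def by linarith
    also have "\<dots> = \<bar>\<bar>t - g \<alpha>\<bar> - \<bar>u - g \<alpha>\<bar>\<bar> / w" using w by (simp add: diff_divide_distrib[symmetric] abs_divide)
    also have "\<dots> \<le> \<bar>t - u\<bar> / w" using w by (intro divide_right_mono) auto
    finally show ?thesis .
  qed
  have phi0: "0 \<le> \<phi> t" for t unfolding \<phi>_def using g hat01 by (intro sum_nonneg mult_nonneg_nonneg) auto
  have phi1: "\<phi> t \<le> real (card A) * h" for t
  proof -
    have "\<phi> t \<le> (\<Sum>\<alpha>\<in>A. h * 1)" unfolding \<phi>_def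
      using g hat01 by (intro sum_mono mult_mono) auto
    then show ?thesis by simp
  qed
  have lip: "\<bar>\<phi> t - \<phi> u\<bar> \<le> (real (card A) * h / w) * \<bar>t - u\<bar>" for t u
  proof -
    have "\<bar>\<phi> t - \<phi> u\<bar> = \<bar>\<Sum>\<alpha>\<in>A. (g \<alpha> - \<alpha>) * (hat \<alpha> t - hat \<alpha> u)\<bar>"
      by (simp add: \<phi>_def sum_subtractf right_diff_distrib)
    also have "\<dots> \<le> (\<Sum>\<alpha>\<in>A. \<bar>(g \<alpha> - \<alpha>) * (hat \<alpha> t - hat \<alpha> u)\<bar>)" by (rule sum_abs)
    also have "\<dots> \<le> (\<Sum>\<alpha>\<in>A. h * (\<bar>t - u\<bar> / w))"
      unfolding abs_mult using g hat_lip by (intro sum_mono mult_mono) auto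
    finally show ?thesis by simp
  qed
  define lam where "lam t = t - \<phi> t" for t
  have sm: "lam t < lam u" if "t < u" for t u
  proof -
    have "\<phi> u - \<phi> t \<le> (real (card A) * h / w) * (u - t)" using lip[of u t] that by auto
    also have "\<dots> < 1 * (u - t)" using that h w by (intro mult_strict_right_mono) auto
    finally show ?thesis by (simp add: lam_def)
  qed
  have cont: "continuous_on S lam" for S
    unfolding lam_def \<phi>_def hat_def using w by (intro continuous_intros) auto
  have lg: "lam (g \<alpha>) = \<alpha>" if "\<alpha> \<in> A" for \<alpha>
  proof -
    \<comment> \<open>The shifted centres stay at least \<open>2 * w - h \<ge> w\<close> apart, so
      each tent vanishes at all other centres.\<close>
    have "hat \<beta> (g \<alpha>) = 0" if b: "\<beta> \<in> A" "\<beta> \<noteq> \<alpha>" for \<beta>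
    proof -
      have "\<bar>g \<alpha> - g \<beta>\<bar> \<ge> w" using w(2)[OF \<open>\<alpha> \<in> A\<close> b(1)] g(1,2)[OF \<open>\<alpha> \<in> A\<close>] g(1,2)[OF b(1)] h b by linarith
      then show ?thesis using w by (simp add: hat_def field_simps)
    qed
    then have "\<phi> (g \<alpha>) = (\<Sum>\<beta>\<in>A. if \<beta> = \<alpha> then g \<alpha> - \<alpha> else 0)"
      unfolding \<phi>_def by (intro sum.cong) (auto simp: hat_def)
    then show ?thesis using A that by (simp add: lam_def)
  qed
  have ls: "lam s = s" using lg[OF A(2)] A(3) by simp
  have "lam ` I = I" using I
  proof (elim disjE exE conjE)
    assume I: "I = {s..}"
    show ?thesis
    proof safe
      fix t assume "t \<in> I" then show "lam t \<in> I" using sm[of s t] ls I by (cases "s = t") auto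
    next
      fix y assume y: "y \<in> I"
      have "lam s \<le> y" "y \<le> lam (y + real (card A) * h)" "s \<le> y + real (card A) * h"
        using y I ls phi1[of "y + real (card A) * h"] g(3) by (auto simp: lam_def intro: add_increasing2)
      then obtain t where "t \<ge> s" "lam t = y" using IVT'[of lam s y] cont by blast
      then show "y \<in> lam ` I" using I by auto
    qed
  next
    fix b assume b: "b \<ge> s" "I = {s..b}" "b \<in> A" "g b = b"
    have lb: "lam b = b" using lg[OF b(3)] b by simp
    show ?thesis
    proof safe
      fix t assume "t \<in> I" then show "lam t \<in> I" using sm[of s t] sm[of t b] ls lb b by (cases "s = t"; cases "t = b") auto
    next
      fix y assume y: "y \<in> I"
      then obtain t where "t \<ge> s" "t \<le> b" "lam t = y" using IVT'[of lam s y b] cont ls lb b by auto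
      then show "y \<in> lam ` I" using b by auto
    qed
  qed
  then have "lam \<in> time_changes I" using sm cont by (auto simp: time_changes_def strict_mono_on_def)
  then show ?thesis using sm lg phi0 phi1
    by (intro bexI[of _ lam] conjI) (auto simp: strict_mono_def lam_def)
qed

text \<open>The discretised path passes a partition point only at the next grid point, so after the
  time change both paths are read in the same cell of the partition. On a compact interval the right
  end must be a grid point, because every time change fixes it.\<close>

lemma rcll_grid_approximation:
  fixes p :: "real \<Rightarrow> 'a::metric_space"
  assumes I: "I = {s..} \<or> (\<exists>b\<ge>s. I = {s..b})" and p: "rcll I p" and d: "d > 0"
  shows "\<exists>H>0. \<forall>h. 0 < h \<and> h < H \<and> (\<forall>b\<ge>s. I = {s..b} \<longrightarrow> (\<exists>m::int. b - s = h * of_int m)) \<longrightarrow>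
    (\<exists>lam\<in>time_changes I. \<forall>t\<in>I. t \<le> T \<longrightarrow>
       \<bar>lam t - t\<bar> < d \<and> dist (p (s + h * of_int \<lfloor>(t - s) / h\<rfloor>)) (p (lam t)) < d)"
proof -
  \<comment> \<open>For a compact interval the horizon is forced to be its right end, so that this
    point enters \<open>A\<close> and stays fixed under the time change.\<close>
  obtain T0 where T0: "s \<le> T0" "{s..T0} \<subseteq> I" "\<And>t. t \<in> I \<Longrightarrow> t \<le> T \<Longrightarrow> t \<le> T0" "\<And>b. b \<ge> s \<Longrightarrow> I = {s..b} \<Longrightarrow> T0 = b"
  proof (cases "I = {s..}")
    case True
    have "I \<noteq> {s..b}" for b
    proof
      assume "I = {s..b}"
      moreover have "max s b + 1 \<in> I" using True by auto
      ultimately show False by auto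
    qed
    then show ?thesis using True by (intro that[of "max s T"]) auto
  next
    case False
    then obtain b where b: "b \<ge> s" "I = {s..b}" using I by auto
    show ?thesis by (rule that[of b]) (use b in \<open>auto simp: Icc_eq_Icc\<close>)
  qed
  obtain A0 where A0: "finite A0" "\<And>u v. s \<le> u \<Longrightarrow> u \<le> v \<Longrightarrow> v \<le> T0 \<Longrightarrow> {u<..v} \<inter> A0 = {} \<Longrightarrow> dist (p u) (p v) < d"
    using rcll_finite_partition[OF p T0(1,2) d] by blast
  define A where "A = insert s (insert T0 (A0 \<inter> {s..T0}))"
  have A: "finite A" "s \<in> A" "T0 \<in> A" using A0 by (auto simp: A_def)
  have part: "dist (p u) (p v) < d" if "s \<le> u" "s \<le> v" "u \<le> T0" "v \<le> T0" "\<And>\<alpha>. \<alpha> \<in> A \<Longrightarrow> \<alpha> \<le> u \<longleftrightarrow> \<alpha> \<le> v" for u v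
  proof (cases "u \<le> v")
    case True
    have "{u<..v} \<inter> A0 = {}"
    proof safe
      fix \<alpha> assume a: "\<alpha> \<in> {u<..v}" "\<alpha> \<in> A0"
      then have "\<alpha> \<in> A" using that(1-4) by (auto simp: A_def)
      then show "\<alpha> \<in> {}" using that(5)[of \<alpha>] a by (metis greaterThanAtMost_iff not_le)
    qed
    then show ?thesis using A0(2) True that by auto
  next
    case False
    have "{v<..u} \<inter> A0 = {}"
    proof safe
      fix \<alpha> assume a: "\<alpha> \<in> {v<..u}" "\<alpha> \<in> A0"
      then have "\<alpha> \<in> A" using that(1-4) by (auto simp: A_def)
      then show "\<alpha> \<in> {}" using that(5)[of \<alpha>] a by (metis greaterThanAtMost_iff not_le)
    qed
    then show ?thesis using A0(2)[of v u] False that by (auto simp: dist_commute)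
  qed
  \<comment> \<open>The inserted 1 covers a partition with a single point.\<close>
  define W where "W = insert 1 ((\<lambda>(\<alpha>, \<beta>). \<bar>\<alpha> - \<beta>\<bar> / 2) ` (A \<times> A) - {0})"
  have W: "finite W" "W \<noteq> {}" "\<And>x. x \<in> W \<Longrightarrow> x > 0" using A by (auto simp: W_def)
  define w where "w = Min W"
  have w: "w > 0" using W by (simp add: w_def)
  have w2: "2 * w \<le> \<bar>\<alpha> - \<beta>\<bar>" if "\<alpha> \<in> A" "\<beta> \<in> A" "\<alpha> \<noteq> \<beta>" for \<alpha> \<beta>
  proof -
    have "\<bar>\<alpha> - \<beta>\<bar> / 2 \<in> W" using that by (auto simp: W_def)
    then have "w \<le> \<bar>\<alpha> - \<beta>\<bar> / 2" unfolding w_def using W(1) by (rule Min_le[rotated])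
    then show ?thesis by simp
  qed
  define c where "c = real (card A)"
  have c: "c > 0" using A by (auto simp: c_def card_gt_0_iff)
  \<comment> \<open>The three bounds give \<open>h \<le> w\<close>, a shift with Lipschitz constant
    below 1, and a total displacement below \<open>d\<close>.\<close>
  define H where "H = min w (min (w / c) (d / c))"
  have H: "H > 0" using w c d by (simp add: H_def)
  show ?thesis
  proof (intro exI[of _ H] conjI allI impI H)
    fix h assume h: "0 < h \<and> h < H \<and> (\<forall>b\<ge>s. I = {s..b} \<longrightarrow> (\<exists>m::int. b - s = h * of_int m))"
    have h0: "h > 0" "h \<le> w" "c * h < w" "c * h < d" using h c by (auto simp: H_def field_simps)
    define g where "g \<alpha> = s + h * of_int \<lceil>(\<alpha> - s) / h\<rceil>" for \<alpha>
    have g1: "\<alpha> \<le> g \<alpha>" for \<alpha>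
    proof -
      have "(\<alpha> - s) / h \<le> of_int \<lceil>(\<alpha> - s) / h\<rceil>" by simp
      then show ?thesis unfolding g_def pos_divide_le_eq[OF h0(1)] by (simp add: mult.commute)
    qed
    have g2: "g \<alpha> - \<alpha> \<le> h" for \<alpha>
    proof -
      have "of_int \<lceil>(\<alpha> - s) / h\<rceil> \<le> (\<alpha> - s) / h + 1" by linarith
      then have "h * of_int \<lceil>(\<alpha> - s) / h\<rceil> \<le> h * ((\<alpha> - s) / h + 1)" using h0 by (intro mult_left_mono) auto
      also have "\<dots> = \<alpha> - s + h" using h0 by (simp add: distrib_left)
      finally show ?thesis by (simp add: g_def)
    qed
    have gs: "g s = s" by (simp add: g_def)
    have "I = {s..} \<or> (\<exists>b\<ge>s. I = {s..b} \<and> b \<in> A \<and> g b = b)"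
      using I
    proof
      assume "\<exists>b\<ge>s. I = {s..b}"
      then obtain b where b: "b \<ge> s" "I = {s..b}" by blast
      then obtain m :: int where m: "b - s = h * of_int m" using h by blast
      then have "(b - s) / h = of_int m" using h0 by simp
      then have "g b = b" using m by (simp add: g_def)
      moreover have "b \<in> A" using T0(4) b A by auto
      ultimately show ?thesis using b by auto
    qed simp
    then obtain lam where lam: "lam \<in> time_changes I" "strict_mono lam" "\<And>\<alpha>. \<alpha> \<in> A \<Longrightarrow> lam (g \<alpha>) = \<alpha>"
      "\<And>t. lam t \<le> t" "\<And>t. t - lam t \<le> c * h"
      using time_change_shift[of I s A g h w] A gs g1 g2 h0 w w2 unfolding c_def by blast
    show "\<exists>lam\<in>time_changes I. \<forall>t\<in>I. t \<le> T \<longrightarrow>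
       \<bar>lam t - t\<bar> < d \<and> dist (p (s + h * of_int \<lfloor>(t - s) / h\<rfloor>)) (p (lam t)) < d"
    proof (intro bexI[of _ lam] ballI impI lam(1))
      fix t assume t: "t \<in> I" "t \<le> T"
      define q where "q = s + h * of_int \<lfloor>(t - s) / h\<rfloor>"
      have st: "s \<le> t" using t I by auto
      have "of_int \<lfloor>(t - s) / h\<rfloor> \<le> (t - s) / h" by simp
      then have qt: "q \<le> t" unfolding q_def pos_le_divide_eq[OF h0(1)] by (simp add: mult.commute)
      have sq: "s \<le> q" using st h0 by (simp add: q_def)
      have "lam s = s" using lam(3)[OF A(2)] gs by simp
      then have sl: "s \<le> lam t" using lam(2) st by (metis strict_mono_less_eq)
      \<comment> \<open>No partition point separates the grid point q from lam t.\<close>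
      have eq: "\<alpha> \<le> q \<longleftrightarrow> \<alpha> \<le> lam t" if a: "\<alpha> \<in> A" for \<alpha>
      proof -
        have "\<alpha> \<le> q \<longleftrightarrow> (\<alpha> - s) / h \<le> of_int \<lfloor>(t - s) / h\<rfloor>"
          unfolding q_def pos_divide_le_eq[OF h0(1)] by (auto simp: mult.commute)
        also have "\<dots> \<longleftrightarrow> \<lceil>(\<alpha> - s) / h\<rceil> \<le> \<lfloor>(t - s) / h\<rfloor>" by (simp add: ceiling_le_iff)
        also have "\<dots> \<longleftrightarrow> of_int \<lceil>(\<alpha> - s) / h\<rceil> \<le> (t - s) / h" by (simp add: le_floor_iff)
        also have "\<dots> \<longleftrightarrow> g \<alpha> \<le> t"
          unfolding g_def pos_le_divide_eq[OF h0(1)] by (auto simp: mult.commute)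
        also have "\<dots> \<longleftrightarrow> lam (g \<alpha>) \<le> lam t" using lam(2) by (simp add: strict_mono_less_eq)
        finally show ?thesis using lam(3)[OF a] by simp
      qed
      have tT: "t \<le> T0" using T0(3) t by auto
      have "dist (p q) (p (lam t)) < d"
        by (rule part) (use sq sl qt lam(4)[of t] tT eq in auto)
      then show "\<bar>lam t - t\<bar> < d \<and> dist (p (s + h * of_int \<lfloor>(t - s) / h\<rfloor>)) (p (lam t)) < d"
        using lam(4,5)[of t] h0 by (simp add: q_def)
    qed
  qed
qed

section \<open>Measurability of Skorohod continuous functionals\<close>

lemma rcll_step:
  fixes v :: "nat \<Rightarrow> 'a::metric_space" and h :: real
  assumes h: "h > 0"
  shows "rcll I (\<lambda>t. v (nat \<lfloor>(t - s) / h\<rfloor>))"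
  unfolding rcll_def
proof (intro ballI conjI)
  fix t assume "t \<in> I"
  define m where "m = \<lfloor>(t - s) / h\<rfloor>"
  have "eventually (\<lambda>u. u < s + h * (of_int m + 1)) (at t within (I \<inter> {t..}))"
  proof -
    have "(t - s) / h < of_int m + 1" unfolding m_def by linarith
    then have "t < s + h * (of_int m + 1)" using h by (simp add: field_simps)
    then show ?thesis by (rule order_tendstoD(2)[OF tendsto_ident_at])
  qed
  moreover have "eventually (\<lambda>u. t \<le> u) (at t within (I \<inter> {t..}))"
    by (auto simp: eventually_at_filter)
  ultimately have "eventually (\<lambda>u. v (nat \<lfloor>(u - s) / h\<rfloor>) = v (nat \<lfloor>(t - s) / h\<rfloor>)) (at t within (I \<inter> {t..}))"
  proof eventually_elim
    case (elim u)
    have "of_int m \<le> (t - s) / h" by (simp add: m_def)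
    also have "\<dots> \<le> (u - s) / h" using elim h by (simp add: field_simps)
    finally have "\<lfloor>(u - s) / h\<rfloor> = m" using elim h by (intro floor_unique) (auto simp: field_simps)
    then show ?case by (simp add: m_def)
  qed
  then show "continuous (at t within (I \<inter> {t..})) (\<lambda>t. v (nat \<lfloor>(t - s) / h\<rfloor>))"
    unfolding continuous_within by (rule tendsto_eventually)
  \<comment> \<open>Ceiling minus one rather than floor: immediately to the left of a grid point the
    path is still in the previous cell.\<close>
  define k where "k = \<lceil>(t - s) / h\<rceil> - 1"
  have "eventually (\<lambda>u. s + h * of_int k < u) (at t within (I \<inter> {..<t}))"
  proof -
    have "of_int k < (t - s) / h" unfolding k_def by linarith
    then have "s + h * of_int k < t" using h by (simp add: field_simps)
    then show ?thesis by (rule order_tendstoD(1)[OF tendsto_ident_at])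
  qed
  moreover have "eventually (\<lambda>u. u < t) (at t within (I \<inter> {..<t}))"
    by (auto simp: eventually_at_filter)
  ultimately have "eventually (\<lambda>u. v (nat \<lfloor>(u - s) / h\<rfloor>) = v (nat k)) (at t within (I \<inter> {..<t}))"
  proof eventually_elim
    case (elim u)
    have "(u - s) / h < (t - s) / h" using elim h by (simp add: field_simps)
    also have "\<dots> \<le> of_int k + 1" by (simp add: k_def)
    finally have "\<lfloor>(u - s) / h\<rfloor> = k" using elim h by (intro floor_unique) (auto simp: field_simps)
    then show ?case by simp
  qed
  then show "\<exists>l. ((\<lambda>t. v (nat \<lfloor>(t - s) / h\<rfloor>)) \<longlongrightarrow> l) (at t within (I \<inter> {..<t}))"
    by (intro exI[of _ "v (nat k)"] tendsto_eventually)
qed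

text \<open>No sigma-algebra on path space is involved: \<open>F\<close> of a step path is a
  continuous function of the sequence of its levels, and that sequence depends measurably on
  \<open>\<omega>\<close>, coordinate by coordinate.\<close>

lemma borel_measurable_skorohod_continuous:
  fixes X :: "'w \<Rightarrow> real \<Rightarrow> 'a::{metric_space, second_countable_topology}"
  assumes I: "I = {s..} \<or> (\<exists>b\<ge>s. I = {s..b})"
    and X: "\<And>t. t \<in> I \<Longrightarrow> (\<lambda>\<omega>. X \<omega> t) \<in> borel_measurable M"
    and rc: "\<And>\<omega>. \<omega> \<in> space M \<Longrightarrow> rcll I (X \<omega>)"
    and F: "skorohod_continuous I F"
  shows "(\<lambda>\<omega>. F (X \<omega>)) \<in> borel_measurable M"
proof -
  have s: "s \<in> I" and sI: "\<And>t. t \<in> I \<Longrightarrow> s \<le> t" and Icc: "\<And>t u. t \<in> I \<Longrightarrow> s \<le> u \<Longrightarrow> u \<le> t \<Longrightarrow> u \<in> I"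
    using I by auto
  \<comment> \<open>With mesh \<open>c / (n + 1)\<close> the right end of a compact interval is
    always a grid point; for a one-point interval any positive \<open>c\<close> will do.\<close>
  obtain c :: real where c: "c > 0" "\<And>b. b \<ge> s \<Longrightarrow> I = {s..b} \<Longrightarrow> b = s \<or> b - s = c"
  proof (cases "\<exists>b>s. I = {s..b}")
    case True
    then obtain b where "b > s" "I = {s..b}" by blast
    then show ?thesis by (intro that[of "b - s"]) (auto simp: Icc_eq_Icc)
  next
    case False
    then show ?thesis by (intro that[of 1]) (auto simp: order.order_iff_strict)
  qed
  define h where "h n = c / real (Suc n)" for n
  have h: "h n > 0" for n using c by (simp add: h_def)
  have h0: "h \<longlonglongrightarrow> 0" unfolding h_def by (rule LIMSEQ_Suc) (rule lim_const_over_n)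
  have int: "\<exists>m::int. b - s = h n * of_int m" if "b \<ge> s" "I = {s..b}" for b n
    using c(2)[OF that]
  proof
    assume "b - s = c"
    then show ?thesis by (intro exI[of _ "int (Suc n)"]) (simp add: h_def)
  qed (auto intro: exI[of _ 0])
  define \<Phi> where "\<Phi> n v t = v (nat \<lfloor>(t - s) / h n\<rfloor>)" for n and v :: "nat \<Rightarrow> 'a" and t
  \<comment> \<open>Grid points outside \<open>I\<close> are replaced by \<open>s\<close>; the step
    path never reads these values on \<open>I\<close>.\<close>
  define V where "V n \<omega> j = X \<omega> (if s + h n * real j \<in> I then s + h n * real j else s)" for n \<omega> j
  have rc\<Phi>: "rcll I (\<Phi> n v)" for n v unfolding \<Phi>_def by (rule rcll_step) (rule h)
  have "continuous_on UNIV (\<lambda>v. F (\<Phi> n v))" for n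
  proof -
    have "(\<lambda>k. F (\<Phi> n (vs k))) \<longlonglongrightarrow> F (\<Phi> n v)" if "vs \<longlonglongrightarrow> v" for vs v
    proof -
      have "skorohod_conv I (\<lambda>k. \<Phi> n (vs k)) (\<Phi> n v)"
      proof (rule skorohod_conv_uniform)
        fix T d :: real assume d: "d > 0"
        have "eventually (\<lambda>k. \<forall>j\<in>{..nat \<lfloor>(T - s) / h n\<rfloor>}. dist (vs k j) (v j) < d) sequentially"
        proof (intro eventually_ball_finite ballI)
          fix j
          have "(\<lambda>k. vs k j) \<longlonglongrightarrow> v j" using that by (simp add: tendsto_fun_iff)
          then show "eventually (\<lambda>k. dist (vs k j) (v j) < d) sequentially" using d by (simp add: tendsto_iff)
        qed simp
        then show "eventually (\<lambda>k. \<forall>t\<in>I. t \<le> T \<longrightarrow> dist (\<Phi> n (vs k) t) (\<Phi> n v t) < d) sequentially"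
        proof eventually_elim
          case (elim k)
          have "nat \<lfloor>(t - s) / h n\<rfloor> \<le> nat \<lfloor>(T - s) / h n\<rfloor>" if "t \<le> T" for t
            using that less_imp_le[OF h[of n]] by (intro nat_mono floor_mono divide_right_mono) auto
          then show ?case using elim by (auto simp: \<Phi>_def)
        qed
      qed
      then show ?thesis by (rule skorohod_continuousD[OF F rc\<Phi> rc\<Phi>])
    qed
    then show ?thesis unfolding continuous_on_sequentially by (auto simp: comp_def)
  qed
  then have m1: "(\<lambda>v. F (\<Phi> n v)) \<in> borel_measurable borel" for n
    by (rule borel_measurable_continuous_onI)
  have m2: "V n \<in> borel_measurable M" for n
    unfolding V_def by (rule measurable_coordinatewise_then_product) (use X s in auto)
  show ?thesis
  proof (rule borel_measurable_LIMSEQ_metric)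
    show "(\<lambda>\<omega>. F (\<Phi> n (V n \<omega>))) \<in> borel_measurable M" for n
      using measurable_compose[OF m2 m1] by simp
    fix \<omega> assume w: "\<omega> \<in> space M"
    have eq: "\<Phi> n (V n \<omega>) t = X \<omega> (s + h n * of_int \<lfloor>(t - s) / h n\<rfloor>)" if t: "t \<in> I" for n t
    proof -
      have fl: "\<lfloor>(t - s) / h n\<rfloor> \<ge> 0" using sI[OF t] h[of n] by simp
      have "of_int \<lfloor>(t - s) / h n\<rfloor> \<le> (t - s) / h n" by simp
      then have "s + h n * of_int \<lfloor>(t - s) / h n\<rfloor> \<le> t"
        unfolding pos_le_divide_eq[OF h] by (simp add: mult.commute)
      then have "s + h n * of_int \<lfloor>(t - s) / h n\<rfloor> \<in> I" using fl h[of n] by (intro Icc[OF t]) auto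
      then show ?thesis using fl by (simp add: \<Phi>_def V_def)
    qed
    have "skorohod_conv I (\<lambda>n. \<Phi> n (V n \<omega>)) (X \<omega>)"
    proof (rule skorohod_convI)
      fix T d :: real assume d: "d > 0"
      obtain H where H: "H > 0" "\<And>h. 0 < h \<Longrightarrow> h < H \<Longrightarrow> (\<forall>b\<ge>s. I = {s..b} \<longrightarrow> (\<exists>m::int. b - s = h * of_int m)) \<Longrightarrow>
        (\<exists>lam\<in>time_changes I. \<forall>t\<in>I. t \<le> T \<longrightarrow>
       \<bar>lam t - t\<bar> < d \<and> dist (X \<omega> (s + h * of_int \<lfloor>(t - s) / h\<rfloor>)) (X \<omega> (lam t)) < d)"
        using rcll_grid_approximation[OF I rc[OF w] d, of T] by blast
      show "eventually (\<lambda>n. \<exists>lam\<in>time_changes I. \<forall>t\<in>I. t \<le> T \<longrightarrow>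
              \<bar>lam t - t\<bar> < d \<and> dist (\<Phi> n (V n \<omega>) t) (X \<omega> (lam t)) < d) sequentially"
        using order_tendstoD(2)[OF h0 H(1)]
      proof eventually_elim
        case (elim n)
        have "\<forall>b\<ge>s. I = {s..b} \<longrightarrow> (\<exists>m::int. b - s = h n * of_int m)" using int by blast
        from H(2)[OF h elim this] show ?case by (simp add: eq cong: ball_cong imp_cong)
      qed
    qed
    then show "(\<lambda>n. F (\<Phi> n (V n \<omega>))) \<longlonglongrightarrow> F (X \<omega>)"
      by (rule skorohod_continuousD[OF F rc\<Phi> rc[OF w]])
  qed
qed

section \<open>A strong law for orthogonal increments\<close>

lemma ex_nat_square_bracket: "\<exists>m::nat. m * m \<le> n \<and> n < Suc m * Suc m"
proof (induction n)
  case 0 show ?case by (rule exI[of _ 0]) simp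
next
  case (Suc n)
  then obtain m where m: "m * m \<le> n" "n < Suc m * Suc m" by blast
  show ?case
  proof (cases "Suc n < Suc m * Suc m")
    case True then show ?thesis using m by (intro exI[of _ m]) auto
  next
    case False then show ?thesis using m by (intro exI[of _ "Suc m"]) auto
  qed
qed

text \<open>Between \<open>m * m\<close> and the next square the sum moves by at most
  \<open>2 * c * m\<close>, which is negligible against \<open>m * m\<close>.\<close>

lemma average_tendsto_0_of_squares:
  fixes S :: "nat \<Rightarrow> real"
  assumes inc: "\<And>n. \<bar>S (Suc n) - S n\<bar> \<le> c"
    and sq: "(\<lambda>m. S (m * m) / real (m * m)) \<longlonglongrightarrow> 0"
  shows "(\<lambda>n. S n / real n) \<longlonglongrightarrow> 0"
proof (rule LIMSEQ_I)
  fix e :: real assume e: "e > 0"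
  have c: "c \<ge> 0" using inc[of 0] by linarith
  have inc2: "\<bar>S (n + k) - S n\<bar> \<le> c * real k" for n k
  proof (induction k)
    case (Suc k)
    then show ?case using inc[of "n + k"] by (simp add: algebra_simps)
  qed simp
  obtain m1 where m1: "\<And>m. m \<ge> m1 \<Longrightarrow> \<bar>S (m * m) / real (m * m)\<bar> < e / 2"
    using LIMSEQ_D[OF sq, of "e/2"] e by auto
  obtain m2 :: nat where m2: "4 * c / e < real m2" using reals_Archimedean2 by blast
  define m0 where "m0 = max (Suc m1) (Suc m2)"
  show "\<exists>n0. \<forall>n\<ge>n0. norm (S n / real n - 0) < e"
  proof (intro exI[of _ "m0 * m0"] allI impI)
    fix n assume n: "n \<ge> m0 * m0"
    obtain m where m: "m * m \<le> n" "n < Suc m * Suc m" using ex_nat_square_bracket by blast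
    have "m0 < Suc m"
    proof (rule ccontr)
      assume "\<not> m0 < Suc m"
      then have "Suc m * Suc m \<le> m0 * m0" by (intro mult_le_mono) auto
      then show False using n m by simp
    qed
    then have mm: "m \<ge> m0" by simp
    then have m_pos: "m > 0" by (simp add: m0_def)
    have "\<bar>S n\<bar> \<le> \<bar>S (m * m)\<bar> + \<bar>S (m * m + (n - m * m)) - S (m * m)\<bar>" using m by simp
    also have "\<dots> \<le> \<bar>S (m * m)\<bar> + c * real (2 * m)"
    proof -
      have "n - m * m \<le> 2 * m" using m by simp
      then have "c * real (n - m * m) \<le> c * real (2 * m)" using c by (intro mult_left_mono) auto
      then show ?thesis using inc2[of "m * m" "n - m * m"] by linarith
    qed
    finally have b: "\<bar>S n\<bar> \<le> \<bar>S (m * m)\<bar> + 2 * c * real m" by simp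
    have nn: "real n \<ge> real (m * m)" "real (m * m) > 0" using m m_pos by (auto simp del: of_nat_mult)
    have "\<bar>S n\<bar> / real n \<le> (\<bar>S (m * m)\<bar> + 2 * c * real m) / real (m * m)"
      using b nn c by (intro frac_le) auto
    also have "\<dots> = \<bar>S (m * m) / real (m * m)\<bar> + 2 * c / real m"
      using m_pos by (simp add: add_divide_distrib)
    also have "\<dots> < e / 2 + e / 2"
    proof (rule add_strict_mono)
      show "\<bar>S (m * m) / real (m * m)\<bar> < e / 2" using m1 mm by (simp add: m0_def)
      have "real m2 < real m" using mm by (simp add: m0_def)
      then have "4 * c / e < real m" using m2 by linarith
      then show "2 * c / real m < e / 2" using e m_pos by (simp add: field_simps)
    qed
    finally show "norm (S n / real n - 0) < e" using nn by simp
  qed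
qed

context prob_space
begin

text \<open>\<open>mean\<close> says that \<open>Z n\<close> has conditional expectation 0 given
  \<open>F n\<close>, and the earlier sum is measurable for \<open>F n\<close>; so the cross term
  vanishes and each step adds at most \<open>c^2\<close>.\<close>

lemma orthogonal_increments_second_moment:
  fixes Z :: "nat \<Rightarrow> 'a \<Rightarrow> real" and F :: "nat \<Rightarrow> 'a measure"
  assumes sub: "\<And>n. subalgebra M (F n)"
    and adapted: "\<And>k n. k < n \<Longrightarrow> Z k \<in> borel_measurable (F n)"
    and bdd: "\<And>n \<omega>. \<bar>Z n \<omega>\<bar> \<le> c"
    and mean: "\<And>n B. B \<in> sets (F n) \<Longrightarrow> (\<integral>\<omega>. indicator B \<omega> * Z n \<omega> \<partial>M) = 0"
  shows "(\<integral>\<omega>. (\<Sum>k<n. Z k \<omega>)^2 \<partial>M) \<le> real n * c^2"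
proof (induction n)
  case (Suc n)
  have meas: "Z k \<in> borel_measurable M" for k
    using measurable_from_subalg[OF sub adapted[of k "Suc k"]] by simp
  have sumb: "\<bar>\<Sum>k<n. Z k \<omega>\<bar> \<le> real n * c" for n \<omega>
    using order_trans[OF sum_abs sum_mono[of "{..<n}" "\<lambda>k. \<bar>Z k \<omega>\<bar>" "\<lambda>_. c"]] bdd by simp
  have c: "c \<ge> 0" using bdd[of 0 undefined] by linarith
  define S where "S \<omega> = (\<Sum>k<n. Z k \<omega>)" for \<omega>
  have SF: "S \<in> borel_measurable (F n)" unfolding S_def by (intro borel_measurable_sum adapted) auto
  have SM: "S \<in> borel_measurable M" by (rule measurable_from_subalg[OF sub SF])
  have Sb: "\<bar>S \<omega>\<bar> \<le> real n * c" for \<omega> unfolding S_def by (rule sumb)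
  have i1: "integrable M (Z n)" using meas bdd by (intro integrable_const_bound[of _ c]) auto
  have i2: "integrable M (\<lambda>\<omega>. S \<omega> * Z n \<omega>)"
  proof (rule integrable_const_bound[of _ "real n * c * c"])
    have "\<bar>S \<omega> * Z n \<omega>\<bar> \<le> real n * c * c" for \<omega>
      unfolding abs_mult using Sb bdd c by (intro mult_mono) auto
    then show "AE \<omega> in M. norm (S \<omega> * Z n \<omega>) \<le> real n * c * c" by simp
  qed (use SM meas in measurable)
  have i3: "integrable M (\<lambda>\<omega>. (S \<omega>)^2)"
  proof (rule integrable_const_bound[of _ "(real n * c)^2"])
    have "(S \<omega>)^2 \<le> (real n * c)^2" for \<omega> using power_mono[OF Sb abs_ge_zero, of \<omega> 2] by simp
    then show "AE \<omega> in M. norm ((S \<omega>)^2) \<le> (real n * c)^2" by simp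
  qed (use SM in measurable)
  have z2: "(Z n \<omega>)^2 \<le> c^2" for \<omega> using power_mono[OF bdd abs_ge_zero, of n \<omega> 2] by simp
  have i4: "integrable M (\<lambda>\<omega>. (Z n \<omega>)^2)"
    by (rule integrable_const_bound[of _ "c^2"]) (use z2 meas in auto)
  interpret fm: finite_measure_subalgebra M "F n"
    by (unfold_locales) (use sub in auto)
  have "AE \<omega> in M. real_cond_exp M (F n) (Z n) \<omega> = 0"
  proof (rule fm.real_cond_exp_charact)
    show "set_lebesgue_integral M A (Z n) = set_lebesgue_integral M A (\<lambda>_. 0)" if "A \<in> sets (F n)" for A
      using mean[OF that] by (simp add: set_lebesgue_integral_def)
  qed (use i1 in auto)
  then have "(\<integral>\<omega>. S \<omega> * real_cond_exp M (F n) (Z n) \<omega> \<partial>M) = (\<integral>\<omega>. 0 \<partial>M)"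
    by (intro integral_cong_AE) (use SM in auto)
  then have orth: "(\<integral>\<omega>. S \<omega> * Z n \<omega> \<partial>M) = 0"
    using fm.real_cond_exp_intg(2)[OF i2 SF meas] by simp
  have "(\<integral>\<omega>. (\<Sum>k<Suc n. Z k \<omega>)^2 \<partial>M) = (\<integral>\<omega>. (S \<omega>)^2 + (2 * (S \<omega> * Z n \<omega>) + (Z n \<omega>)^2) \<partial>M)"
    by (intro Bochner_Integration.integral_cong) (auto simp: S_def power2_eq_square algebra_simps)
  also have "\<dots> = (\<integral>\<omega>. (S \<omega>)^2 \<partial>M) + (2 * (\<integral>\<omega>. S \<omega> * Z n \<omega> \<partial>M) + (\<integral>\<omega>. (Z n \<omega>)^2 \<partial>M))"
    using i2 i3 i4 by simp
  also have "\<dots> \<le> real n * c^2 + (2 * 0 + c^2)"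
  proof (intro add_mono)
    show "(\<integral>\<omega>. (S \<omega>)^2 \<partial>M) \<le> real n * c^2" using Suc by (simp add: S_def)
    show "(\<integral>\<omega>. (Z n \<omega>)^2 \<partial>M) \<le> c^2" using integral_le_const[OF i4, of "c^2"] z2 by simp
  qed (simp add: orth)
  finally show ?case by (simp add: algebra_simps)
qed simp

text \<open>By the second moment bound the squared average at time \<open>N\<close> has mean at most
  \<open>c^2 / N\<close>, which is summable along \<open>N = (m + 1)^2\<close>; a nonnegative series
  with finite expectation converges almost surely. Bounded increments fill the gaps between
  squares.\<close>

lemma strong_law_orthogonal:
  fixes Z :: "nat \<Rightarrow> 'a \<Rightarrow> real" and F :: "nat \<Rightarrow> 'a measure"
  assumes sub: "\<And>n. subalgebra M (F n)"
    and adapted: "\<And>k n. k < n \<Longrightarrow> Z k \<in> borel_measurable (F n)"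
    and bdd: "\<And>n \<omega>. \<bar>Z n \<omega>\<bar> \<le> c"
    and mean: "\<And>n B. B \<in> sets (F n) \<Longrightarrow> (\<integral>\<omega>. indicator B \<omega> * Z n \<omega> \<partial>M) = 0"
  shows "AE \<omega> in M. (\<lambda>n. (\<Sum>k<n. Z k \<omega>) / real n) \<longlonglongrightarrow> 0"
proof -
  define S where "S n \<omega> = (\<Sum>k<n. Z k \<omega>)" for n \<omega>
  have meas: "Z k \<in> borel_measurable M" for k
    using measurable_from_subalg[OF sub adapted[of k "Suc k"]] by simp
  then have Sm[measurable]: "S n \<in> borel_measurable M" for n unfolding S_def by measurable
  have sumb: "\<bar>S n \<omega>\<bar> \<le> real n * c" for n \<omega>
    unfolding S_def using order_trans[OF sum_abs sum_mono[of "{..<n}" "\<lambda>k. \<bar>Z k \<omega>\<bar>" "\<lambda>_. c"]] bdd by simp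
  define f where "f m \<omega> = (S (Suc m * Suc m) \<omega> / real (Suc m * Suc m))^2" for m \<omega>
  have fm: "f m \<in> borel_measurable M" for m unfolding f_def by measurable
  have fb: "(\<integral>\<^sup>+\<omega>. ennreal (f m \<omega>) \<partial>M) \<le> ennreal (c^2 / (real (Suc m))^2)" for m
  proof -
    define N where "N = Suc m * Suc m"
    have N: "N > 0" by (simp add: N_def)
    have fb0: "f m \<omega> \<le> c^2" for \<omega>
    proof -
      have "\<bar>S N \<omega> / real N\<bar> \<le> c" using sumb[of N \<omega>] N by (simp add: field_simps)
      from power_mono[OF this abs_ge_zero, of 2] show ?thesis
        unfolding f_def N_def[symmetric] by (simp only: power2_abs)
    qed
    have fi: "integrable M (f m)"
      by (rule integrable_const_bound[of _ "c^2"]) (use fb0 fm in \<open>auto simp: f_def\<close>)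
    have "(\<integral>\<^sup>+\<omega>. ennreal (f m \<omega>) \<partial>M) = ennreal (\<integral>\<omega>. f m \<omega> \<partial>M)"
      by (rule nn_integral_eq_integral[OF fi]) (simp add: f_def)
    also have "(\<integral>\<omega>. f m \<omega> \<partial>M) = (\<integral>\<omega>. (S N \<omega>)^2 \<partial>M) / (real N)^2"
      by (simp add: f_def N_def power_divide)
    also have "\<dots> \<le> (real N * c^2) / (real N)^2"
      using orthogonal_increments_second_moment[of F Z c N, OF sub adapted bdd mean]
      by (intro divide_right_mono) (auto simp: S_def)
    also have "\<dots> = c^2 / real N" using N by (simp add: power2_eq_square)
    also have "\<dots> = c^2 / (real (Suc m))^2" by (simp only: N_def power2_eq_square of_nat_mult)
    finally show ?thesis by (simp add: ennreal_leI)
  qed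
  have sm: "summable (\<lambda>m. c^2 / (real (Suc m))^2)"
    using summable_mult[OF inverse_power_summable[of 2, where 'a=real], of "c^2"]
    by (subst summable_Suc_iff[of "\<lambda>m. c^2 / (real m)^2"]) (simp add: divide_inverse)
  have "(\<integral>\<^sup>+\<omega>. (\<Sum>m. ennreal (f m \<omega>)) \<partial>M) = (\<Sum>m. \<integral>\<^sup>+\<omega>. ennreal (f m \<omega>) \<partial>M)"
    using fm by (intro nn_integral_suminf) auto
  also have "\<dots> \<le> (\<Sum>m. ennreal (c^2 / (real (Suc m))^2))" by (intro suminf_le fb) auto
  also have "\<dots> < \<infinity>" using sm by (simp add: suminf_ennreal2 ennreal_suminf_neq_top less_top[symmetric])
  finally have "AE \<omega> in M. (\<Sum>m. ennreal (f m \<omega>)) \<noteq> \<infinity>"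
    by (intro nn_integral_PInf_AE) (use fm in auto)
  then show ?thesis
  proof eventually_elim
    case (elim \<omega>)
    have "summable (\<lambda>m. f m \<omega>)"
      by (rule summable_suminf_not_top) (use elim in \<open>auto simp: f_def\<close>)
    then have "(\<lambda>m. f m \<omega>) \<longlonglongrightarrow> 0" by (rule summable_LIMSEQ_zero)
    then have "(\<lambda>m. sqrt (f m \<omega>)) \<longlonglongrightarrow> sqrt 0" by (intro tendsto_intros)
    then have "(\<lambda>m. \<bar>S (Suc m * Suc m) \<omega> / real (Suc m * Suc m)\<bar>) \<longlonglongrightarrow> 0"
      unfolding f_def real_sqrt_abs by simp
    then have "(\<lambda>m. S (Suc m * Suc m) \<omega> / real (Suc m * Suc m)) \<longlonglongrightarrow> 0"
      by (rule tendsto_rabs_zero_cancel)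
    then have "(\<lambda>m. S (m * m) \<omega> / real (m * m)) \<longlonglongrightarrow> 0"
      by (rule LIMSEQ_imp_Suc[where f="\<lambda>m. S (m * m) \<omega> / real (m * m)"])
    then have "(\<lambda>n. S n \<omega> / real n) \<longlonglongrightarrow> 0"
      by (rule average_tendsto_0_of_squares[rotated, where c=c]) (use bdd in \<open>auto simp: S_def\<close>)
    then show ?case by (simp add: S_def)
  qed
qed

end

section \<open>Markov renewal processes with bounded sojourn times\<close>

locale bounded_markov_renewal = prob_space M
  for M :: "'w measure" +
  fixes x :: "nat \<Rightarrow> 'w \<Rightarrow> 'x::finite" and T :: "nat \<Rightarrow> 'w \<Rightarrow> real"
    and Q :: "'x \<Rightarrow> 'x \<Rightarrow> real \<Rightarrow> real" and rho :: "'x \<Rightarrow> real" and taubar :: real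
  assumes kernel: "semi_markov_kernel Q"
    and mrp: "markov_renewal_process M x T Q"
    and ergodic: "embedded_chain_ergodic (emb_P Q) rho"
    and taubar: "taubar > 0" "\<And>a b. Q a b taubar = emb_P Q a b"
begin

text \<open>The sigma-algebra \<open>past_events\<close> as a measure object, so that measurability
  with respect to the past can be expressed.\<close>

definition past :: "nat \<Rightarrow> 'w measure" where
  "past n = sigma (space M)
     ((\<Union>k\<in>{..n}. {x k -` {a} \<inter> space M | a. True}) \<union>
      (\<Union>k\<in>{..n}. {T k -` A \<inter> space M | A. A \<in> sets borel}))"

lemma x_meas[measurable]: "x n \<in> measurable M (count_space UNIV)"
  and T_meas[measurable]: "T n \<in> borel_measurable M"
  and T_less: "\<omega> \<in> space M \<Longrightarrow> T n \<omega> < T (Suc n) \<omega>"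
  using mrp by (auto simp: markov_renewal_process_def)

lemma space_past[simp]: "space (past n) = space M" by (simp add: past_def space_measure_of_conv)

lemma sets_past: "sets (past n) = past_events M x T n"
  unfolding past_def past_events_def by (intro sets_measure_of) auto

lemma x_past: assumes "k \<le> n" shows "x k \<in> measurable (past n) (count_space UNIV)"
proof -
  have "x k -` {a} \<inter> space M \<in> sets (past n)" for a
    unfolding sets_past past_events_def by (rule sigma_sets.Basic) (use assms in auto)
  then show ?thesis by (simp add: measurable_count_space_eq2)
qed

lemma T_past: assumes "k \<le> n" shows "T k \<in> borel_measurable (past n)"
proof -
  have "T k -` A \<inter> space M \<in> sets (past n)" if "A \<in> sets borel" for A
    unfolding sets_past past_events_def by (rule sigma_sets.Basic) (use assms that in auto)
  then show ?thesis by (auto simp: measurable_def)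
qed

lemma subalgebra_past: "subalgebra M (past n)"
proof -
  have "x k -` {a} \<inter> space M \<in> sets M" for a k using measurable_sets[OF x_meas] by simp
  moreover have "T k -` A \<inter> space M \<in> sets M" if "A \<in> sets borel" for A k using measurable_sets[OF T_meas that] .
  ultimately have "past_events M x T n \<subseteq> sets M"
    unfolding past_events_def by (intro sets.sigma_sets_subset) auto
  then show ?thesis by (simp add: subalgebra_def sets_past)
qed

lemma past_sets: "B \<in> sets (past n) \<Longrightarrow> B \<in> sets M"
  using subalgebra_past by (auto simp: subalgebra_def)

definition tau :: "nat \<Rightarrow> 'w \<Rightarrow> real" where "tau n \<omega> = T (Suc n) \<omega> - T n \<omega>"

lemma tau_meas[measurable]: "tau n \<in> borel_measurable M"
  unfolding tau_def by measurable

lemma tau_pos: "\<omega> \<in> space M \<Longrightarrow> tau n \<omega> > 0"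
  using T_less by (simp add: tau_def)

definition at_state :: "nat \<Rightarrow> 'x \<Rightarrow> 'w set" where "at_state n a = {\<omega> \<in> space M. x n \<omega> = a}"

lemma at_state_past: "at_state n a \<in> sets (past n)"
proof -
  have "x n -` {a} \<inter> space (past n) \<in> sets (past n)" by (rule measurable_sets[OF x_past]) auto
  moreover have "x n -` {a} \<inter> space (past n) = at_state n a" by (auto simp: at_state_def)
  ultimately show ?thesis by simp
qed

lemma at_state_sets[measurable]: "at_state n a \<in> sets M"
  by (rule past_sets[OF at_state_past])

text \<open>Intersecting with \<open>at_state n a\<close> freezes the kernel, which turns the
  integral into a plain product.\<close>

lemma kernel_prob:
  assumes B: "B \<in> sets (past n)"
  shows "prob ({\<omega>\<in>space M. x (Suc n) \<omega> = b \<and> tau n \<omega> \<le> t} \<inter> (B \<inter> at_state n a))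
       = Q a b t * prob (B \<inter> at_state n a)"
proof -
  have B': "B \<inter> at_state n a \<in> sets (past n)" using B at_state_past by auto
  have "prob ({\<omega>\<in>space M. x (Suc n) \<omega> = b \<and> tau n \<omega> \<le> t} \<inter> (B \<inter> at_state n a))
      = (LINT \<omega>:B \<inter> at_state n a|M. Q (x n \<omega>) b t)"
    using mrp B' unfolding markov_renewal_process_def sets_past tau_def by blast
  also have "\<dots> = (\<integral>\<omega>. indicator (B \<inter> at_state n a) \<omega> * Q a b t \<partial>M)"
    unfolding set_lebesgue_integral_def
    by (intro Bochner_Integration.integral_cong) (auto simp: at_state_def indicator_def)
  also have "\<dots> = Q a b t * prob (B \<inter> at_state n a)"
    using past_sets[OF B'] by (simp add: mult.commute)
  finally show ?thesis .
qed

lemma sum_emb_P: "(\<Sum>b\<in>UNIV. emb_P Q a b) = 1"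
  using kernel by (simp add: semi_markov_kernel_def emb_P_def)

lemma kernel_tau:
  assumes B: "B \<in> sets (past n)"
  shows "prob ({\<omega>\<in>space M. tau n \<omega> \<le> t} \<inter> (B \<inter> at_state n a)) = Fdist Q a t * prob (B \<inter> at_state n a)"
proof -
  let ?E = "\<lambda>b. {\<omega>\<in>space M. x (Suc n) \<omega> = b \<and> tau n \<omega> \<le> t} \<inter> (B \<inter> at_state n a)"
  have "B \<in> sets M" by (rule past_sets[OF B])
  then have E: "?E b \<in> sets M" for b by measurable
  have "prob ({\<omega>\<in>space M. tau n \<omega> \<le> t} \<inter> (B \<inter> at_state n a)) = prob (\<Union>b. ?E b)"
    by (intro arg_cong[where f=prob]) auto
  also have "\<dots> = (\<Sum>b\<in>UNIV. prob (?E b))"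
    by (intro finite_measure_finite_Union) (use E in \<open>auto simp: disjoint_family_on_def\<close>)
  also have "\<dots> = Fdist Q a t * prob (B \<inter> at_state n a)"
    by (simp add: kernel_prob[OF B] Fdist_def sum_distrib_right)
  finally show ?thesis .
qed

text \<open>Summed over the target states, the kernel already has full mass at
  \<open>taubar\<close>.\<close>

lemma AE_tau_le: "AE \<omega> in M. tau n \<omega> \<le> taubar"
proof -
  have F1: "Fdist Q a taubar = 1" for a by (simp add: Fdist_def taubar sum_emb_P)
  have "prob ({\<omega>\<in>space M. tau n \<omega> \<le> taubar} \<inter> (space M \<inter> at_state n a)) = prob (at_state n a)" for a
    using kernel_tau[of "space M" n taubar a] sets.top[of "past n"] sets.sets_into_space[OF at_state_sets[of n a]]
    by (simp add: F1 Int_absorb1)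
  then have e: "prob ({\<omega>\<in>space M. tau n \<omega> \<le> taubar} \<inter> at_state n a) = prob (at_state n a)" for a
    using sets.sets_into_space[OF at_state_sets[of n a]] by (simp add: Int_absorb1)
  have "prob {\<omega>\<in>space M. tau n \<omega> \<le> taubar} = prob (\<Union>a. {\<omega>\<in>space M. tau n \<omega> \<le> taubar} \<inter> at_state n a)"
    by (intro arg_cong[where f=prob]) (auto simp: at_state_def)
  also have "\<dots> = (\<Sum>a\<in>UNIV. prob ({\<omega>\<in>space M. tau n \<omega> \<le> taubar} \<inter> at_state n a))"
    by (intro finite_measure_finite_Union) (auto simp: disjoint_family_on_def at_state_def)
  also have "\<dots> = (\<Sum>a\<in>UNIV. prob (at_state n a))" by (simp add: e)
  also have "\<dots> = prob (\<Union>a. at_state n a)"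
    by (intro finite_measure_finite_Union[symmetric]) (auto simp: disjoint_family_on_def at_state_def)
  also have "(\<Union>a. at_state n a) = space M" by (auto simp: at_state_def)
  finally have "prob {\<omega>\<in>space M. tau n \<omega> \<le> taubar} = 1" by (simp add: prob_space)
  then show ?thesis by (subst (asm) prob_Collect_eq_1) auto
qed

text \<open>At level \<open>taubar\<close> the bound on the sojourn time is almost surely void, so
  the kernel reduces to the transition matrix.\<close>

lemma kernel_jump:
  assumes B: "B \<in> sets (past n)"
  shows "prob ({\<omega>\<in>space M. x (Suc n) \<omega> = b} \<inter> (B \<inter> at_state n a)) = emb_P Q a b * prob (B \<inter> at_state n a)"
proof -
  have [measurable]: "B \<in> sets M" by (rule past_sets[OF B])
  have "prob ({\<omega>\<in>space M. x (Suc n) \<omega> = b} \<inter> (B \<inter> at_state n a))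
      = prob ({\<omega>\<in>space M. x (Suc n) \<omega> = b \<and> tau n \<omega> \<le> taubar} \<inter> (B \<inter> at_state n a))"
    by (rule measure_eq_AE) (use AE_tau_le[of n] in \<open>auto elim!: eventually_mono\<close>)
  then show ?thesis using kernel_prob[OF B, of b taubar a] by (simp add: taubar)
qed

section \<open>Conditional means of the sojourn times\<close>

lemma Fdist_distribution:
  shows "cdf (interval_measure (Fdist Q a)) = Fdist Q a" "real_distribution (interval_measure (Fdist Q a))"
proof -
  have Q: "mono (Q a b)" "continuous (at_right t) (Q a b)" "t < 0 \<Longrightarrow> Q a b t = 0" "conv_at_top (Q a b)" for b t
    using kernel by (auto simp: semi_markov_kernel_def)
  have m: "Fdist Q a t \<le> Fdist Q a u" if "t \<le> u" for t u
    unfolding Fdist_def using Q(1) that by (intro sum_mono) (auto simp: mono_def)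
  have c: "continuous (at_right t) (Fdist Q a)" for t
    unfolding Fdist_def by (intro continuous_intros Q)
  have b: "(Fdist Q a \<longlongrightarrow> 0) at_bot"
  proof (rule tendsto_eventually)
    show "eventually (\<lambda>t. Fdist Q a t = 0) at_bot"
      using eventually_gt_at_bot[of 0] Q(3) unfolding eventually_at_bot_dense Fdist_def
      by (intro exI[of _ 0]) auto
  qed
  have "(Q a b \<longlongrightarrow> emb_P Q a b) at_top" for b
  proof -
    obtain l where l: "(Q a b \<longlongrightarrow> l) at_top" using Q(4) by (auto simp: conv_at_top_def)
    then have "Lim at_top (Q a b) = l" by (intro tendsto_Lim) auto
    then show ?thesis using l by (simp add: emb_P_def)
  qed
  then have "((\<lambda>t. \<Sum>b\<in>UNIV. Q a b t) \<longlongrightarrow> (\<Sum>b\<in>UNIV. emb_P Q a b)) at_top" by (intro tendsto_sum)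
  then have t: "(Fdist Q a \<longlongrightarrow> 1) at_top" by (simp add: Fdist_def[abs_def] sum_emb_P)
  show "cdf (interval_measure (Fdist Q a)) = Fdist Q a" by (rule cdf_interval_measure[OF m c b])
  show "real_distribution (interval_measure (Fdist Q a))" by (rule real_distribution_interval_measure[OF m c b t])
qed

text \<open>A version of tau that is bounded everywhere, not only almost surely.\<close>
definition tau' :: "nat \<Rightarrow> 'w \<Rightarrow> real" where "tau' n \<omega> = max 0 (min (tau n \<omega>) taubar)"

lemma tau'_meas[measurable]: "tau' n \<in> borel_measurable M"
  unfolding tau'_def by measurable

lemma AE_tau': "AE \<omega> in M. tau' n \<omega> = tau n \<omega>"
  using AE_tau_le[of n] AE_space
proof eventually_elim
  case (elim \<omega>)
  then show ?case using tau_pos[of \<omega> n] by (simp add: tau'_def)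
qed

lemma tau'_bdd: "0 \<le> tau' n \<omega>" "tau' n \<omega> \<le> taubar"
  using taubar by (auto simp: tau'_def)

text \<open>\<open>m1\<close> is an integral against the measure generated by \<open>Fdist\<close>.
  The law of \<open>tau n\<close> conditioned on \<open>B \<inter> at_state n a\<close> has the same
  distribution function, hence is that measure. The null case is separate because there is nothing
  to condition on.\<close>

lemma mean_tau':
  assumes B: "B \<in> sets (past n)"
  shows "(\<integral>\<omega>. indicator (B \<inter> at_state n a) \<omega> * tau' n \<omega> \<partial>M) = m1 Q a * prob (B \<inter> at_state n a)"
proof (cases "prob (B \<inter> at_state n a) = 0")
  case True
  have [measurable]: "B \<in> sets M" by (rule past_sets[OF B])
  have "AE \<omega> in M. \<omega> \<notin> B \<inter> at_state n a"
    using True by (intro AE_not_in) (simp add: null_sets_def emeasure_eq_measure)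
  then have "(\<integral>\<omega>. indicator (B \<inter> at_state n a) \<omega> * tau' n \<omega> \<partial>M) = (\<integral>\<omega>. 0 \<partial>M)"
    by (intro integral_cong_AE) (auto elim!: eventually_mono simp: indicator_def)
  then show ?thesis using True by simp
next
  case False
  define A where "A = B \<inter> at_state n a"
  have A[measurable]: "A \<in> sets M" using past_sets[OF B] by (simp add: A_def)
  have pA: "prob A > 0" using False zero_less_measure_iff[of M A] by (simp add: A_def)
  have eA: "emeasure M A \<noteq> 0" "emeasure M A \<noteq> \<infinity>" using pA by (auto simp: emeasure_eq_measure)
  define U where "U = uniform_measure M A"
  interpret U: prob_space U unfolding U_def by (rule prob_space_uniform_measure[OF eA])
  have Ud: "U = density M (\<lambda>\<omega>. ennreal (indicator A \<omega> / prob A))"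
    unfolding U_def uniform_measure_def emeasure_eq_measure using pA
    by (intro arg_cong[where f="density M"] ext) (auto simp: indicator_def divide_ennreal[symmetric])
  have sU: "sets U = sets M" "space U = space M" by (simp_all add: U_def)
  have tm: "tau n \<in> borel_measurable U" using tau_meas[of n] by (simp add: U_def)
  define R where "R = distr U borel (tau n)"
  have R: "real_distribution R" unfolding R_def by (rule U.real_distribution_distr) (rule tm)
  have "cdf R t = Fdist Q a t" for t
  proof -
    have "cdf R t = measure U (tau n -` {..t} \<inter> space M)"
      unfolding cdf_def R_def by (subst measure_distr) (use tm sU in auto)
    also have "\<dots> = prob (A \<inter> (tau n -` {..t} \<inter> space M)) / prob A"
      unfolding U_def by (rule measure_uniform_measure[OF eA]) measurable
    also have "A \<inter> (tau n -` {..t} \<inter> space M) = {\<omega>\<in>space M. tau n \<omega> \<le> t} \<inter> (B \<inter> at_state n a)"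
      by (auto simp: A_def)
    also have "prob \<dots> = Fdist Q a t * prob A" using kernel_tau[OF B] by (simp add: A_def)
    finally show ?thesis using pA by simp
  qed
  then have "cdf R = cdf (interval_measure (Fdist Q a))" by (simp add: Fdist_distribution fun_eq_iff)
  then have Req: "R = interval_measure (Fdist Q a)" by (rule cdf_unique[OF R Fdist_distribution(2)])
  have "m1 Q a = (\<integral>t. t \<partial>R)" by (simp add: m1_def Req)
  also have "\<dots> = (\<integral>\<omega>. tau n \<omega> \<partial>U)" unfolding R_def by (rule integral_distr) (use tm in auto)
  also have "\<dots> = (\<integral>\<omega>. tau' n \<omega> \<partial>U)"
  proof (rule integral_cong_AE)
    show "AE \<omega> in U. tau n \<omega> = tau' n \<omega>" unfolding U_def
      by (rule AE_uniform_measureI) (use AE_tau'[of n] A in \<open>auto elim!: eventually_mono\<close>)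
  qed (use tm tau'_meas[of n] in \<open>auto simp: U_def\<close>)
  also have "\<dots> = (\<integral>\<omega>. (indicator A \<omega> / prob A) *\<^sub>R tau' n \<omega> \<partial>M)"
    unfolding Ud by (rule integral_density) (auto simp: indicator_def)
  also have "\<dots> = (\<integral>\<omega>. indicator A \<omega> * tau' n \<omega> / prob A \<partial>M)" by simp
  also have "\<dots> = (\<integral>\<omega>. indicator A \<omega> * tau' n \<omega> \<partial>M) / prob A" by (rule integral_divide_zero)
  finally show ?thesis using pA by (simp add: A_def field_simps)
qed

lemma integrable_ind: "A \<in> sets M \<Longrightarrow> integrable M (indicator A :: 'w \<Rightarrow> real)"
  by (simp add: integrable_real_indicator less_top[symmetric])

text \<open>Given the past, \<open>H n - m\<close> has mean zero on the event of being in
  \<open>a\<close>, and elsewhere it is multiplied by 0; so the products are orthogonal increments.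
  \<open>H k\<close> is revealed only after step \<open>k\<close>, which is why it is measurable for
  later pasts only.\<close>

lemma strong_law_at_state:
  fixes H :: "nat \<Rightarrow> 'w \<Rightarrow> real"
  assumes H: "\<And>k n. k < n \<Longrightarrow> H k \<in> borel_measurable (past n)" "\<And>n \<omega>. \<bar>H n \<omega>\<bar> \<le> c"
    and mean: "\<And>n B. B \<in> sets (past n) \<Longrightarrow>
      (\<integral>\<omega>. indicator (B \<inter> at_state n a) \<omega> * H n \<omega> \<partial>M) = m * prob (B \<inter> at_state n a)"
  shows "AE \<omega> in M. (\<lambda>n. (\<Sum>k<n. of_bool (x k \<omega> = a) * (H k \<omega> - m)) / real n) \<longlonglongrightarrow> 0"
proof -
  define Z where "Z n \<omega> = indicator (at_state n a) \<omega> * (H n \<omega> - m)" for n \<omega>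
  have HM: "H n \<in> borel_measurable M" for n
    using measurable_from_subalg[OF subalgebra_past H(1)[of n "Suc n"]] by simp
  have "AE \<omega> in M. (\<lambda>n. (\<Sum>k<n. Z k \<omega>) / real n) \<longlonglongrightarrow> 0"
  proof (rule strong_law_orthogonal[where F=past and c="c + \<bar>m\<bar>"])
    show "subalgebra M (past n)" for n by (rule subalgebra_past)
    show "Z k \<in> borel_measurable (past n)" if "k < n" for k n
    proof -
      have [measurable]: "x k \<in> measurable (past n) (count_space UNIV)" "H k \<in> borel_measurable (past n)"
        using x_past[of k n] H(1)[OF that] that by auto
      have "at_state k a = {\<omega> \<in> space (past n). x k \<omega> = a}" by (simp add: at_state_def)
      also have "\<dots> \<in> sets (past n)" by measurable
      finally have [measurable]: "at_state k a \<in> sets (past n)" .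
      show ?thesis unfolding Z_def by measurable
    qed
    show "\<bar>Z n \<omega>\<bar> \<le> c + \<bar>m\<bar>" for n \<omega>
      using H(2)[of n \<omega>] by (auto simp: Z_def indicator_def)
    fix n B assume B: "B \<in> sets (past n)"
    have [measurable]: "B \<in> sets M" "H n \<in> borel_measurable M" by (rule past_sets[OF B], rule HM)
    have i: "integrable M (\<lambda>\<omega>. indicator (B \<inter> at_state n a) \<omega> * H n \<omega>)"
      by (rule integrable_const_bound[of _ c]) (use H(2)[of n] order_trans[OF abs_ge_zero H(2)[of n]] in \<open>auto simp: indicator_def\<close>)
    have "(\<integral>\<omega>. indicator B \<omega> * Z n \<omega> \<partial>M)
       = (\<integral>\<omega>. indicator (B \<inter> at_state n a) \<omega> * H n \<omega> - m * indicator (B \<inter> at_state n a) \<omega> \<partial>M)"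
      by (intro Bochner_Integration.integral_cong) (auto simp: Z_def indicator_def)
    also have "\<dots> = (\<integral>\<omega>. indicator (B \<inter> at_state n a) \<omega> * H n \<omega> \<partial>M)
       - m * (\<integral>\<omega>. indicator (B \<inter> at_state n a) \<omega> \<partial>M)"
      using i integrable_ind[of "B \<inter> at_state n a"] by (subst Bochner_Integration.integral_diff) auto
    also have "\<dots> = 0" by (simp add: mean[OF B])
    finally show "(\<integral>\<omega>. indicator B \<omega> * Z n \<omega> \<partial>M) = 0" .
  qed
  then show ?thesis using AE_space
    by eventually_elim (simp add: Z_def indicator_def at_state_def of_bool_def)
qed

lemma strong_law_tau:
  "AE \<omega> in M. (\<lambda>n. (\<Sum>k<n. of_bool (x k \<omega> = a) * (tau k \<omega> - m1 Q a)) / real n) \<longlonglongrightarrow> 0"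
proof -
  have "AE \<omega> in M. (\<lambda>n. (\<Sum>k<n. of_bool (x k \<omega> = a) * (tau' k \<omega> - m1 Q a)) / real n) \<longlonglongrightarrow> 0"
  proof (rule strong_law_at_state[where c=taubar])
    show "tau' k \<in> borel_measurable (past n)" if "k < n" for k n
    proof -
      have [measurable]: "T k \<in> borel_measurable (past n)" "T (Suc k) \<in> borel_measurable (past n)"
        using T_past that by auto
      show ?thesis unfolding tau'_def tau_def by measurable
    qed
  qed (use tau'_bdd mean_tau' in auto)
  moreover have "AE \<omega> in M. \<forall>n. tau' n \<omega> = tau n \<omega>" by (simp add: AE_all_countable AE_tau')
  ultimately show ?thesis by eventually_elim simp
qed

lemma strong_law_jumps:
  "AE \<omega> in M. (\<lambda>n. (\<Sum>k<n. of_bool (x k \<omega> = a) * (of_bool (x (Suc k) \<omega> = b) - emb_P Q a b)) / real n) \<longlonglongrightarrow> 0"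
proof (rule strong_law_at_state[where c=1])
  show "(\<lambda>\<omega>. of_bool (x (Suc k) \<omega> = b) :: real) \<in> borel_measurable (past n)" if "k < n" for k n
  proof -
    have [measurable]: "x (Suc k) \<in> measurable (past n) (count_space UNIV)" using x_past that by auto
    show ?thesis by measurable
  qed
  fix n B assume B: "B \<in> sets (past n)"
  have [measurable]: "B \<in> sets M" by (rule past_sets[OF B])
  have "(\<integral>\<omega>. indicator (B \<inter> at_state n a) \<omega> * of_bool (x (Suc n) \<omega> = b) \<partial>M)
     = (\<integral>\<omega>. indicat_real ({\<omega>\<in>space M. x (Suc n) \<omega> = b} \<inter> (B \<inter> at_state n a)) \<omega> \<partial>M)"
    by (intro Bochner_Integration.integral_cong) (auto simp: indicator_def)
  also have "\<dots> = emb_P Q a b * prob (B \<inter> at_state n a)" using kernel_jump[OF B, of b a] by simp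
  finally show "(\<integral>\<omega>. indicator (B \<inter> at_state n a) \<omega> * of_bool (x (Suc n) \<omega> = b) \<partial>M) = emb_P Q a b * prob (B \<inter> at_state n a)" .
qed simp

section \<open>Limiting frequencies of the embedded chain\<close>

definition freq :: "'w \<Rightarrow> nat \<Rightarrow> 'x \<Rightarrow> real" where
  "freq \<omega> n a = (\<Sum>k<n. of_bool (x k \<omega> = a)) / real n"

lemma freq_bounds: "0 \<le> freq \<omega> n a" "freq \<omega> n a \<le> 1"
proof -
  show "0 \<le> freq \<omega> n a" by (simp add: freq_def sum_nonneg)
  have "(\<Sum>k<n. of_bool (x k \<omega> = a)) \<le> (\<Sum>k<n. 1 :: real)" by (intro sum_mono) auto
  then show "freq \<omega> n a \<le> 1" by (cases "n = 0") (auto simp: freq_def)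
qed

lemma freq_sum: "n > 0 \<Longrightarrow> (\<Sum>a\<in>UNIV. freq \<omega> n a) = 1"
proof -
  assume n: "n > 0"
  have "(\<Sum>a\<in>UNIV. freq \<omega> n a) = (\<Sum>k<n. \<Sum>a\<in>UNIV. of_bool (x k \<omega> = a)) / real n"
    unfolding freq_def sum_divide_distrib[symmetric] by (subst sum.swap) simp
  also have "\<dots> = 1" using n by (simp add: of_bool_def)
  finally show ?thesis .
qed

text \<open>The empirical distribution is asymptotically invariant under P, hence under every power of P,
  and the powers of P are close to the projection onto rho.\<close>
lemma freq_tendsto:
  assumes jumps: "\<And>a b. (\<lambda>n. (\<Sum>k<n. of_bool (x k \<omega> = a) * (of_bool (x (Suc k) \<omega> = b) - emb_P Q a b)) / real n) \<longlonglongrightarrow> 0"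
  shows "(\<lambda>n. freq \<omega> n b) \<longlonglongrightarrow> rho b"
proof -
  let ?P = "emb_P Q"
  have step: "(\<lambda>n. freq \<omega> n b - (\<Sum>a\<in>UNIV. freq \<omega> n a * ?P a b)) \<longlonglongrightarrow> 0" for b
  proof -
    \<comment> \<open>Boundary term of a telescoping sum: one side counts visits at times 1 to
      \<open>n\<close>, the other at times 0 to \<open>n - 1\<close>.\<close>
    define R where "R n = (of_bool (x n \<omega> = b) - of_bool (x 0 \<omega> = b)) / real n" for n
    have R: "R \<longlonglongrightarrow> 0"
    proof (rule tendsto_0_le[where K=1])
      show "(\<lambda>n. 1 / real n) \<longlonglongrightarrow> 0" by (rule lim_const_over_n)
      show "eventually (\<lambda>n. norm (R n) \<le> norm (1 / real n) * 1) sequentially"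
        by (auto simp: R_def divide_right_mono)
    qed
    have eq: "freq \<omega> n b - (\<Sum>a\<in>UNIV. freq \<omega> n a * ?P a b) =
      (\<Sum>a\<in>UNIV. (\<Sum>k<n. of_bool (x k \<omega> = a) * (of_bool (x (Suc k) \<omega> = b) - ?P a b)) / real n) - R n" for n
    proof -
      have "(\<Sum>a\<in>UNIV. (\<Sum>k<n. of_bool (x k \<omega> = a) * (of_bool (x (Suc k) \<omega> = b) - ?P a b)) / real n)
        = (\<Sum>a\<in>UNIV. (\<Sum>k<n. of_bool (x k \<omega> = a) * of_bool (x (Suc k) \<omega> = b)) / real n) - (\<Sum>a\<in>UNIV. freq \<omega> n a * ?P a b)"
        by (simp add: right_diff_distrib sum_subtractf diff_divide_distrib freq_def sum_distrib_right)
      also have "(\<Sum>a\<in>UNIV. (\<Sum>k<n. of_bool (x k \<omega> = a) * of_bool (x (Suc k) \<omega> = b)) / real n)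
        = (\<Sum>k<n. \<Sum>a\<in>UNIV. of_bool (x k \<omega> = a) * of_bool (x (Suc k) \<omega> = b)) / real n"
        unfolding sum_divide_distrib[symmetric] by (subst sum.swap) simp
      also have "\<dots> = (\<Sum>k<n. of_bool (x (Suc k) \<omega> = b)) / real n"
        by (simp add: sum_distrib_right[symmetric])
      also have "(\<Sum>k<n. of_bool (x (Suc k) \<omega> = b) :: real)
        = (\<Sum>k<n. of_bool (x k \<omega> = b)) + (of_bool (x n \<omega> = b) - of_bool (x 0 \<omega> = b))"
        using sum_lessThan_telescope[of "\<lambda>k. of_bool (x k \<omega> = b) :: real" n]
        by (simp add: sum_subtractf)
      finally show ?thesis by (simp add: freq_def R_def add_divide_distrib)
    qed
    have "(\<lambda>n. (\<Sum>a\<in>UNIV. (\<Sum>k<n. of_bool (x k \<omega> = a) * (of_bool (x (Suc k) \<omega> = b) - ?P a b)) / real n) - R n)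
       \<longlonglongrightarrow> (\<Sum>a\<in>(UNIV::'x set). 0) - 0"
      by (intro tendsto_diff tendsto_sum jumps R)
    then show ?thesis unfolding eq by simp
  qed
  have pow: "(\<lambda>n. freq \<omega> n b - (\<Sum>a\<in>UNIV. freq \<omega> n a * mpow ?P m a b)) \<longlonglongrightarrow> 0" for m b
  proof (induction m arbitrary: b)
    case 0
    have "(\<Sum>a\<in>UNIV. freq \<omega> n a * mpow ?P 0 a b) = freq \<omega> n b" for n
      by (simp add: if_distrib[of "\<lambda>y. _ * y"] cong: if_cong)
    then show ?case by simp
  next
    case (Suc m)
    have eq: "freq \<omega> n b - (\<Sum>a\<in>UNIV. freq \<omega> n a * mpow ?P (Suc m) a b) =
      (freq \<omega> n b - (\<Sum>c\<in>UNIV. freq \<omega> n c * ?P c b)) +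
      (\<Sum>c\<in>UNIV. (freq \<omega> n c - (\<Sum>a\<in>UNIV. freq \<omega> n a * mpow ?P m a c)) * ?P c b)" for n
    proof -
      have "(\<Sum>a\<in>UNIV. freq \<omega> n a * mpow ?P (Suc m) a b) = (\<Sum>a\<in>UNIV. \<Sum>c\<in>UNIV. freq \<omega> n a * mpow ?P m a c * ?P c b)"
        by (simp add: sum_distrib_left mult.assoc)
      also have "\<dots> = (\<Sum>c\<in>UNIV. (\<Sum>a\<in>UNIV. freq \<omega> n a * mpow ?P m a c) * ?P c b)"
        by (subst sum.swap) (simp add: sum_distrib_right)
      finally show ?thesis by (simp add: left_diff_distrib sum_subtractf)
    qed
    have "(\<lambda>n. (freq \<omega> n b - (\<Sum>c\<in>UNIV. freq \<omega> n c * ?P c b)) +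
      (\<Sum>c\<in>UNIV. (freq \<omega> n c - (\<Sum>a\<in>UNIV. freq \<omega> n a * mpow ?P m a c)) * ?P c b))
      \<longlonglongrightarrow> 0 + (\<Sum>c\<in>(UNIV::'x set). 0 * ?P c b)"
      by (intro tendsto_intros step Suc)
    then show ?case unfolding eq by simp
  qed
  show ?thesis
  proof (rule LIMSEQ_I)
    fix e :: real assume e: "e > 0"
    have "(\<lambda>m. Max (range (\<lambda>a. \<Sum>y\<in>UNIV. \<bar>mpow ?P m a y - rho y\<bar>))) \<longlonglongrightarrow> 0"
      using ergodic by (simp add: embedded_chain_ergodic_def)
    then obtain m where m: "Max (range (\<lambda>a. \<Sum>y\<in>UNIV. \<bar>mpow ?P m a y - rho y\<bar>)) < e / 2"
      using order_tendstoD(2)[of _ 0 sequentially "e/2"] e eventually_happens[of _ sequentially] by fastforce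
    \<comment> \<open>A single entry is dominated by its row sum, and every row sum by the operator
      norm.\<close>
    have mb: "\<bar>mpow ?P m a b - rho b\<bar> < e / 2" for a
    proof -
      have "\<bar>mpow ?P m a b - rho b\<bar> \<le> (\<Sum>y\<in>UNIV. \<bar>mpow ?P m a y - rho y\<bar>)"
        by (rule member_le_sum) auto
      also have "\<dots> \<le> Max (range (\<lambda>a. \<Sum>y\<in>UNIV. \<bar>mpow ?P m a y - rho y\<bar>))" by (rule Max_ge) auto
      finally show ?thesis using m by simp
    qed
    obtain n0 where n0: "\<And>n. n \<ge> n0 \<Longrightarrow> \<bar>freq \<omega> n b - (\<Sum>a\<in>UNIV. freq \<omega> n a * mpow ?P m a b)\<bar> < e / 2"
      using LIMSEQ_D[OF pow[of b m], of "e/2"] e by auto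
    show "\<exists>n0. \<forall>n\<ge>n0. norm (freq \<omega> n b - rho b) < e"
    proof (intro exI[of _ "Suc n0"] allI impI)
      fix n assume n: "n \<ge> Suc n0"
      have "(\<Sum>a\<in>UNIV. freq \<omega> n a * mpow ?P m a b) - rho b = (\<Sum>a\<in>UNIV. freq \<omega> n a * (mpow ?P m a b - rho b))"
        using freq_sum[of n \<omega>] n by (simp add: right_diff_distrib sum_subtractf sum_distrib_right[symmetric])
      also have "\<bar>\<dots>\<bar> \<le> (\<Sum>a\<in>UNIV. \<bar>freq \<omega> n a * (mpow ?P m a b - rho b)\<bar>)" by (rule sum_abs)
      also have "\<dots> \<le> (\<Sum>a\<in>UNIV. freq \<omega> n a * (e / 2))"
      proof (rule sum_mono)
        fix a
        have "freq \<omega> n a * \<bar>mpow ?P m a b - rho b\<bar> \<le> freq \<omega> n a * (e / 2)"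
          by (rule mult_left_mono[OF less_imp_le[OF mb] freq_bounds(1)])
        then show "\<bar>freq \<omega> n a * (mpow ?P m a b - rho b)\<bar> \<le> freq \<omega> n a * (e / 2)"
          using freq_bounds(1)[of \<omega> n a] by (simp add: abs_mult)
      qed
      also have "\<dots> = e / 2" using freq_sum[of n \<omega>] n by (simp add: sum_distrib_right[symmetric] sum_divide_distrib[symmetric])
      finally have "\<bar>(\<Sum>a\<in>UNIV. freq \<omega> n a * mpow ?P m a b) - rho b\<bar> \<le> e / 2" .
      then show "norm (freq \<omega> n b - rho b) < e" using n0[of n] n unfolding real_norm_def by linarith
    qed
  qed
qed

text \<open>All randomness is confined to this event. It involves neither the starting time nor
  \<open>e\<close> nor any vector, and the convergence of the evolution on it is
  deterministic.\<close>

definition good_path :: "'w \<Rightarrow> bool" where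
  "good_path \<omega> \<longleftrightarrow>
     (\<forall>a b. (\<lambda>n. (\<Sum>k<n. of_bool (x k \<omega> = a \<and> x (Suc k) \<omega> = b)) / real n) \<longlonglongrightarrow> rho a * emb_P Q a b) \<and>
     (\<forall>a. (\<lambda>n. (\<Sum>k<n. of_bool (x k \<omega> = a) * tau k \<omega>) / real n) \<longlonglongrightarrow> rho a * m1 Q a)"

lemma AE_good_path: "AE \<omega> in M. good_path \<omega> \<and> (\<forall>a. (\<lambda>n. freq \<omega> n a) \<longlonglongrightarrow> rho a)"
proof -
  have "AE \<omega> in M. \<forall>a\<in>UNIV. \<forall>b\<in>UNIV. (\<lambda>n. (\<Sum>k<n. of_bool (x k \<omega> = a) * (of_bool (x (Suc k) \<omega> = b) - emb_P Q a b)) / real n) \<longlonglongrightarrow> 0"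
    by (intro AE_finite_allI strong_law_jumps) auto
  moreover have "AE \<omega> in M. \<forall>a\<in>UNIV. (\<lambda>n. (\<Sum>k<n. of_bool (x k \<omega> = a) * (tau k \<omega> - m1 Q a)) / real n) \<longlonglongrightarrow> 0"
    by (intro AE_finite_allI strong_law_tau) auto
  ultimately show ?thesis
  proof eventually_elim
    case (elim \<omega>)
    have f: "(\<lambda>n. freq \<omega> n a) \<longlonglongrightarrow> rho a" for a by (rule freq_tendsto) (use elim in auto)
    have "(\<lambda>n. (\<Sum>k<n. of_bool (x k \<omega> = a \<and> x (Suc k) \<omega> = b)) / real n) \<longlonglongrightarrow> rho a * emb_P Q a b" for a b
    proof -
      have "(\<lambda>n. (\<Sum>k<n. of_bool (x k \<omega> = a) * (of_bool (x (Suc k) \<omega> = b) - emb_P Q a b)) / real n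
          + freq \<omega> n a * emb_P Q a b) \<longlonglongrightarrow> 0 + rho a * emb_P Q a b"
        using elim by (intro tendsto_intros f) auto
      then show ?thesis
        by (simp add: freq_def right_diff_distrib sum_subtractf diff_divide_distrib sum_distrib_right of_bool_conj)
    qed
    moreover have "(\<lambda>n. (\<Sum>k<n. of_bool (x k \<omega> = a) * tau k \<omega>) / real n) \<longlonglongrightarrow> rho a * m1 Q a" for a
    proof -
      have "(\<lambda>n. (\<Sum>k<n. of_bool (x k \<omega> = a) * (tau k \<omega> - m1 Q a)) / real n
          + freq \<omega> n a * m1 Q a) \<longlonglongrightarrow> 0 + rho a * m1 Q a"
        using elim by (intro tendsto_intros f) auto
      then show ?thesis
        by (simp add: freq_def right_diff_distrib sum_subtractf diff_divide_distrib sum_distrib_right)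
    qed
    ultimately show ?case using f by (simp add: good_path_def)
  qed
qed

text \<open>A state of positive weight is visited with positive probability, since otherwise its
  frequency would vanish almost surely. As sojourn times are strictly positive, its mean sojourn
  time is positive too.\<close>

lemma Mrho_pos: "Mrho Q rho > 0"
proof -
  have rho: "rho a \<ge> 0" "(\<Sum>a\<in>UNIV. rho a) = 1" for a
    using ergodic by (auto simp: embedded_chain_ergodic_def)
  have m1_pos: "m1 Q a > 0" if a: "rho a > 0" for a
  proof -
    have "\<exists>n. prob (at_state n a) > 0"
    proof (rule ccontr)
      assume "\<not> ?thesis"
      then have z: "prob (at_state n a) = 0" for n using measure_nonneg[of M "at_state n a"] by (metis linorder_not_less order_antisym)
      have "AE \<omega> in M. \<forall>n. \<omega> \<notin> at_state n a"
        unfolding AE_all_countable using z by (intro allI AE_not_in) (simp add: null_sets_def emeasure_eq_measure)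
      then have "AE \<omega> in M. False" using AE_good_path AE_space
      proof eventually_elim
        case (elim \<omega>)
        then have "freq \<omega> n a = 0" for n by (simp add: freq_def at_state_def)
        moreover have "(\<lambda>n. freq \<omega> n a) \<longlonglongrightarrow> rho a" using elim by simp
        ultimately have "(\<lambda>n. 0) \<longlonglongrightarrow> rho a" by simp
        then show False using a by (simp add: LIMSEQ_const_iff)
      qed
      then show False by simp
    qed
    then obtain n where n: "prob (at_state n a) > 0" by blast
    have "(\<integral>\<omega>. indicator (space M \<inter> at_state n a) \<omega> * tau' n \<omega> \<partial>M) = m1 Q a * prob (space M \<inter> at_state n a)"
      using sets.top[of "past n"] by (intro mean_tau') simp
    moreover have "space M \<inter> at_state n a = at_state n a" by (auto simp: at_state_def)
    ultimately have eq: "(\<integral>\<omega>. indicator (at_state n a) \<omega> * tau' n \<omega> \<partial>M) = m1 Q a * prob (at_state n a)" by simp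
    have i: "integrable M (\<lambda>\<omega>. indicator (at_state n a) \<omega> * tau' n \<omega>)"
      by (rule integrable_const_bound[of _ taubar]) (use tau'_bdd taubar in \<open>auto simp: indicator_def\<close>)
    have nn: "(\<integral>\<omega>. indicator (at_state n a) \<omega> * tau' n \<omega> \<partial>M) \<ge> 0"
      using tau'_bdd by (intro Bochner_Integration.integral_nonneg) auto
    have "(\<integral>\<omega>. indicator (at_state n a) \<omega> * tau' n \<omega> \<partial>M) \<noteq> 0"
    proof
      assume "(\<integral>\<omega>. indicator (at_state n a) \<omega> * tau' n \<omega> \<partial>M) = 0"
      then have "AE \<omega> in M. indicator (at_state n a) \<omega> * tau' n \<omega> = 0"
        using integral_nonneg_eq_0_iff_AE[OF i] tau'_bdd by auto
      then have "AE \<omega> in M. \<omega> \<notin> at_state n a" using AE_space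
      proof eventually_elim
        case (elim \<omega>)
        moreover have "tau' n \<omega> > 0" using tau_pos[of \<omega> n] elim taubar by (simp add: tau'_def)
        ultimately show ?case by (auto simp: indicator_def)
      qed
      then have "prob (at_state n a) = 0" using prob_eq_0[of "at_state n a"] by simp
      then show False using n by simp
    qed
    then have "m1 Q a * prob (at_state n a) > 0" using nn eq by linarith
    then show ?thesis using n by (simp add: zero_less_mult_iff)
  qed
  \<comment> \<open>The sign of \<open>m1\<close> is known only for states of positive weight; the
    others contribute 0.\<close>
  have nn: "rho a * m1 Q a \<ge> 0" for a using rho(1)[of a] m1_pos[of a] by (cases "rho a = 0") auto
  obtain a where a: "rho a > 0"
  proof (rule ccontr)
    assume "\<not> thesis"
    then have "\<not> rho a > 0" for a using that by blast
    then have "rho a = 0" for a using rho(1)[of a] by (simp add: order.antisym not_less)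
    then show False using rho(2) by simp
  qed
  have "0 < rho a * m1 Q a" using a m1_pos by simp
  also have "\<dots> \<le> (\<Sum>a\<in>UNIV. rho a * m1 Q a)" by (rule member_le_sum) (use nn in auto)
  finally show ?thesis by (simp add: Mrho_def)
qed

end

section \<open>Evolution along a renewal path\<close>

text \<open>The factor \<open>e\<close> times the fast time equals \<open>e * s + (u - s)\<close>,
  which tends to \<open>u - s\<close>. At \<open>u = s\<close> the fast time does not go to
  infinity, and the limit is 0 because \<open>G s\<close> is constant.\<close>

lemma tendsto_scaled_linear_growth:
  fixes G :: "real \<Rightarrow> real"
  assumes G: "((\<lambda>r. G r / r) \<longlongrightarrow> c) at_top" and u: "s \<le> u"
  shows "((\<lambda>e. e * G (s + (u - s) / e)) \<longlongrightarrow> c * (u - s)) (at_right 0)"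
proof (cases "u = s")
  case True
  have "((\<lambda>e. e * G s) \<longlongrightarrow> 0 * G s) (at_right 0)" by (intro tendsto_intros)
  then show ?thesis using True by simp
next
  case False
  then have us: "u - s > 0" using u by simp
  have "filterlim (\<lambda>e::real. inverse e) at_top (at_right 0)" by (rule filterlim_inverse_at_top_right)
  then have "filterlim (\<lambda>e. s + (u - s) * inverse e) at_top (at_right 0)"
    by (intro filterlim_tendsto_add_at_top[OF tendsto_const] filterlim_tendsto_pos_mult_at_top[OF tendsto_const us])
  then have r: "filterlim (\<lambda>e. s + (u - s) / e) at_top (at_right 0)" by (simp add: divide_inverse)
  have "((\<lambda>e. (G (s + (u - s) / e) / (s + (u - s) / e)) * (e * s + (u - s))) \<longlongrightarrow> c * (0 * s + (u - s))) (at_right 0)"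
    by (intro tendsto_mult filterlim_compose[OF G r] tendsto_add tendsto_const tendsto_ident_at)
  moreover have "eventually (\<lambda>e. (G (s + (u - s) / e) / (s + (u - s) / e)) * (e * s + (u - s)) = e * G (s + (u - s) / e)) (at_right 0)"
    using filterlim_at_top_dense[THEN iffD1, OF r, rule_format, of 0] eventually_at_right_less[of 0]
  proof eventually_elim
    case (elim e)
    have "e * s + (u - s) = e * (s + (u - s) / e)" using elim by (simp add: distrib_left)
    then show ?case using elim by simp
  qed
  ultimately have "((\<lambda>e. e * G (s + (u - s) / e)) \<longlongrightarrow> c * (0 * s + (u - s))) (at_right 0)"
    by (rule Lim_transform_eventually)
  then show ?thesis by simp
qed

locale renewal_path =
  fixes x :: "nat \<Rightarrow> 'w \<Rightarrow> 'x::finite" and T :: "nat \<Rightarrow> 'w \<Rightarrow> real" and \<omega> :: 'w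
  assumes T_zero: "T 0 \<omega> = 0" and T_step: "\<And>n. T n \<omega> < T (Suc n) \<omega>"
    and T_fin: "\<And>t. finite {n. T n \<omega> \<le> t}"
begin

definition N :: "real \<Rightarrow> nat" where "N r = Ncount T r \<omega>"

lemma T_strict: "m < n \<Longrightarrow> T m \<omega> < T n \<omega>"
  using T_step by (rule lift_Suc_mono_less)

lemma T_mono: "m \<le> n \<Longrightarrow> T m \<omega> \<le> T n \<omega>"
  using T_strict[of m n] by (cases "m = n") auto

lemma N_bracket: assumes "r \<ge> 0" shows "T (N r) \<omega> \<le> r" "r < T (Suc (N r)) \<omega>"
proof -
  let ?S = "{n. T n \<omega> \<le> r}"
  have ne: "0 \<in> ?S" using assms T_zero by simp
  have eq: "N r = Max ?S" using ne T_fin[of r] by (auto simp: N_def Ncount_def Sup_nat_def)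
  have "Max ?S \<in> ?S" using ne T_fin[of r] by (intro Max_in) auto
  then show "T (N r) \<omega> \<le> r" by (simp add: eq)
  show "r < T (Suc (N r)) \<omega>"
  proof (rule ccontr)
    assume "\<not> ?thesis"
    then have "Suc (N r) \<in> ?S" by simp
    then have "Suc (N r) \<le> Max ?S" using T_fin[of r] by (intro Max_ge)
    then show False by (simp add: eq)
  qed
qed

lemma N_eqI: assumes "T k \<omega> \<le> r" "r < T (Suc k) \<omega>" shows "N r = k"
proof -
  have r: "r \<ge> 0" using assms(1) T_mono[of 0 k] T_zero by simp
  have "\<not> N r < k" using N_bracket[OF r] assms T_mono[of "Suc (N r)" k] by fastforce
  moreover have "\<not> k < N r" using N_bracket[OF r] assms T_mono[of "Suc k" "N r"] by fastforce
  ultimately show ?thesis by simp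
qed

lemma N_T: "N (T k \<omega>) = k" by (rule N_eqI) (auto simp: T_step)

lemma N_geI: assumes "T k \<omega> \<le> r" shows "k \<le> N r"
proof (rule ccontr)
  assume "\<not> ?thesis"
  then have "T (Suc (N r)) \<omega> \<le> T k \<omega>" by (intro T_mono) simp
  moreover have "r \<ge> 0" using assms T_mono[of 0 k] T_zero by simp
  ultimately show False using N_bracket(2)[of r] assms by simp
qed

lemma N_mono: assumes "0 \<le> r" "r \<le> r'" shows "N r \<le> N r'"
  by (rule N_geI) (use N_bracket(1)[of r] assms in auto)

text \<open>Time spent in \<open>a\<close> up to time \<open>r\<close>; the last summand is the
  sojourn still running.\<close>

definition occ :: "'x \<Rightarrow> real \<Rightarrow> real" where
  "occ a r = (\<Sum>k<N r. of_bool (x k \<omega> = a) * (T (Suc k) \<omega> - T k \<omega>)) + of_bool (x (N r) \<omega> = a) * (r - T (N r) \<omega>)"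

definition jumps :: "'x \<Rightarrow> 'x \<Rightarrow> real \<Rightarrow> real" where
  "jumps a b r = (\<Sum>k<N r. of_bool (x k \<omega> = a \<and> x (Suc k) \<omega> = b))"

lemma occ_same: "N r = N r' \<Longrightarrow> occ a r' - occ a r = of_bool (x (N r) \<omega> = a) * (r' - r)"
  by (simp add: occ_def algebra_simps)

lemma jumps_same: "N r = N r' \<Longrightarrow> jumps a b r' - jumps a b r = 0"
  by (simp add: jumps_def)

lemma occ_jump: "occ a (T (Suc (N r)) \<omega>) - occ a r = of_bool (x (N r) \<omega> = a) * (T (Suc (N r)) \<omega> - r)"
  by (simp add: occ_def N_T algebra_simps)

lemma jumps_jump: "jumps a b (T (Suc (N r)) \<omega>) - jumps a b r = of_bool (x (N r) \<omega> = a \<and> x (Suc (N r)) \<omega> = b)"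
  by (simp add: jumps_def N_T)

lemma filterlim_N: "filterlim N at_top at_top"
  unfolding filterlim_at_top
proof
  fix k
  show "eventually (\<lambda>r. k \<le> N r) at_top"
    using eventually_ge_at_top[of "T k \<omega>"] by eventually_elim (rule N_geI)
qed

text \<open>The elementary renewal theorem on one path: \<open>r\<close> lies between two
  consecutive jump times, both of which grow like \<open>m * N r\<close>.\<close>

lemma N_rate:
  assumes T: "(\<lambda>n. T n \<omega> / real n) \<longlonglongrightarrow> m" and m: "m > 0"
  shows "((\<lambda>r. real (N r) / r) \<longlongrightarrow> 1 / m) at_top"
proof -
  have T': "(\<lambda>n. T (Suc n) \<omega> / real n) \<longlonglongrightarrow> m"
  proof -
    have "(\<lambda>n. (T (Suc n) \<omega> / real (Suc n)) * (real (Suc n) / real n)) \<longlonglongrightarrow> m * 1"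
      by (intro tendsto_mult LIMSEQ_Suc[OF T] LIMSEQ_Suc_n_over_n)
    moreover have "eventually (\<lambda>n. (T (Suc n) \<omega> / real (Suc n)) * (real (Suc n) / real n) = T (Suc n) \<omega> / real n) sequentially"
      using eventually_gt_at_top[of 0] by eventually_elim (simp del: of_nat_Suc)
    ultimately have "(\<lambda>n. T (Suc n) \<omega> / real n) \<longlonglongrightarrow> m * 1" by (rule Lim_transform_eventually)
    then show ?thesis by simp
  qed
  have "((\<lambda>r. r / real (N r)) \<longlongrightarrow> m) at_top"
  proof (rule tendsto_sandwich)
    show "((\<lambda>r. T (N r) \<omega> / real (N r)) \<longlongrightarrow> m) at_top" by (rule filterlim_compose[OF T filterlim_N])
    show "((\<lambda>r. T (Suc (N r)) \<omega> / real (N r)) \<longlongrightarrow> m) at_top" by (rule filterlim_compose[OF T' filterlim_N])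
    show "eventually (\<lambda>r. T (N r) \<omega> / real (N r) \<le> r / real (N r)) at_top"
      using eventually_ge_at_top[of 0] by eventually_elim (intro divide_right_mono N_bracket, auto)
    show "eventually (\<lambda>r. r / real (N r) \<le> T (Suc (N r)) \<omega> / real (N r)) at_top"
      using eventually_ge_at_top[of 0] by eventually_elim (auto intro!: divide_right_mono less_imp_le[OF N_bracket(2)])
  qed
  from tendsto_inverse[OF this] show ?thesis using m by (simp add: divide_inverse mult.commute)
qed

text \<open>Averages per step become averages per unit of time on division by the mean step
  length.\<close>

lemma N_time_change:
  assumes T: "(\<lambda>n. T n \<omega> / real n) \<longlonglongrightarrow> m" and m: "m > 0" and U: "(\<lambda>n. U n / real n) \<longlonglongrightarrow> c"
  shows "((\<lambda>r. U (N r) / r) \<longlongrightarrow> c / m) at_top"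
proof -
  have "((\<lambda>r. (U (N r) / real (N r)) * (real (N r) / r)) \<longlongrightarrow> c * (1 / m)) at_top"
    by (intro tendsto_mult filterlim_compose[OF U filterlim_N] N_rate[OF T m])
  moreover have "eventually (\<lambda>r. (U (N r) / real (N r)) * (real (N r) / r) = U (N r) / r) at_top"
    using filterlim_N[unfolded filterlim_at_top, rule_format, of 1] by eventually_elim simp
  ultimately have "((\<lambda>r. U (N r) / r) \<longlongrightarrow> c * (1 / m)) at_top" by (rule Lim_transform_eventually)
  then show ?thesis by simp
qed

lemma occ_rate:
  assumes T: "(\<lambda>n. T n \<omega> / real n) \<longlonglongrightarrow> m" and m: "m > 0"
    and U: "(\<lambda>n. (\<Sum>k<n. of_bool (x k \<omega> = a) * (T (Suc k) \<omega> - T k \<omega>)) / real n) \<longlonglongrightarrow> c"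
  shows "((\<lambda>r. occ a r / r) \<longlongrightarrow> c / m) at_top"
proof -
  \<comment> \<open>The running sojourn is negligible because \<open>T (N r) / r\<close> tends to
    1.\<close>
  have one: "((\<lambda>r. 1 - T (N r) \<omega> / r) \<longlongrightarrow> 1 - m / m) at_top"
    by (intro tendsto_diff tendsto_const N_time_change[OF T m T])
  have "((\<lambda>r. of_bool (x (N r) \<omega> = a) * (r - T (N r) \<omega>) / r) \<longlongrightarrow> 0) at_top"
  proof (rule tendsto_0_le[where K=1])
    show "((\<lambda>r. 1 - T (N r) \<omega> / r) \<longlongrightarrow> 0) at_top" using one m by simp
    show "eventually (\<lambda>r. norm (of_bool (x (N r) \<omega> = a) * (r - T (N r) \<omega>) / r) \<le> norm (1 - T (N r) \<omega> / r) * 1) at_top"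
      using eventually_gt_at_top[of 0]
    proof eventually_elim
      case (elim r)
      have "1 - T (N r) \<omega> / r = (r - T (N r) \<omega>) / r" using elim by (simp add: diff_divide_distrib)
      then show ?case by simp
    qed
  qed
  from tendsto_add[OF N_time_change[OF T m U] this] show ?thesis
    by (simp add: occ_def add_divide_distrib)
qed

end

section \<open>The rescaled product on one sample path\<close>

lemma time_domain_mem:
  assumes "time_domain J" "a \<in> J" "b \<in> J" "a \<le> u" "u \<le> b"
  shows "u \<in> J" and "0 \<le> a"
  using assms by (auto simp: time_domain_def)

lemma norm_blinfun_le1: "norm (B :: 'a::real_normed_vector \<Rightarrow>\<^sub>L 'b::real_normed_vector) \<le> 1 \<Longrightarrow> norm (B y) \<le> norm y"
  using norm_blinfun[of B y] mult_right_mono[of "norm B" 1 "norm y"] by simp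

lemma blinfun_compose_id [simp]:
  "B o\<^sub>L id_blinfun = B" "id_blinfun o\<^sub>L B = B"
  by (auto intro!: blinfun_eqI)

lemma blinfun_compose_assoc: "(A o\<^sub>L B) o\<^sub>L C = A o\<^sub>L (B o\<^sub>L C)"
  by (auto intro!: blinfun_eqI)

locale path_evolution = renewal_path x T \<omega>
  for x :: "nat \<Rightarrow> 'w \<Rightarrow> 'x::finite" and T \<omega> +
  fixes J :: "real set" and Gs :: "'x \<Rightarrow> real \<Rightarrow> real \<Rightarrow> 'y::real_normed_vector \<Rightarrow>\<^sub>L 'y"
    and D :: "real \<Rightarrow> 'x \<Rightarrow> 'x \<Rightarrow> 'y \<Rightarrow>\<^sub>L 'y" and e s :: real
  assumes J: "time_domain J" and semigroup: "\<And>y. inhom_semigroup J (Gs y)"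
    and s: "s \<in> J" and e: "0 < e"
begin

definition V :: "real \<Rightarrow> 'y \<Rightarrow>\<^sub>L 'y" where "V u = Veps Gs D x T e s u \<omega>"
text \<open>The unscaled time that belongs to the macroscopic time \<open>u\<close>;
  \<open>th\<close> is its inverse evaluated at the jump times.\<close>

definition r :: "real \<Rightarrow> real" where "r u = s + (u - s) / e"
definition th :: "nat \<Rightarrow> real" where "th k = s + e * (T k \<omega> - s)"

lemma s0: "0 \<le> s" using time_domain_mem(2)[OF J s s] by simp

lemma r_ge: "s \<le> u \<Longrightarrow> s \<le> r u" using e by (simp add: r_def)

lemma r_nonneg: "s \<le> u \<Longrightarrow> 0 \<le> r u" using r_ge s0 by fastforce

lemma r_s[simp]: "r s = s" by (simp add: r_def)

lemma r_th: "r (th k) = T k \<omega>" using e by (simp add: r_def th_def)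

lemma r_mono: "u \<le> v \<Longrightarrow> r u \<le> r v" using e by (simp add: r_def divide_right_mono)

lemma r_diff: "e * (r v - r u) = v - u" using e by (simp add: r_def diff_divide_distrib[symmetric])

lemma th_le_iff: "th k \<le> u \<longleftrightarrow> T k \<omega> \<le> r u"
proof -
  have "T k \<omega> \<le> r u \<longleftrightarrow> e * (r (th k)) \<le> e * r u" using e by (simp add: r_th)
  also have "\<dots> \<longleftrightarrow> 0 \<le> e * (r u - r (th k))" by (simp add: right_diff_distrib)
  also have "\<dots> \<longleftrightarrow> th k \<le> u" by (simp add: r_diff)
  finally show ?thesis ..
qed

lemma th_less_iff: "u < th k \<longleftrightarrow> r u < T k \<omega>"
  using th_le_iff[of k u] by auto

lemma N_r_mono: "s \<le> u \<Longrightarrow> u \<le> v \<Longrightarrow> N (r u) \<le> N (r v)"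
  by (intro N_mono r_nonneg r_mono)

lemma th_next: "s \<le> u \<Longrightarrow> u < th (Suc (N (r u)))"
  using N_bracket(2)[OF r_nonneg] by (simp add: th_less_iff)

text \<open>Unlike th, the jump times Te are counted from the starting time s, which is itself Te 0.\<close>
definition Te :: "nat \<Rightarrow> real" where "Te n = (if n = 0 then s else th (N s + n))"

definition factor :: "nat \<Rightarrow> 'y \<Rightarrow>\<^sub>L 'y" where
  "factor k = Gs (x (N s + (k - 1)) \<omega>) (Te (k - 1)) (Te k) o\<^sub>L D e (x (N s + (k - 1)) \<omega>) (x (N s + k) \<omega>)"

lemma Tfrom_scaled: "s + e * (Tfrom T s k \<omega> - s) = Te k"
  by (simp add: Te_def Tfrom_def th_def N_def)

lemma xfrom_eq: "xfrom x T s k \<omega> = x (N s + k) \<omega>"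
proof (cases k)
  case (Suc j)
  then show ?thesis using N_T[of "N s + k"] by (simp add: xfrom_def xproc_def Tfrom_def N_def)
qed (simp add: xfrom_def xproc_def Tfrom_def N_def)

lemma V_eq:
  assumes "s \<le> u" "N (r u) = N s + n"
  shows "V u = lprod factor n o\<^sub>L Gs (x (N s + n) \<omega>) (Te n) u"
proof -
  have l: "(\<lambda>k. Gs (x (N s + (k - 1)) \<omega>) (Te (k - 1)) (Te k) o\<^sub>L D e (x (N s + (k - 1)) \<omega>) (x (N s + k) \<omega>)) = factor"
    by (simp add: fun_eq_iff factor_def)
  have "Ncount T (r u) \<omega> - Ncount T s \<omega> = n" "xproc x T (r u) \<omega> = x (N s + n) \<omega>"
    using assms(2) by (auto simp: N_def xproc_def)
  then show ?thesis unfolding V_def Veps_def Let_def Tfrom_scaled xfrom_eq r_def[symmetric] l by simp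
qed

lemma Te_le: assumes "s \<le> u" "N (r u) = N s + n" shows "s \<le> Te n" "Te n \<le> u"
proof -
  show "s \<le> Te n"
  proof (cases "n = 0")
    case False
    have "s < T (Suc (N s)) \<omega>" using N_bracket(2)[OF s0] .
    also have "\<dots> \<le> T (N s + n) \<omega>" using False by (intro T_mono) simp
    finally show ?thesis using False e by (simp add: Te_def th_def)
  qed (simp add: Te_def)
  show "Te n \<le> u"
    using N_bracket(1)[OF r_nonneg[OF assms(1)]] assms by (cases "n = 0") (auto simp: Te_def th_le_iff)
qed

lemma N_r_split: assumes "s \<le> u" obtains n where "N (r u) = N s + n"
  using N_r_mono[of s u] assms le_Suc_ex[of "N s" "N (r u)"] by auto

lemma Gs_comp: "a \<in> J \<Longrightarrow> b \<in> J \<Longrightarrow> c \<in> J \<Longrightarrow> a \<le> b \<Longrightarrow> b \<le> c \<Longrightarrow> Gs y a b o\<^sub>L Gs y b c = Gs y a c"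
  and Gs_refl: "a \<in> J \<Longrightarrow> Gs y a a = id_blinfun"
  using semigroup by (auto simp: inhom_semigroup_def)

lemma V_start: "V s = id_blinfun"
  using V_eq[of s 0] by (simp add: Te_def Gs_refl s)

text \<open>Together with \<open>V_start\<close> and \<open>V_jump\<close> this replaces the
  explicit product in all estimates along a path.\<close>

lemma V_segment:
  assumes "s \<le> u" "u \<le> v" "v \<in> J" "N (r v) = N (r u)"
  shows "V v = V u o\<^sub>L Gs (x (N (r u)) \<omega>) u v"
proof -
  obtain n where n: "N (r u) = N s + n" using N_r_split assms by blast
  have "Te n \<in> J" "u \<in> J" using Te_le[OF assms(1) n] time_domain_mem(1)[OF J s assms(3)] assms by auto
  then have "Gs y (Te n) v = Gs y (Te n) u o\<^sub>L Gs y u v" for y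
    using Gs_comp[of "Te n" u v] Te_le[OF assms(1) n] assms by simp
  then show ?thesis using V_eq[of u n] V_eq[of v n] assms n by (simp add: blinfun_compose_assoc)
qed

lemma V_jump:
  assumes "s \<le> u" "th (Suc (N (r u))) \<in> J"
  shows "V (th (Suc (N (r u)))) = V u o\<^sub>L Gs (x (N (r u)) \<omega>) u (th (Suc (N (r u))))
     o\<^sub>L D e (x (N (r u)) \<omega>) (x (Suc (N (r u))) \<omega>)"
proof -
  obtain n where n: "N (r u) = N s + n" using N_r_split assms by blast
  define v where "v = th (Suc (N (r u)))"
  have uv: "u < v" unfolding v_def by (rule th_next[OF assms(1)])
  have J': "Te n \<in> J" "u \<in> J" "v \<in> J"
    using Te_le[OF assms(1) n] time_domain_mem(1)[OF J s assms(2)] assms uv by (auto simp: v_def)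
  have nv: "N (r v) = N s + Suc n" by (simp add: v_def r_th N_T n)
  have Tev: "Te (Suc n) = v" by (simp add: Te_def v_def n)
  have "V v = lprod factor (Suc n) o\<^sub>L Gs (x (N s + Suc n) \<omega>) v v"
    using V_eq[of v "Suc n"] nv uv assms Tev by simp
  also have "\<dots> = lprod factor n o\<^sub>L (Gs (x (N s + n) \<omega>) (Te n) v o\<^sub>L D e (x (N s + n) \<omega>) (x (N s + Suc n) \<omega>))"
    using J' by (simp add: Gs_refl factor_def Tev)
  also have "Gs (x (N s + n) \<omega>) (Te n) v = Gs (x (N s + n) \<omega>) (Te n) u o\<^sub>L Gs (x (N s + n) \<omega>) u v"
    using Gs_comp[of "Te n" u v] Te_le[OF assms(1) n] J' uv by simp
  finally show ?thesis using V_eq[of u n] n assms unfolding v_def by (simp add: blinfun_compose_assoc)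
qed

text \<open>An interval estimate that is stable under concatenation only has to be checked between
  consecutive jumps and across a single jump.\<close>
lemma chain_induct:
  assumes ab: "s \<le> a" "a \<le> b" "b \<in> J"
    and seg: "\<And>u v. a \<le> u \<Longrightarrow> u \<le> v \<Longrightarrow> v \<le> b \<Longrightarrow> N (r v) = N (r u) \<Longrightarrow> P u v"
    and jump: "\<And>u. a \<le> u \<Longrightarrow> th (Suc (N (r u))) \<le> b \<Longrightarrow> P u (th (Suc (N (r u))))"
    and trans: "\<And>u v w. a \<le> u \<Longrightarrow> u \<le> v \<Longrightarrow> v \<le> w \<Longrightarrow> w \<le> b \<Longrightarrow> P u v \<Longrightarrow> P v w \<Longrightarrow> P u w"
  shows "P a b"
proof -
  \<comment> \<open>The induction runs over the number of jumps between \<open>u\<close> and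
    \<open>b\<close>.\<close>
  have "P u b" if "a \<le> u" "u \<le> b" "N (r b) - N (r u) = n" for u n
    using that
  proof (induction n arbitrary: u)
    case 0
    then have "N (r b) = N (r u)" using N_r_mono[of u b] ab by simp
    then show ?case using seg 0 by auto
  next
    case (Suc n)
    define v where "v = th (Suc (N (r u)))"
    have uv: "u < v" unfolding v_def using th_next Suc ab by simp
    have "T (Suc (N (r u))) \<omega> \<le> T (N (r b)) \<omega>" using Suc by (intro T_mono) simp
    also have "\<dots> \<le> r b" using N_bracket(1) r_nonneg ab by simp
    finally have vb: "v \<le> b" by (simp add: v_def th_le_iff)
    have nv: "N (r v) = Suc (N (r u))" by (simp add: v_def r_th N_T)
    have "P u v" unfolding v_def using jump Suc vb by (simp add: v_def)
    moreover have "P v b" using Suc uv vb nv by (intro Suc.IH) auto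
    ultimately show ?case using trans[of u v b] Suc uv vb by auto
  qed
  then show ?thesis using ab by blast
qed

end

locale contractive_path_evolution = path_evolution +
  assumes Gs_contr: "\<And>y a b. a \<in> J \<Longrightarrow> b \<in> J \<Longrightarrow> a \<le> b \<Longrightarrow> norm (Gs y a b) \<le> 1"
    and D_contr: "\<And>y y'. norm (D e y y') \<le> 1"
begin

lemma V_contr: assumes "s \<le> u" "u \<in> J" shows "norm (V u) \<le> 1"
proof -
  \<comment> \<open>An implication from one end point to the other is a property that concatenates,
    as \<open>chain_induct\<close> requires.\<close>
  have "norm (V s) \<le> 1 \<longrightarrow> norm (V u) \<le> 1"
  proof (rule chain_induct[where P="\<lambda>u v. norm (V u) \<le> 1 \<longrightarrow> norm (V v) \<le> 1", OF order_refl assms])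
    fix u' v' assume seg: "s \<le> u'" "u' \<le> v'" "v' \<le> u" "N (r v') = N (r u')"
    then have J': "u' \<in> J" "v' \<in> J" using time_domain_mem(1)[OF J s assms(2)] by auto
    have "norm (V v') \<le> norm (V u') * norm (Gs (x (N (r u')) \<omega>) u' v')"
      using V_segment[of u' v'] seg J' norm_blinfun_compose by metis
    also have "\<dots> \<le> norm (V u') * 1" using Gs_contr J' seg by (intro mult_left_mono) auto
    finally show "norm (V u') \<le> 1 \<longrightarrow> norm (V v') \<le> 1" by simp
  next
    fix u' assume jump: "s \<le> u'" "th (Suc (N (r u'))) \<le> u"
    define v' where "v' = th (Suc (N (r u')))"
    have uv: "u' < v'" unfolding v'_def using th_next jump by simp
    then have J': "u' \<in> J" "v' \<in> J" using time_domain_mem(1)[OF J s assms(2)] jump by (auto simp: v'_def)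
    have "norm (V v') \<le> norm (V u' o\<^sub>L Gs (x (N (r u')) \<omega>) u' v') * norm (D e (x (N (r u')) \<omega>) (x (Suc (N (r u'))) \<omega>))"
      using V_jump[of u'] jump J' norm_blinfun_compose unfolding v'_def by metis
    also have "\<dots> \<le> (norm (V u') * 1) * 1"
    proof (intro mult_mono D_contr)
      have "norm (V u' o\<^sub>L Gs (x (N (r u')) \<omega>) u' v') \<le> norm (V u') * norm (Gs (x (N (r u')) \<omega>) u' v')"
        by (rule norm_blinfun_compose)
      also have "\<dots> \<le> norm (V u') * 1" using Gs_contr J' uv by (intro mult_left_mono) auto
      finally show "norm (V u' o\<^sub>L Gs (x (N (r u')) \<omega>) u' v') \<le> norm (V u') * 1" .
    qed auto
    finally show "norm (V u') \<le> 1 \<longrightarrow> norm (V (th (Suc (N (r u'))))) \<le> 1" by (simp add: v'_def)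
  qed simp
  then show ?thesis using V_start by (simp add: norm_blinfun_id_le)
qed

lemma V_apply_le: "s \<le> u \<Longrightarrow> u \<in> J \<Longrightarrow> norm (V u y) \<le> norm y"
  using norm_blinfun_le1 V_contr by blast

end

section \<open>First-order expansions of inhomogeneous semigroups\<close>

text \<open>At an end point of \<open>J\<close> one of the two one-sided limits in
  \<open>gen_at\<close> is vacuous. They are never both vacuous, and this is what makes generator
  values unique.\<close>

lemma time_domain_at_nontrivial:
  assumes J: "time_domain J" and t: "t \<in> J"
  shows "at 0 within {h. 0 < h \<and> t + h \<in> J} \<noteq> bot \<or> at 0 within {h. 0 < h \<and> t - h \<in> J} \<noteq> bot"
proof -
  have *: "at (0::real) within S \<noteq> bot" if "d > 0" "{0<..<d} \<subseteq> S" for S d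
  proof -
    have "(0::real) islimpt {0<..<d}" using that by (simp add: islimpt_greaterThanLessThan1)
    then show ?thesis using islimpt_subset[OF _ that(2)] trivial_limit_within by blast
  qed
  from J consider "J = {0..}" | Tinf where "Tinf > 0" "J = {0..Tinf}" by (auto simp: time_domain_def)
  then show ?thesis
  proof cases
    case 1 then show ?thesis using t by (intro disjI1 *[of 1]) auto
  next
    case 2
    show ?thesis
    proof (cases "t = Tinf")
      case True then show ?thesis using 2 t by (intro disjI2 *[of Tinf]) auto
    next
      case False then show ?thesis using 2 t by (intro disjI1 *[of "Tinf - t"]) auto
    qed
  qed
qed

lemma gen_eqI:
  assumes J: "time_domain J" and t: "t \<in> J" and g: "gen_at J G t f g"
  shows "gen J G t f = g"
  unfolding gen_def
proof (rule the_equality)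
  fix g' assume "gen_at J G t f g'"
  note g' = this
  show "g' = g" using time_domain_at_nontrivial[OF J t]
  proof
    assume nb: "at 0 within {h. 0 < h \<and> t + h \<in> J} \<noteq> bot"
    show ?thesis by (rule tendsto_unique[OF nb]) (use g g' in \<open>auto simp: gen_at_def\<close>)
  next
    assume nb: "at 0 within {h. 0 < h \<and> t - h \<in> J} \<noteq> bot"
    show ?thesis by (rule tendsto_unique[OF nb]) (use g g' in \<open>auto simp: gen_at_def\<close>)
  qed
qed (rule g)

lemma gen_at_gen:
  assumes J: "time_domain J" and t: "t \<in> J" and f: "f \<in> gen_dom_all J G"
  shows "gen_at J G t f (gen J G t f)"
  using assms gen_eqI[OF J t] by (auto simp: gen_dom_all_def gen_dom_def)

lemma D1_eqI:
  assumes e: "0 \<le> e" "e \<le> 1" and g: "D1_at D e y y' f g"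
  shows "D1 D e y y' f = g"
  unfolding D1_def
proof (rule the_equality)
  have "0 islimpt {h. e + h \<in> {0..1}}"
  proof (cases "e = 1")
    case True
    have "(0::real) islimpt {-1<..<0}" by (simp add: islimpt_greaterThanLessThan2)
    then show ?thesis by (rule islimpt_subset) (use True in auto)
  next
    case False
    then have "(0::real) islimpt {0<..<1-e}" using e by (simp add: islimpt_greaterThanLessThan1)
    then show ?thesis by (rule islimpt_subset) (use e in auto)
  qed
  then have nb: "at 0 within {h. e + h \<in> {0..1}} \<noteq> bot" using trivial_limit_within by blast
  fix g' assume "D1_at D e y y' f g'"
  then show "g' = g" using g tendsto_unique[OF nb] unfolding D1_at_def by blast
qed (rule g)

lemma eventually_at_right_shift:
  fixes t :: real
  assumes lim: "(\<phi> \<longlongrightarrow> g) (at 0 within {h. 0 < h \<and> t + h \<in> J})" and v: "t < v" "{t..v} \<subseteq> J" and e: "e > 0"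
  shows "eventually (\<lambda>w. dist (\<phi> (w - t)) g < e) (at_right t)"
proof -
  obtain d where d: "d > 0" "\<And>h. 0 < h \<Longrightarrow> t + h \<in> J \<Longrightarrow> h < d \<Longrightarrow> dist (\<phi> h) g < e"
    using tendstoD[OF lim e] unfolding eventually_at by (auto simp: dist_real_def)
  show ?thesis unfolding eventually_at_right_field
  proof (intro exI[of _ "min v (t + d)"] conjI allI impI)
    fix w assume w: "t < w" "w < min v (t + d)"
    then have "w \<in> {t..v}" by auto
    then have "t + (w - t) \<in> J" using v by auto
    then show "dist (\<phi> (w - t)) g < e" using d(2)[of "w - t"] w by auto
  qed (use v d in auto)
qed

lemma regularD:
  assumes "regular J iota G"
  shows regular_dom: "f \<in> Y1 iota \<Longrightarrow> f \<in> gen_dom_all J G"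
    and regular_invariant: "a \<in> J \<Longrightarrow> b \<in> J \<Longrightarrow> a \<le> b \<Longrightarrow> f \<in> Y1 iota \<Longrightarrow> G a b f \<in> Y1 iota"
    and regular_cont_Y1: "t \<in> J \<Longrightarrow> f \<in> Y1 iota \<Longrightarrow> continuous_on {u \<in> J. u \<le> t} (\<lambda>u. toZ iota (G u t f))"
    and regular_cont: "a \<in> J \<Longrightarrow> continuous_on (Jfrom J a) (\<lambda>u. G a u f')"
  using assms by (auto simp: regular_def DeltaJ_def image_subset_iff)

text \<open>To the right of \<open>w\<close>, the path \<open>G u w f\<close> grows at the rate
  \<open>G u w\<close> applied to the generator at \<open>w\<close>; contractivity passes on the
  error of the difference quotient. Comparing with a straight line in direction \<open>y\<close>
  avoids integrals.\<close>

lemma semigroup_first_order: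
  fixes G :: "real \<Rightarrow> real \<Rightarrow> 'y::{banach, second_countable_topology} \<Rightarrow>\<^sub>L 'y"
  assumes J: "time_domain J" and G: "inhom_semigroup J G" and reg: "regular J iota G"
    and contr: "\<And>a b. a \<in> J \<Longrightarrow> b \<in> J \<Longrightarrow> a \<le> b \<Longrightarrow> norm (G a b) \<le> 1"
    and uv: "u \<in> J" "v \<in> J" "u \<le> v" and f: "f \<in> Y1 iota"
    and bd: "\<And>w. u \<le> w \<Longrightarrow> w \<le> v \<Longrightarrow> norm (G u w (gen J G w f) - y) \<le> C"
  shows "norm (G u v f - f - (v - u) *\<^sub>R y) \<le> C * (v - u)"
proof -
  define F where "F w = G u w f - (w - u) *\<^sub>R y" for w
  have fd: "f \<in> gen_dom_all J G" using regular_dom[OF reg f] .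
  have sub: "{u..v} \<subseteq> J" using time_domain_mem(1)[OF J uv(1,2)] by auto
  have Jsub: "{u..v} \<subseteq> Jfrom J u" using sub by (auto simp: Jfrom_def)
  have "continuous_on (Jfrom J u) (\<lambda>w. G u w f)" by (rule regular_cont[OF reg uv(1)])
  then have "continuous_on {u..v} (\<lambda>w. G u w f)" by (rule continuous_on_subset[OF _ Jsub])
  then have cont: "continuous_on {u..v} F" unfolding F_def
    by (intro continuous_on_diff continuous_on_scaleR continuous_on_id continuous_on_const)
  have "norm (F v - F u) \<le> C * (v - u)"
  proof (rule norm_diff_le_of_right_increments[OF uv(3) cont])
    fix t e :: real assume t: "u \<le> t" "t < v" and e: "e > 0"
    have tJ: "t \<in> J" using sub t by auto
    define A where "A = gen J G t f"
    have "((\<lambda>h. (1 / h) *\<^sub>R (G t (t + h) f - f)) \<longlongrightarrow> A) (at 0 within {h. 0 < h \<and> t + h \<in> J})"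
      using gen_at_gen[OF J tJ fd] by (simp add: gen_at_def A_def)
    moreover have "{t..v} \<subseteq> J" using sub t by auto
    ultimately have ev: "eventually (\<lambda>w. dist ((1 / (w - t)) *\<^sub>R (G t (t + (w - t)) f - f)) A < e) (at_right t)"
      using eventually_at_right_shift t e by blast
    moreover have "eventually (\<lambda>w. w \<in> {t<..<v}) (at_right t)"
      using t by (simp add: eventually_at_right_field) (auto intro!: exI[of _ v])
    ultimately show "eventually (\<lambda>w. norm (F w - F t) \<le> (C + e) * (w - t)) (at_right t)"
    proof eventually_elim
      case (elim w)
      then have w: "w \<in> J" "t < w" using sub t by auto
      define q where "q = (1 / (w - t)) *\<^sub>R (G t w f - f)"
      have q: "norm (q - A) < e" "G t w f - f = (w - t) *\<^sub>R q"
        using elim w by (auto simp: q_def dist_norm)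
      have comp: "G u w f = G u t (G t w f)"
        using G uv tJ w t unfolding inhom_semigroup_def
        by (metis blinfun_apply_blinfun_compose less_imp_le)
      have "F w - F t = G u t (G t w f - f) - (w - t) *\<^sub>R y"
        by (simp add: F_def comp blinfun.diff_right algebra_simps)
      also have "\<dots> = (w - t) *\<^sub>R (G u t (q - A) + (G u t A - y))"
        by (simp add: q(2) blinfun.scaleR_right blinfun.diff_right algebra_simps)
      also have "norm \<dots> = (w - t) * norm (G u t (q - A) + (G u t A - y))" using w by simp
      also have "\<dots> \<le> (w - t) * (e + C)"
      proof (rule mult_left_mono)
        have "norm (G u t (q - A)) \<le> norm (q - A)"
          using norm_blinfun_le1 contr uv tJ t by blast
        then show "norm (G u t (q - A) + (G u t A - y)) \<le> e + C"
          using norm_triangle_ineq[of "G u t (q - A)" "G u t A - y"] q bd[of t] t by (simp add: A_def)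
      qed (use w in simp)
      finally show ?case by (simp add: algebra_simps)
    qed
  qed
  moreover have "F u = f" using G uv by (simp add: F_def inhom_semigroup_def)
  ultimately show ?thesis by (simp add: F_def algebra_simps)
qed

text \<open>The left difference quotient at \<open>w\<close> gives the growth of
  \<open>G w t f\<close> as \<open>w\<close> decreases, so the mean value inequality is applied in
  reversed time. The quotient error enters with no operator in front of it, so no norm bound on
  \<open>G\<close> is involved; this matters for \<open>Gh\<close>, whose contractivity is a
  conclusion.\<close>

lemma backward_first_order:
  fixes G :: "real \<Rightarrow> real \<Rightarrow> 'y::{banach, second_countable_topology} \<Rightarrow>\<^sub>L 'y"
  assumes J: "time_domain J" and G: "inhom_semigroup J G" and reg: "regular J iota G"
    and gen: "\<And>w f. w \<in> J \<Longrightarrow> f \<in> Y1 iota \<Longrightarrow> gen_at J G w f (A w f)"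
    and ab: "a \<in> J" "b \<in> J" "t \<in> J" "a \<le> b" "b \<le> t" and f: "f \<in> Y1 iota"
    and bd: "\<And>w. a \<le> w \<Longrightarrow> w \<le> b \<Longrightarrow> norm (A w (G w t f) - y) \<le> C"
  shows "norm (G a t f - G b t f - (b - a) *\<^sub>R y) \<le> C * (b - a)"
proof -
  define F where "F w = G (- w) t f - w *\<^sub>R y" for w
  have sub: "{a..b} \<subseteq> J" using time_domain_mem(1)[OF J ab(1,2)] by auto
  have inv: "G w t f \<in> Y1 iota" if "w \<in> J" "w \<le> t" for w
    using regular_invariant[OF reg that(1) ab(3) that(2) f] .
  \<comment> \<open>Regularity gives continuity in the first argument only for vectors of
    \<open>Y1\<close> and in the \<open>Y1\<close> norm; the embedding carries it to
    \<open>Y\<close>.\<close>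
  have "continuous_on {u \<in> J. u \<le> t} (\<lambda>w. toZ iota (G w t f))"
    by (rule regular_cont_Y1[OF reg ab(3) f])
  then have "continuous_on {u \<in> J. u \<le> t} (\<lambda>w. iota (toZ iota (G w t f)))"
    by (intro continuous_intros)
  moreover have "iota (toZ iota (G w t f)) = G w t f" if "w \<in> {u \<in> J. u \<le> t}" for w
    using inv that by (auto simp: toZ_def Y1_def f_inv_into_f)
  ultimately have "continuous_on {u \<in> J. u \<le> t} (\<lambda>w. G w t f)"
    by (rule continuous_on_eq)
  then have c1: "continuous_on {a..b} (\<lambda>w. G w t f)" by (rule continuous_on_subset) (use sub ab in auto)
  have cont: "continuous_on {-b..-a} F" unfolding F_def
    by (intro continuous_on_diff continuous_on_scaleR continuous_on_const continuous_on_id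
        continuous_on_compose2[OF c1] continuous_intros) auto
  have "norm (F (-a) - F (-b)) \<le> C * (-a - (-b))"
  proof (rule norm_diff_le_of_right_increments[OF _ cont])
    show "- b \<le> - a" using ab by simp
    fix \<tau> e :: real assume \<tau>: "- b \<le> \<tau>" "\<tau> < - a" and e: "e > 0"
    define w where "w = - \<tau>"
    have w: "a < w" "w \<le> b" using \<tau> by (auto simp: w_def)
    have wJ: "w \<in> J" using sub w by auto
    define g where "g = G w t f"
    have gY: "g \<in> Y1 iota" unfolding g_def using inv wJ w ab by auto
    have "((\<lambda>h. (1 / h) *\<^sub>R (G (w - h) w g - g)) \<longlongrightarrow> A w g) (at 0 within {h. 0 < h \<and> w - h \<in> J})"
      using gen[OF wJ gY] by (simp add: gen_at_def)
    moreover have "{h. 0 < h \<and> w - h \<in> J} = {h. 0 < h \<and> \<tau> + h \<in> {z. - z \<in> J}}"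
      by (simp add: w_def)
    moreover have "{\<tau>..-a} \<subseteq> {z. - z \<in> J}"
    proof
      fix z assume z: "z \<in> {\<tau>..-a}"
      then have "- z \<in> {a..b}" using w by (auto simp: w_def)
      then show "z \<in> {z. - z \<in> J}" using sub by auto
    qed
    ultimately have ev: "eventually (\<lambda>z. dist ((1 / (z - \<tau>)) *\<^sub>R (G (w - (z - \<tau>)) w g - g)) (A w g) < e) (at_right \<tau>)"
      using eventually_at_right_shift[of _ "A w g" \<tau> "{z. - z \<in> J}" "-a" e] \<tau> e by simp
    moreover have "eventually (\<lambda>z. z \<in> {\<tau><..<-a}) (at_right \<tau>)"
      using \<tau> by (simp add: eventually_at_right_field) (auto intro!: exI[of _ "-a"])
    ultimately show "eventually (\<lambda>z. norm (F z - F \<tau>) \<le> (C + e) * (z - \<tau>)) (at_right \<tau>)"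
    proof eventually_elim
      case (elim z)
      then have zJ: "- z \<in> J" and z: "\<tau> < z" "- z \<le> w" using sub w by (auto simp: w_def)
      define q where "q = (1 / (z - \<tau>)) *\<^sub>R (G (- z) w g - g)"
      have wz: "w - (z - \<tau>) = - z" by (simp add: w_def)
      have q: "norm (q - A w g) < e" "G (- z) w g - g = (z - \<tau>) *\<^sub>R q"
        using elim(1) z unfolding wz by (auto simp: q_def dist_norm)
      have "G (- z) w o\<^sub>L G w t = G (- z) t" using G zJ wJ ab z w unfolding inhom_semigroup_def by simp
      then have comp: "G (- z) t f = G (- z) w g" unfolding g_def by (metis blinfun_apply_blinfun_compose)
      have "F z - F \<tau> = (z - \<tau>) *\<^sub>R ((q - A w g) + (A w g - y))"
        using q(2) by (simp add: F_def comp g_def w_def algebra_simps)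
      also have "norm \<dots> = (z - \<tau>) * norm ((q - A w g) + (A w g - y))" using z by simp
      also have "\<dots> \<le> (z - \<tau>) * (e + C)"
        using norm_triangle_ineq[of "q - A w g" "A w g - y"] q bd[of w] w z
        by (intro mult_left_mono) (auto simp: g_def)
      finally show ?case by (simp add: algebra_simps)
    qed
  qed
  then show ?thesis by (simp add: F_def algebra_simps)
qed

section \<open>First-order expansion along a path\<close>

lemma sum_of_bool_scaleR:
  fixes w :: "'x::finite \<Rightarrow> 'a::real_vector"
  shows "(\<Sum>y\<in>UNIV. (of_bool (c = y) * t) *\<^sub>R w y) = t *\<^sub>R w c"
proof -
  have "(\<Sum>y\<in>UNIV. (of_bool (c = y) * t) *\<^sub>R w y) = (\<Sum>y\<in>UNIV. if c = y then t *\<^sub>R w y else 0)"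
    by (intro sum.cong) auto
  then show ?thesis by simp
qed

locale smooth_path_evolution = contractive_path_evolution x T \<omega> J Gs D e s
  for x :: "nat \<Rightarrow> 'w \<Rightarrow> 'x::finite" and T \<omega> J
    and Gs :: "'x \<Rightarrow> real \<Rightarrow> real \<Rightarrow> 'y::{banach, second_countable_topology} \<Rightarrow>\<^sub>L 'y" and D e s +
  fixes iota :: "'z::real_normed_vector \<Rightarrow>\<^sub>L 'y" and CL :: real
  assumes reg: "\<And>y. regular J iota (Gs y)" and CL: "CL \<ge> 0"
    and gen_bound: "\<And>y u z. u \<in> J \<Longrightarrow> norm (gen J (Gs y) u (iota z)) \<le> CL * norm z"
    and D_bound: "\<And>y y' z. norm (D e y y' (iota z) - iota z) \<le> CL * norm z * e"
begin

text \<open>A jump takes no time yet moves a vector of \<open>Y1\<close> by order \<open>e\<close>;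
  charging \<open>e\<close> for each jump makes all local bounds additive in one monotone
  function.\<close>

definition clock :: "real \<Rightarrow> real" where "clock u = u + e * real (N (r u))"

lemma clock_mono: "s \<le> u \<Longrightarrow> u \<le> v \<Longrightarrow> v - u \<le> clock v - clock u"
  using N_r_mono[of u v] e by (simp add: clock_def)

lemma clock_segment: "N (r v) = N (r u) \<Longrightarrow> clock v - clock u = v - u"
  by (simp add: clock_def)

lemma clock_jump: "clock (th (Suc (N (r u)))) - clock u = th (Suc (N (r u))) - u + e"
  by (simp add: clock_def r_th N_T algebra_simps)

lemma iota_Y1: "iota z \<in> Y1 iota" by (simp add: Y1_def)

lemma Gs_increment:
  assumes "u \<in> J" "v \<in> J" "u \<le> v"
  shows "norm (Gs y u v (iota z) - iota z) \<le> CL * norm z * (v - u)"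
proof -
  have "norm (Gs y u v (iota z) - iota z - (v - u) *\<^sub>R 0) \<le> CL * norm z * (v - u)"
  proof (rule semigroup_first_order[OF J semigroup reg Gs_contr assms iota_Y1])
    fix w assume w: "u \<le> w" "w \<le> v"
    then have wJ: "w \<in> J" using time_domain_mem(1)[OF J assms(1,2)] by auto
    have "norm (Gs y u w (gen J (Gs y) w (iota z))) \<le> norm (gen J (Gs y) w (iota z))"
      by (rule norm_blinfun_le1[OF Gs_contr[OF assms(1) wJ w(1)]])
    then show "norm (Gs y u w (gen J (Gs y) w (iota z)) - 0) \<le> CL * norm z"
      using gen_bound[OF wJ, of y z] by simp
  qed
  then show ?thesis by simp
qed

text \<open>On \<open>Y1\<close> both ingredients are Lipschitz, the semigroups in time and the jump
  operators in \<open>e\<close>; contractivity of the factors in front preserves these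
  bounds.\<close>

lemma V_lipschitz:
  assumes ab: "s \<le> a" "a \<le> b" "b \<in> J"
  shows "norm (V b (iota z) - V a (iota z)) \<le> CL * norm z * (clock b - clock a)"
proof (rule chain_induct[where P="\<lambda>u v. norm (V v (iota z) - V u (iota z)) \<le> CL * norm z * (clock v - clock u)", OF ab])
  have inJ: "u \<in> J" if "a \<le> u" "u \<le> b" for u
    using time_domain_mem(1)[OF J s ab(3)] that ab by auto
  {
    fix u v assume uv: "a \<le> u" "u \<le> v" "v \<le> b" "N (r v) = N (r u)"
    have J': "u \<in> J" "v \<in> J" using inJ uv by auto
    have "V v (iota z) - V u (iota z) = V u (Gs (x (N (r u)) \<omega>) u v (iota z) - iota z)"
      using V_segment[of u v] uv ab J' by (simp add: blinfun.diff_right)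
    also have "norm \<dots> \<le> norm (Gs (x (N (r u)) \<omega>) u v (iota z) - iota z)"
      using V_apply_le J' uv ab by auto
    also have "\<dots> \<le> CL * norm z * (v - u)" by (rule Gs_increment[OF J' uv(2)])
    finally show "norm (V v (iota z) - V u (iota z)) \<le> CL * norm z * (clock v - clock u)"
      using clock_segment[OF uv(4)] by simp
  next
    fix u assume u: "a \<le> u" "th (Suc (N (r u))) \<le> b"
    define v where "v = th (Suc (N (r u)))"
    have uv: "u < v" unfolding v_def using th_next u ab by simp
    have J': "u \<in> J" "v \<in> J" using inJ[of u] inJ[of v] u uv by (auto simp: v_def)
    define G where "G = Gs (x (N (r u)) \<omega>) u v"
    define d where "d = D e (x (N (r u)) \<omega>) (x (Suc (N (r u))) \<omega>) (iota z)"
    have "V v (iota z) - V u (iota z) = V u (G (d - iota z) + (G (iota z) - iota z))"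
      using V_jump[of u] u ab J'(2) by (simp add: v_def[symmetric] G_def d_def blinfun.diff_right blinfun.add_right)
    also have "norm \<dots> \<le> norm (G (d - iota z) + (G (iota z) - iota z))"
      using V_apply_le J' u ab by auto
    also have "\<dots> \<le> norm (G (d - iota z)) + norm (G (iota z) - iota z)" by (rule norm_triangle_ineq)
    also have "\<dots> \<le> CL * norm z * e + CL * norm z * (v - u)"
    proof (rule add_mono)
      have "norm (G (d - iota z)) \<le> norm (d - iota z)"
        unfolding G_def by (rule norm_blinfun_le1) (use Gs_contr J' uv in auto)
      also have "\<dots> \<le> CL * norm z * e" unfolding d_def by (rule D_bound)
      finally show "norm (G (d - iota z)) \<le> CL * norm z * e" .
      show "norm (G (iota z) - iota z) \<le> CL * norm z * (v - u)"
        unfolding G_def using Gs_increment[OF J'] uv by auto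
    qed
    also have "\<dots> = CL * norm z * (clock v - clock u)"
      unfolding v_def clock_jump by (simp add: algebra_simps)
    finally show "norm (V (th (Suc (N (r u)))) (iota z) - V u (iota z)) \<le> CL * norm z * (clock (th (Suc (N (r u)))) - clock u)"
      by (simp add: v_def)
  next
    fix u v w assume "norm (V v (iota z) - V u (iota z)) \<le> CL * norm z * (clock v - clock u)"
      "norm (V w (iota z) - V v (iota z)) \<le> CL * norm z * (clock w - clock v)"
    then show "norm (V w (iota z) - V u (iota z)) \<le> CL * norm z * (clock w - clock u)"
      using norm_triangle_ineq[of "V w (iota z) - V v (iota z)" "V v (iota z) - V u (iota z)"]
      by (simp add: algebra_simps)
  }
qed

text \<open>Accumulated first-order increment: scaled time spent in each state weighted by
  \<open>g\<close>, scaled number of each transition weighted by \<open>d\<close>.\<close>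

definition drift :: "('x \<Rightarrow> 'y) \<Rightarrow> ('x \<Rightarrow> 'x \<Rightarrow> 'y) \<Rightarrow> real \<Rightarrow> 'y" where
  "drift g d u = (\<Sum>y\<in>UNIV. (e * occ y (r u)) *\<^sub>R g y) + (\<Sum>y\<in>UNIV. \<Sum>y'\<in>UNIV. (e * jumps y y' (r u)) *\<^sub>R d y y')"

lemma drift_segment:
  assumes "N (r v) = N (r u)"
  shows "drift g d v - drift g d u = (v - u) *\<^sub>R g (x (N (r u)) \<omega>)"
proof -
  have "e * occ y (r v) - e * occ y (r u) = of_bool (x (N (r u)) \<omega> = y) * (v - u)" for y
    using occ_same[of "r u" "r v" y] assms r_diff[of v u] by (simp add: right_diff_distrib[symmetric] mult.left_commute)
  moreover have "jumps y y' (r v) = jumps y y' (r u)" for y y'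
    using jumps_same[of "r u" "r v" y y'] assms by simp
  moreover have "drift g d v - drift g d u = (\<Sum>y\<in>UNIV. (e * occ y (r v) - e * occ y (r u)) *\<^sub>R g y)
      + (\<Sum>y\<in>UNIV. \<Sum>y'\<in>UNIV. (e * jumps y y' (r v) - e * jumps y y' (r u)) *\<^sub>R d y y')"
    by (simp add: drift_def sum_subtractf scaleR_left_diff_distrib)
  ultimately show ?thesis by (simp add: sum_of_bool_scaleR)
qed

lemma drift_jump:
  defines "v \<equiv> \<lambda>u. th (Suc (N (r u)))"
  shows "drift g d (v u) - drift g d u =
    (v u - u) *\<^sub>R g (x (N (r u)) \<omega>) + e *\<^sub>R d (x (N (r u)) \<omega>) (x (Suc (N (r u))) \<omega>)"
proof -
  have rv: "r (v u) = T (Suc (N (r u))) \<omega>" by (simp add: v_def r_th)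
  have "e * occ y (r (v u)) - e * occ y (r u) = of_bool (x (N (r u)) \<omega> = y) * (v u - u)" for y
    using occ_jump[of y "r u"] r_diff[of "v u" u] unfolding rv by (simp add: right_diff_distrib[symmetric] mult.left_commute)
  moreover have "e * jumps y y' (r (v u)) - e * jumps y y' (r u)
      = of_bool (x (N (r u)) \<omega> = y) * (of_bool (x (Suc (N (r u))) \<omega> = y') * e)" for y y'
    using jumps_jump[of y y' "r u"] unfolding rv by (simp add: right_diff_distrib[symmetric] of_bool_conj)
  moreover have "drift g d (v u) - drift g d u = (\<Sum>y\<in>UNIV. (e * occ y (r (v u)) - e * occ y (r u)) *\<^sub>R g y)
      + (\<Sum>y\<in>UNIV. \<Sum>y'\<in>UNIV. (e * jumps y y' (r (v u)) - e * jumps y y' (r u)) *\<^sub>R d y y')"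
    by (simp add: drift_def sum_subtractf scaleR_left_diff_distrib)
  moreover have "(\<Sum>y\<in>UNIV. \<Sum>y'\<in>UNIV. (of_bool (x (N (r u)) \<omega> = y) * (of_bool (x (Suc (N (r u))) \<omega> = y') * e)) *\<^sub>R d y y')
     = e *\<^sub>R d (x (N (r u)) \<omega>) (x (Suc (N (r u))) \<omega>)"
  proof -
    have "(\<Sum>y\<in>UNIV. \<Sum>y'\<in>UNIV. (of_bool (x (N (r u)) \<omega> = y) * (of_bool (x (Suc (N (r u))) \<omega> = y') * e)) *\<^sub>R d y y')
      = (\<Sum>y\<in>UNIV. (of_bool (x (N (r u)) \<omega> = y) * 1) *\<^sub>R (\<Sum>y'\<in>UNIV. (of_bool (x (Suc (N (r u))) \<omega> = y') * e) *\<^sub>R d y y'))"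
      by (simp add: scaleR_sum_right)
    then show ?thesis by (simp only: sum_of_bool_scaleR scaleR_one)
  qed
  ultimately show ?thesis by (simp add: sum_of_bool_scaleR)
qed

text \<open>Every local increment appears behind \<open>V u\<close> and possibly a semigroup factor.
  Since \<open>g\<close> and \<open>d\<close> take values in \<open>Y1\<close>, replacing
  \<open>V u\<close> by \<open>V a\<close>, and that factor by the identity, costs at most
  \<open>CL * Cg\<close> times the clock increment each, whence the 2. Summed over the interval,
  these errors are quadratic in the clock increment.\<close>

lemma V_first_order:
  fixes g :: "'x \<Rightarrow> 'z" and d :: "'x \<Rightarrow> 'x \<Rightarrow> 'z"
  assumes ab: "s \<le> a" "a \<le> b" "b \<in> J"
    and g: "\<And>y w. a \<le> w \<Longrightarrow> w \<le> b \<Longrightarrow> norm (gen J (Gs y) w (iota z) - iota (g y)) \<le> \<eta>" "\<And>y. norm (g y) \<le> Cg"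
    and d: "\<And>y y'. norm (D e y y' (iota z) - iota z - e *\<^sub>R iota (d y y')) \<le> \<eta> * e" "\<And>y y'. norm (d y y') \<le> Cg"
  defines "S \<equiv> drift (\<lambda>y. iota (g y)) (\<lambda>y y'. iota (d y y'))"
  shows "norm (V b (iota z) - V a (iota z) - V a (S b - S a))
     \<le> (\<eta> + 2 * CL * Cg * (clock b - clock a)) * (clock b - clock a)"
proof -
  define f where "f = iota z"
  define B where "B = clock b - clock a"
  define K where "K = \<eta> + 2 * CL * Cg * B"
  have B0: "b - a \<le> B" "0 \<le> B" using clock_mono[of a b] ab by (auto simp: B_def)
  have Cg0: "Cg \<ge> 0" using g(2)[of undefined] norm_ge_zero order_trans by blast
  have clock_le: "clock u - clock a \<le> B" if "a \<le> u" "u \<le> b" for u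
    using clock_mono[of u b] that ab by (auto simp: B_def)
  have inJ: "u \<in> J" if "a \<le> u" "u \<le> b" for u
    using time_domain_mem(1)[OF J s ab(3)] that ab by auto
  have CB: "CL * norm w * h \<le> CL * Cg * B" if "norm w \<le> Cg" "h \<le> B" "0 \<le> h" for w :: 'z and h
    using that CL Cg0 by (intro mult_mono) auto
  have Va: "norm (V u (iota w) - V a (iota w)) \<le> CL * Cg * B" if "a \<le> u" "u \<le> b" "norm w \<le> Cg" for u w
  proof -
    have "norm (V u (iota w) - V a (iota w)) \<le> CL * norm w * (clock u - clock a)"
      by (rule V_lipschitz) (use that ab inJ in auto)
    also have "\<dots> \<le> CL * Cg * B"
      using clock_le[of u] clock_mono[of a u] that ab by (intro CB) auto
    finally show ?thesis .
  qed
  have Gi: "norm (Gs y u v (iota w) - iota w) \<le> CL * Cg * B" if "a \<le> u" "u \<le> v" "v \<le> b" "norm w \<le> Cg" for y u v w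
  proof -
    have "norm (Gs y u v (iota w) - iota w) \<le> CL * norm w * (v - u)"
      by (rule Gs_increment) (use that inJ in auto)
    also have "\<dots> \<le> CL * Cg * B" using that B0 by (intro CB) auto
    finally show ?thesis .
  qed
  have seg: "norm (V u (Gs y u v f - f) - V a ((v - u) *\<^sub>R iota (g y))) \<le> K * (v - u)"
    if uv: "a \<le> u" "u \<le> v" "v \<le> b" for y u v
  proof -
    have J': "u \<in> J" "v \<in> J" using inJ uv by auto
    have 1: "norm (Gs y u v f - f - (v - u) *\<^sub>R iota (g y)) \<le> (\<eta> + CL * Cg * B) * (v - u)"
      unfolding f_def
    proof (rule semigroup_first_order[OF J semigroup reg Gs_contr J' uv(2) iota_Y1])
      fix w assume w: "u \<le> w" "w \<le> v"
      have wJ: "w \<in> J" using inJ w uv by auto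
      have "norm (Gs y u w (gen J (Gs y) w (iota z)) - iota (g y))
        = norm (Gs y u w (gen J (Gs y) w (iota z) - iota (g y)) + (Gs y u w (iota (g y)) - iota (g y)))"
        by (simp add: blinfun.diff_right)
      also have "\<dots> \<le> norm (Gs y u w (gen J (Gs y) w (iota z) - iota (g y))) + norm (Gs y u w (iota (g y)) - iota (g y))"
        by (rule norm_triangle_ineq)
      also have "\<dots> \<le> \<eta> + CL * Cg * B"
      proof (rule add_mono)
        have "norm (Gs y u w (gen J (Gs y) w (iota z) - iota (g y))) \<le> norm (gen J (Gs y) w (iota z) - iota (g y))"
          by (rule norm_blinfun_le1[OF Gs_contr[OF J'(1) wJ w(1)]])
        also have "\<dots> \<le> \<eta>" using g(1) w uv by auto
        finally show "norm (Gs y u w (gen J (Gs y) w (iota z) - iota (g y))) \<le> \<eta>" .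
        show "norm (Gs y u w (iota (g y)) - iota (g y)) \<le> CL * Cg * B" using Gi g(2) w uv by auto
      qed
      finally show "norm (Gs y u w (gen J (Gs y) w (iota z)) - iota (g y)) \<le> \<eta> + CL * Cg * B" .
    qed
    have "norm (V u (Gs y u v f - f) - V a ((v - u) *\<^sub>R iota (g y)))
        = norm (V u (Gs y u v f - f - (v - u) *\<^sub>R iota (g y)) + (v - u) *\<^sub>R (V u (iota (g y)) - V a (iota (g y))))"
      by (simp add: blinfun.diff_right blinfun.scaleR_right scaleR_diff_right)
    also have "\<dots> \<le> norm (V u (Gs y u v f - f - (v - u) *\<^sub>R iota (g y))) + norm ((v - u) *\<^sub>R (V u (iota (g y)) - V a (iota (g y))))"
      by (rule norm_triangle_ineq)
    also have "\<dots> \<le> (\<eta> + CL * Cg * B) * (v - u) + (v - u) * (CL * Cg * B)"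
    proof (rule add_mono)
      have su: "s \<le> u" using uv ab by simp
      have "norm (V u (Gs y u v f - f - (v - u) *\<^sub>R iota (g y))) \<le> norm (Gs y u v f - f - (v - u) *\<^sub>R iota (g y))"
        by (rule V_apply_le[OF su J'(1)])
      also note 1
      finally show "norm (V u (Gs y u v f - f - (v - u) *\<^sub>R iota (g y))) \<le> (\<eta> + CL * Cg * B) * (v - u)" .
      show "norm ((v - u) *\<^sub>R (V u (iota (g y)) - V a (iota (g y)))) \<le> (v - u) * (CL * Cg * B)"
        using Va[of u "g y"] uv g(2) by (simp add: mult_left_mono)
    qed
    also have "\<dots> = K * (v - u)" by (simp add: K_def algebra_simps)
    finally show ?thesis .
  qed
  have "norm (V b f - V a f - V a (S b - S a)) \<le> K * (clock b - clock a)"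
  proof (rule chain_induct[where P="\<lambda>u v. norm (V v f - V u f - V a (S v - S u)) \<le> K * (clock v - clock u)", OF ab])
    fix u v assume uv: "a \<le> u" "u \<le> v" "v \<le> b" "N (r v) = N (r u)"
    have "V v f - V u f = V u (Gs (x (N (r u)) \<omega>) u v f - f)"
      using V_segment[of u v] uv ab inJ[of v] by (simp add: blinfun.diff_right)
    moreover have "S v - S u = (v - u) *\<^sub>R iota (g (x (N (r u)) \<omega>))"
      unfolding S_def by (rule drift_segment[OF uv(4)])
    ultimately show "norm (V v f - V u f - V a (S v - S u)) \<le> K * (clock v - clock u)"
      using seg[OF uv(1-3)] clock_segment[OF uv(4)] by simp
  next
    fix u assume u: "a \<le> u" "th (Suc (N (r u))) \<le> b"
    define v where "v = th (Suc (N (r u)))"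
    have uv: "u < v" "v \<le> b" unfolding v_def using th_next u ab by simp_all
    have J': "u \<in> J" "v \<in> J" using inJ[of u] inJ[of v] u uv by auto
    define y where "y = x (N (r u)) \<omega>"
    define y' where "y' = x (Suc (N (r u))) \<omega>"
    define G where "G = Gs y u v"
    define dd where "dd = iota (d y y')"
    define R where "R = D e y y' f - f - e *\<^sub>R dd"
    have R: "norm R \<le> \<eta> * e" using d(1)[of y y'] by (simp add: R_def dd_def f_def)
    have Df: "D e y y' f = f + e *\<^sub>R dd + R" by (simp add: R_def)
    have "V v f = V u (G (D e y y' f))"
      using V_jump[of u] u ab J'(2) by (simp add: v_def[symmetric] G_def y_def y'_def)
    moreover have "S v - S u = (v - u) *\<^sub>R iota (g y) + e *\<^sub>R dd"
      unfolding S_def v_def y_def y'_def dd_def by (rule drift_jump)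
    \<comment> \<open>Four parts of a jump: the semigroup segment, the remainder of
      \<open>D\<close>, the cost of removing the semigroup factor in front of the derivative term,
      and the cost of freezing \<open>V\<close> at \<open>a\<close> in front of it.\<close>
    ultimately have "norm (V v f - V u f - V a (S v - S u)) = norm
       ((V u (G f - f) - V a ((v - u) *\<^sub>R iota (g y))) + V u (G R) + e *\<^sub>R (V u (G dd - dd)) + e *\<^sub>R (V u dd - V a dd))"
      unfolding Df by (simp add: blinfun.add_right blinfun.diff_right blinfun.scaleR_right scaleR_diff_right)
        (simp add: algebra_simps)
    also have "\<dots> \<le> K * (v - u) + \<eta> * e + e * (CL * Cg * B) + e * (CL * Cg * B)"
    proof (intro norm_triangle_mono)
      show "norm (V u (G f - f) - V a ((v - u) *\<^sub>R iota (g y))) \<le> K * (v - u)"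
        unfolding G_def using seg u uv by auto
      have "norm (V u (G R)) \<le> norm (G R)" using V_apply_le J' u ab by auto
      also have "\<dots> \<le> norm R" unfolding G_def by (rule norm_blinfun_le1) (use Gs_contr J' uv in auto)
      finally show "norm (V u (G R)) \<le> \<eta> * e" using R by simp
      have "norm (V u (G dd - dd)) \<le> norm (G dd - dd)" using V_apply_le J' u ab by auto
      also have "\<dots> \<le> CL * Cg * B" unfolding G_def dd_def using Gi u uv d(2) by auto
      finally show "norm (e *\<^sub>R V u (G dd - dd)) \<le> e * (CL * Cg * B)" using e by simp
      have "norm (V u dd - V a dd) \<le> CL * Cg * B" unfolding dd_def using Va u uv d(2) by auto
      then show "norm (e *\<^sub>R (V u dd - V a dd)) \<le> e * (CL * Cg * B)" using e by simp
    qed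
    also have "\<dots> = K * (clock v - clock u)" unfolding v_def clock_jump K_def by (simp add: algebra_simps)
    finally show "norm (V (th (Suc (N (r u)))) f - V u f - V a (S (th (Suc (N (r u)))) - S u)) \<le> K * (clock (th (Suc (N (r u)))) - clock u)"
      by (simp add: v_def)
  next
    fix u v w assume 1: "norm (V v f - V u f - V a (S v - S u)) \<le> K * (clock v - clock u)"
      "norm (V w f - V v f - V a (S w - S v)) \<le> K * (clock w - clock v)"
    have eq: "V w f - V u f - V a (S w - S u) = (V v f - V u f - V a (S v - S u)) + (V w f - V v f - V a (S w - S v))"
      by (simp add: blinfun.diff_right algebra_simps)
    have "norm (V w f - V u f - V a (S w - S u)) \<le> K * (clock v - clock u) + K * (clock w - clock v)"
      unfolding eq by (rule norm_triangle_mono[OF 1])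
    then show "norm (V w f - V u f - V a (S w - S u)) \<le> K * (clock w - clock u)" by (simp add: algebra_simps)
  qed
  then show ?thesis by (simp add: f_def K_def B_def)
qed

text \<open>Between jumps the path is a fixed operator applied to a continuous semigroup path. So
  right continuity needs a jump-free interval starting at \<open>t\<close>, and the left limit needs
  one ending at \<open>t\<close>.\<close>

lemma V_rcll: "rcll (Jfrom J s) (\<lambda>t. V t f)"
  unfolding rcll_def
proof (intro ballI conjI)
  fix t assume "t \<in> Jfrom J s"
  then have t: "t \<in> J" "s \<le> t" by (auto simp: Jfrom_def)
  let ?R = "at t within (Jfrom J s \<inter> {t..})" and ?L = "at t within (Jfrom J s \<inter> {..<t})"
  have cont: "((\<lambda>v. V u (Gs y u v f)) \<longlongrightarrow> V u (Gs y u t f)) (at t within (Jfrom J u))"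
    if "u \<in> J" "u \<le> t" for u y
  proof -
    have "continuous_on (Jfrom J u) (\<lambda>v. Gs y u v f)" by (rule regular_cont[OF reg that(1)])
    then have "((\<lambda>v. Gs y u v f) \<longlongrightarrow> Gs y u t f) (at t within (Jfrom J u))"
      using that t by (auto simp: continuous_on_def Jfrom_def)
    then show ?thesis by (rule bounded_linear.tendsto[OF blinfun.bounded_linear_right])
  qed
  show "continuous ?R (\<lambda>t. V t f)"
    unfolding continuous_within
  proof (rule Lim_transform_eventually)
    define y where "y = x (N (r t)) \<omega>"
    have "((\<lambda>v. V t (Gs y t v f)) \<longlongrightarrow> V t (Gs y t t f)) ?R"
      by (rule tendsto_within_subset[OF cont]) (use t in \<open>auto simp: Jfrom_def\<close>)
    then show "((\<lambda>v. V t (Gs y t v f)) \<longlongrightarrow> V t f) ?R"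
      using t by (simp add: Gs_refl)
    have "eventually (\<lambda>v. v < th (Suc (N (r t)))) ?R"
      by (rule order_tendstoD(2)[OF tendsto_ident_at th_next[OF t(2)]])
    moreover have "eventually (\<lambda>v. v \<in> Jfrom J s \<inter> {t..}) ?R"
      by (auto simp: eventually_at_filter)
    ultimately show "eventually (\<lambda>v. V t (Gs y t v f) = V v f) ?R"
    proof eventually_elim
      case (elim v)
      then have v: "t \<le> v" "v \<in> J" by (auto simp: Jfrom_def)
      have "N (r v) = N (r t)"
        using elim v t N_bracket(1)[OF r_nonneg[OF t(2)]] r_mono[OF v(1)] by (intro N_eqI) (auto simp: th_less_iff)
      then show ?case using V_segment[OF t(2) v] by (simp add: y_def)
    qed
  qed
  show "\<exists>l. ((\<lambda>t. V t f) \<longlongrightarrow> l) ?L"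
  proof (cases "t = s")
    case True
    then have "Jfrom J s \<inter> {..<t} = {}" by (auto simp: Jfrom_def)
    then show ?thesis by simp
  next
    case False
    then have st: "s < t" using t by simp
    \<comment> \<open>The interval starts at the last jump strictly before \<open>t\<close>, or at
      \<open>s\<close> if that is later. If \<open>t\<close> is itself a jump time, the preceding
      jump is taken.\<close>
    obtain u where u: "s \<le> u" "u < t" "\<And>v. u \<le> v \<Longrightarrow> v < t \<Longrightarrow> N (r v) = N (r u)"
    proof (cases "th (N (r t)) < t")
      case True
      define u where "u = max s (th (N (r t)))"
      have "N (r v) = N (r t)" if "u \<le> v" "v < t" for v
      proof (rule N_eqI)
        show "T (N (r t)) \<omega> \<le> r v" using that by (simp add: u_def th_le_iff[symmetric])
        show "r v < T (Suc (N (r t))) \<omega>"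
          using r_mono[of v t] that N_bracket(2)[OF r_nonneg[OF t(2)]] by simp
      qed
      moreover have "u < t" "s \<le> u" using True st by (auto simp: u_def)
      ultimately show ?thesis using that[of u] by auto
    next
      case False
      have "th (N (r t)) \<le> t" using N_bracket(1)[OF r_nonneg[OF t(2)]] by (simp add: th_le_iff)
      then have eq: "th (N (r t)) = t" using False by simp
      then have rt: "r t = T (N (r t)) \<omega>" by (metis r_th)
      \<comment> \<open>The jump with index 0 sits at time 0, whereas
        \<open>r t > s \<ge> 0\<close>.\<close>
      have "N (r t) \<noteq> 0"
      proof
        assume "N (r t) = 0"
        then have "r t = 0" using rt T_zero by simp
        moreover have "r t > s" using st e by (simp add: r_def)
        ultimately show False using s0 by simp
      qed
      then obtain k where k: "N (r t) = Suc k" using not0_implies_Suc by blast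
      define u where "u = max s (th k)"
      have "N (r v) = k" if "u \<le> v" "v < t" for v
      proof (rule N_eqI)
        show "T k \<omega> \<le> r v" using that by (simp add: u_def th_le_iff[symmetric])
        show "r v < T (Suc k) \<omega>" using that eq k by (simp add: th_less_iff[symmetric])
      qed
      moreover have "th k < t" using eq k T_step[of k] by (metis r_th th_less_iff)
      then have "u < t" "s \<le> u" using st by (auto simp: u_def)
      ultimately show ?thesis using that[of u] by auto
    qed
    have uJ: "u \<in> J" using time_domain_mem(1)[OF J s t(1)] u by auto
    define y where "y = x (N (r u)) \<omega>"
    have "((\<lambda>v. V u (Gs y u v f)) \<longlongrightarrow> V u (Gs y u t f)) (at t within ({u..<t} \<inter> J))"
      by (rule tendsto_within_subset[OF cont]) (use uJ u in \<open>auto simp: Jfrom_def\<close>)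
    moreover have "?L = at t within ({u..<t} \<inter> J)"
      by (rule at_within_nhd[of t "{u<..}"]) (use u in \<open>auto simp: Jfrom_def\<close>)
    ultimately have lim: "((\<lambda>v. V u (Gs y u v f)) \<longlongrightarrow> V u (Gs y u t f)) ?L"
      by simp
    have "eventually (\<lambda>v. u < v) ?L"
      by (rule order_tendstoD(1)[OF tendsto_ident_at u(2)])
    moreover have "eventually (\<lambda>v. v \<in> Jfrom J s \<inter> {..<t}) ?L"
      by (auto simp: eventually_at_filter)
    ultimately have "eventually (\<lambda>v. V u (Gs y u v f) = V v f) ?L"
    proof eventually_elim
      case (elim v)
      then have v: "u \<le> v" "v \<in> J" "v < t" by (auto simp: Jfrom_def)
      then show ?case using V_segment[OF u(1) v(1,2) u(3)[OF v(1,3)]] by (simp add: y_def)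
    qed
    with lim have "((\<lambda>v. V v f) \<longlongrightarrow> V u (Gs y u t f)) ?L"
      by (rule Lim_transform_eventually)
    then show ?thesis by blast
  qed
qed

end

section \<open>The averaged generator\<close>

locale averaged_evolution = bounded_markov_renewal M x T Q rho taubar
  for M :: "'w measure" and x :: "nat \<Rightarrow> 'w \<Rightarrow> 'x::finite" and T Q rho taubar +
  fixes J :: "real set"
    and iota :: "'z::{banach, second_countable_topology} \<Rightarrow>\<^sub>L 'y::{banach, second_countable_topology}"
    and Gs :: "'x \<Rightarrow> real \<Rightarrow> real \<Rightarrow> 'y \<Rightarrow>\<^sub>L 'y"
    and D :: "real \<Rightarrow> 'x \<Rightarrow> 'x \<Rightarrow> 'y \<Rightarrow>\<^sub>L 'y"
    and Gh :: "real \<Rightarrow> real \<Rightarrow> 'y \<Rightarrow>\<^sub>L 'y"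
  assumes J: "time_domain J"
    and semigroups: "\<And>y. inhom_semigroup J (Gs y)"
    and D0: "\<And>y z. D 0 y z = id_blinfun"
    and dense: "\<exists>C. C \<subseteq> Dhat J iota Gs D \<and> closure C = UNIV \<and> closure (toZ iota ` C) = UNIV"
    and a0: "A0 J iota Gs D Q" and a3: "A3 J iota Gs D Q rho Gh"
    and Gs_meas: "(\<lambda>(r, t, y, f). blinfun_apply (Gs y r t) f) \<in> borel_measurable
        (restrict_space (borel \<Otimes>\<^sub>M borel \<Otimes>\<^sub>M count_space UNIV \<Otimes>\<^sub>M borel)
           {(r, t, y, f). (r, t) \<in> DeltaJ J})"
    and D_meas: "\<And>e. e \<in> {0<..1} \<Longrightarrow> (\<lambda>(y, z, f). blinfun_apply (D e y z) f) \<in> borel_measurable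
        (count_space UNIV \<Otimes>\<^sub>M count_space UNIV \<Otimes>\<^sub>M borel)"
begin

lemma iota_in_Y1: "iota z \<in> Y1 iota" by (simp add: Y1_def)

lemma iota_toZ: "f \<in> Y1 iota \<Longrightarrow> iota (toZ iota f) = f"
  by (auto simp: toZ_def Y1_def f_inv_into_f)

lemma Gs_regular: "regular J iota (Gs y)"
  and Gs_norm: "a \<in> J \<Longrightarrow> b \<in> J \<Longrightarrow> a \<le> b \<Longrightarrow> norm (Gs y a b) \<le> 1"
  and D_norm: "0 < e \<Longrightarrow> e \<le> 1 \<Longrightarrow> norm (D e y y') \<le> 1"
  and Y1_D1dom: "f \<in> Y1 iota \<Longrightarrow> f \<in> D1dom D"
  and gen_cont: "f \<in> Y1 iota \<Longrightarrow> continuous_on J (\<lambda>t. gen J (Gs y) t f)"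
  and gen_linear: "u \<in> J \<Longrightarrow> bounded_linear (\<lambda>z. gen J (Gs y) u (iota z))"
  and gen_bounded: "\<exists>C. \<forall>u\<in>J. \<forall>z. norm (gen J (Gs y) u (iota z)) \<le> C * norm z"
  using a0 by (auto simp: A0_def DeltaJ_def)

lemma Dhat_facts:
  assumes "f \<in> Dhat J iota Gs D"
  shows "f \<in> Y1 iota" "u \<in> J \<Longrightarrow> gen J (Gs y) u f \<in> Y1 iota" "D1 D 0 y y' f \<in> Y1 iota"
    "\<exists>C. \<forall>u\<in>J. \<forall>y. norm (toZ iota (gen J (Gs y) u f)) \<le> C"
proof -
  have f: "\<And>y. f \<in> Aprime_dom J iota (Gs y)" "f \<in> D01_in_Y1 iota D" using assms by (auto simp: Dhat_def)
  show "f \<in> Y1 iota" "D1 D 0 y y' f \<in> Y1 iota" using f(2) by (auto simp: D01_in_Y1_def)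
  show "u \<in> J \<Longrightarrow> gen J (Gs y) u f \<in> Y1 iota" using f(1)[of y] by (auto simp: Aprime_dom_def)
  have "f \<in> (\<Inter>y. Aprime_dom J iota (Gs y))" using f(1) by auto
  then show "\<exists>C. \<forall>u\<in>J. \<forall>y. norm (toZ iota (gen J (Gs y) u f)) \<le> C"
    using a0 unfolding A0_def by blast
qed

lemma D_derivative:
  assumes "f \<in> Y1 iota"
  shows "((\<lambda>h. (1 / h) *\<^sub>R (D h y y' f - f)) \<longlongrightarrow> D1 D 0 y y' f) (at_right 0)"
proof -
  obtain g where g: "D1_at D 0 y y' f g" using Y1_D1dom[OF assms] by (force simp: D1dom_def)
  then have "D1 D 0 y y' f = g" by (intro D1_eqI) auto
  moreover have "at (0::real) within {h. 0 + h \<in> {0..1}} = at_right 0"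
    using at_within_Icc_at_right[of 0 "1::real"] by (simp add: atLeastAtMost_def atLeast_def atMost_def Int_def)
  ultimately show ?thesis using g by (simp add: D1_at_def D0)
qed

section \<open>Uniform control of the jump operators and of the averaged generator\<close>

lemma D_first_order:
  assumes f: "f \<in> Y1 iota" and \<eta>: "\<eta> > 0"
  shows "eventually (\<lambda>e. \<forall>y y'. norm (D e y y' f - f - e *\<^sub>R D1 D 0 y y' f) \<le> \<eta> * e) (at_right 0)"
proof -
  have "eventually (\<lambda>e. dist ((1 / e) *\<^sub>R (D e y y' f - f)) (D1 D 0 y y' f) < \<eta>) (at_right 0)" for y y'
    using tendstoD[OF D_derivative[OF f] \<eta>] .
  then have "eventually (\<lambda>e. \<forall>y\<in>UNIV. \<forall>y'\<in>UNIV. dist ((1 / e) *\<^sub>R (D e y y' f - f)) (D1 D 0 y y' f) < \<eta>) (at_right 0)"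
    by (intro eventually_ball_finite ballI) auto
  then show ?thesis using eventually_at_right_less[of 0]
  proof eventually_elim
    case (elim e)
    show ?case
    proof (intro allI)
      fix y y'
      have "D e y y' f - f - e *\<^sub>R D1 D 0 y y' f = e *\<^sub>R ((1 / e) *\<^sub>R (D e y y' f - f) - D1 D 0 y y' f)"
        using elim by (simp add: scaleR_diff_right)
      moreover have "norm ((1 / e) *\<^sub>R (D e y y' f - f) - D1 D 0 y y' f) < \<eta>" using elim by (simp add: dist_norm)
      ultimately show "norm (D e y y' f - f - e *\<^sub>R D1 D 0 y y' f) \<le> \<eta> * e"
        using elim by (simp add: mult.commute)
    qed
  qed
qed

text \<open>Differentiability at 0 bounds the difference quotients of each single vector, near 0
  through the limit and elsewhere through contractivity. The uniform boundedness principle turns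
  this into a bound linear in the \<open>Y1\<close> norm, as required for remainders that are only
  known to be small in that norm.\<close>

lemma D_lipschitz_pair: "\<exists>C\<ge>0. \<forall>e\<in>{0<..1}. \<forall>z. norm (D e y y' (iota z) - iota z) \<le> C * norm z * e"
proof -
  define L where "L e = (1 / e) *\<^sub>R ((D e y y' o\<^sub>L iota) - iota)" for e
  have L: "L e z = (1 / e) *\<^sub>R (D e y y' (iota z) - iota z)" for e z
    by (simp add: L_def blinfun.scaleR_left blinfun.diff_left)
  have "\<exists>C\<ge>0. \<forall>e\<in>{0<..1}. \<forall>z. norm (L e z) \<le> C * norm z"
  proof (rule banach_steinhaus)
    show "bounded_linear (blinfun_apply (L e))" for e by (rule blinfun.bounded_linear_right)
    fix z
    define d where "d = D1 D 0 y y' (iota z)"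
    have "eventually (\<lambda>e. dist (L e z) d < 1) (at_right 0)"
      using tendstoD[OF D_derivative[OF iota_in_Y1[of z]], of 1 y y'] by (simp add: L d_def)
    then obtain b where b: "b > 0" "\<And>e. 0 < e \<Longrightarrow> e < b \<Longrightarrow> dist (L e z) d < 1"
      unfolding eventually_at_right_field by auto
    show "\<exists>C. \<forall>e\<in>{0<..1}. norm (L e z) \<le> C"
    proof (intro exI[of _ "max (norm d + 1) (2 * norm (iota z) / b)"] ballI)
      fix e :: real assume e: "e \<in> {0<..1}"
      show "norm (L e z) \<le> max (norm d + 1) (2 * norm (iota z) / b)"
      proof (cases "e < b")
        case True
        then have "norm (L e z - d) < 1" using b e by (simp add: dist_norm)
        then show ?thesis using norm_triangle_ineq[of "L e z - d" d] by simp
      next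
        case False
        have "norm (D e y y' (iota z)) \<le> norm (iota z)" by (rule norm_blinfun_le1) (use D_norm e in auto)
        then have "norm (D e y y' (iota z) - iota z) \<le> 2 * norm (iota z)"
          using norm_triangle_ineq4[of "D e y y' (iota z)" "iota z"] by simp
        then have "norm (L e z) \<le> 2 * norm (iota z) / e" using e by (simp add: L divide_right_mono)
        also have "\<dots> \<le> 2 * norm (iota z) / b" using False b by (intro divide_left_mono) auto
        finally show ?thesis by simp
      qed
    qed
  qed
  then obtain C where C: "C \<ge> 0" "\<And>e z. e \<in> {0<..1} \<Longrightarrow> norm (L e z) \<le> C * norm z" by blast
  have "norm (D e y y' (iota z) - iota z) \<le> C * norm z * e" if "e \<in> {0<..1}" for e z
    using C(2)[OF that, of z] that by (simp add: L pos_divide_le_eq)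
  then show ?thesis using C(1) by blast
qed

lemma common_bound:
  "\<exists>C\<ge>0. (\<forall>y. \<forall>u\<in>J. \<forall>z. norm (gen J (Gs y) u (iota z)) \<le> C * norm z) \<and>
     (\<forall>e\<in>{0<..1}. \<forall>y y' z. norm (D e y y' (iota z) - iota z) \<le> C * norm z * e)"
proof -
  obtain CA where CA: "\<And>y u z. u \<in> J \<Longrightarrow> norm (gen J (Gs y) u (iota z)) \<le> CA y * norm z"
    using gen_bounded by metis
  obtain CD where CD: "\<And>y y'. CD y y' \<ge> 0" "\<And>y y' e z. e \<in> {0<..1} \<Longrightarrow> norm (D e y y' (iota z) - iota z) \<le> CD y y' * norm z * e"
    using D_lipschitz_pair by metis
  define C where "C = (\<Sum>y\<in>UNIV. \<bar>CA y\<bar>) + (\<Sum>y\<in>UNIV. \<Sum>y'\<in>UNIV. CD y y')"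
  have 1: "(\<Sum>y\<in>UNIV. \<Sum>y'\<in>UNIV. CD y y') \<ge> 0" "(\<Sum>y\<in>UNIV. \<bar>CA y\<bar>) \<ge> 0" using CD by (auto intro!: sum_nonneg)
  have 2: "CA y \<le> C" for y
  proof -
    have "\<bar>CA y\<bar> \<le> (\<Sum>y\<in>UNIV. \<bar>CA y\<bar>)" by (rule member_le_sum) auto
    then show ?thesis using 1 by (simp add: C_def)
  qed
  have 3: "CD y y' \<le> C" for y y'
  proof -
    have "CD y y' \<le> (\<Sum>y'\<in>UNIV. CD y y')" by (rule member_le_sum) (use CD in auto)
    also have "\<dots> \<le> (\<Sum>y\<in>UNIV. \<Sum>y'\<in>UNIV. CD y y')"
      by (rule member_le_sum[of y _ "\<lambda>y. \<Sum>y'\<in>UNIV. CD y y'"]) (use CD in \<open>auto intro!: sum_nonneg\<close>)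
    finally show ?thesis using 1 unfolding C_def by linarith
  qed
  show ?thesis
  proof (intro exI[of _ C] conjI allI ballI)
    show "C \<ge> 0" using 1 by (simp add: C_def)
    show "norm (gen J (Gs y) u (iota z)) \<le> C * norm z" if "u \<in> J" for y u z
      using CA[OF that, of y z] mult_right_mono[OF 2[of y], of "norm z"] by simp
    show "norm (D e y y' (iota z) - iota z) \<le> C * norm z * e" if "e \<in> {0<..1}" for e y y' z
    proof -
      have "CD y y' * norm z * e \<le> C * norm z * e" using that by (intro mult_right_mono 3) auto
      then show ?thesis using CD(2)[OF that, of y y' z] by linarith
    qed
  qed
qed

text \<open>One constant for the generators and jump operators of all states, fixed once so that
  every sample path instantiates the same locale with the same bound.\<close>

definition CL :: real where
  "CL = (SOME C. C \<ge> 0 \<and> (\<forall>y. \<forall>u\<in>J. \<forall>z. norm (gen J (Gs y) u (iota z)) \<le> C * norm z) \<and>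
     (\<forall>e\<in>{0<..1}. \<forall>y y' z. norm (D e y y' (iota z) - iota z) \<le> C * norm z * e))"

lemma CL_facts: "CL \<ge> 0" "u \<in> J \<Longrightarrow> norm (gen J (Gs y) u (iota z)) \<le> CL * norm z"
  "0 < e \<Longrightarrow> e \<le> 1 \<Longrightarrow> norm (D e y y' (iota z) - iota z) \<le> CL * norm z * e"
  using someI_ex[OF common_bound, folded CL_def] by auto

abbreviation V :: "real \<Rightarrow> real \<Rightarrow> real \<Rightarrow> 'w \<Rightarrow> 'y \<Rightarrow>\<^sub>L 'y" where
  "V e s t \<omega> \<equiv> Veps Gs D x T e s t \<omega>"

lemma renewal_path: "\<omega> \<in> space M \<Longrightarrow> renewal_path T \<omega>"
  using mrp by unfold_locales (auto simp: markov_renewal_process_def)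

lemma evolution:
  assumes "\<omega> \<in> space M" "s \<in> J" "0 < e" "e \<le> 1"
  shows "smooth_path_evolution T \<omega> J Gs D e s iota CL"
proof -
  interpret renewal_path x T \<omega> by (rule renewal_path[OF assms(1)])
  show ?thesis
    by unfold_locales (use J semigroups assms Gs_norm D_norm Gs_regular CL_facts in auto)
qed

lemma D1_linear: "bounded_linear (\<lambda>z. D1 D 0 y y' (iota z))"
proof (rule bounded_linear_intro)
  fix z w :: 'z and c :: real
  have lim: "((\<lambda>h. (1 / h) *\<^sub>R (D h y y' (iota z) - iota z)) \<longlongrightarrow> D1 D 0 y y' (iota z)) (at_right 0)" for z
    by (rule D_derivative[OF iota_in_Y1])
  have "((\<lambda>h. (1 / h) *\<^sub>R (D h y y' (iota z) - iota z) + (1 / h) *\<^sub>R (D h y y' (iota w) - iota w))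
     \<longlongrightarrow> D1 D 0 y y' (iota z) + D1 D 0 y y' (iota w)) (at_right 0)"
    by (intro tendsto_add lim)
  moreover have "(1 / h) *\<^sub>R (D h y y' (iota z) - iota z) + (1 / h) *\<^sub>R (D h y y' (iota w) - iota w)
      = (1 / h) *\<^sub>R (D h y y' (iota (z + w)) - iota (z + w))" for h
    by (simp add: blinfun.add_right scaleR_diff_right scaleR_add_right)
  ultimately have "((\<lambda>h. (1 / h) *\<^sub>R (D h y y' (iota (z + w)) - iota (z + w)))
     \<longlongrightarrow> D1 D 0 y y' (iota z) + D1 D 0 y y' (iota w)) (at_right 0)"
    by simp
  then show "D1 D 0 y y' (iota (z + w)) = D1 D 0 y y' (iota z) + D1 D 0 y y' (iota w)"
    using tendsto_unique[OF trivial_limit_at_right_real lim] by blast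
  have "((\<lambda>h. c *\<^sub>R ((1 / h) *\<^sub>R (D h y y' (iota z) - iota z))) \<longlongrightarrow> c *\<^sub>R D1 D 0 y y' (iota z)) (at_right 0)"
    by (intro tendsto_scaleR tendsto_const lim)
  then have "((\<lambda>h. (1 / h) *\<^sub>R (D h y y' (iota (c *\<^sub>R z)) - iota (c *\<^sub>R z))) \<longlongrightarrow> c *\<^sub>R D1 D 0 y y' (iota z)) (at_right 0)"
    by (simp add: blinfun.scaleR_right scaleR_diff_right mult.commute)
  then show "D1 D 0 y y' (iota (c *\<^sub>R z)) = c *\<^sub>R D1 D 0 y y' (iota z)"
    using tendsto_unique[OF trivial_limit_at_right_real lim] by blast
  have ev: "eventually (\<lambda>h. norm ((1 / h) *\<^sub>R (D h y y' (iota z) - iota z)) \<le> CL * norm z) (at_right 0)"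
  proof -
    have "eventually (\<lambda>h::real. 0 < h \<and> h < 1) (at_right 0)"
      by (auto simp: eventually_at_right_field intro!: exI[of _ 1])
    then show ?thesis
    proof eventually_elim
      case (elim h)
      then show ?case using CL_facts(3)[of h y y' z] by (simp add: pos_divide_le_eq)
    qed
  qed
  show "norm (D1 D 0 y y' (iota z)) \<le> norm z * CL"
    using tendsto_upperbound[OF tendsto_norm[OF lim] ev trivial_limit_at_right_real] by (simp add: mult.commute)
qed

abbreviation Ah :: "real \<Rightarrow> 'y \<Rightarrow> 'y" where "Ah \<equiv> Ahat J Gs D Q rho"

lemma Ahat_linear: "u \<in> J \<Longrightarrow> bounded_linear (\<lambda>z. Ah u (iota z))"
  unfolding Ahat_def a_avg_def
  by (intro bounded_linear_sum bounded_linear_compose[OF bounded_linear_scaleR_right]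
      bounded_linear_add gen_linear D1_linear)

text \<open>Uniformity in \<open>u\<close> allows the argument of the averaged generator to vary
  with time as well.\<close>

lemma Ahat_bounded: "\<exists>C\<ge>0. \<forall>u\<in>J. \<forall>z. norm (Ah u (iota z)) \<le> C * norm z"
proof -
  obtain K where K: "\<And>y y' z. norm (D1 D 0 y y' (iota z)) \<le> K y y' * norm z"
    using bounded_linear.bounded[OF D1_linear] by (metis mult.commute)
  define C where "C = (\<Sum>y\<in>UNIV. \<bar>rho y\<bar> * (\<bar>1 / Mrho Q rho\<bar> * (\<bar>m1 Q y\<bar> * CL + (\<Sum>y'\<in>UNIV. \<bar>emb_P Q y y'\<bar> * K y y'))))"
  have "norm (Ah u (iota z)) \<le> C * norm z" if "u \<in> J" for u z
  proof -
    have 1: "norm (m1 Q y *\<^sub>R gen J (Gs y) u (iota z)) \<le> \<bar>m1 Q y\<bar> * CL * norm z" for y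
      using mult_left_mono[OF CL_facts(2)[OF that, of y z], of "\<bar>m1 Q y\<bar>"] by (simp add: mult.assoc)
    have 2: "norm (\<Sum>y'\<in>UNIV. emb_P Q y y' *\<^sub>R D1 D 0 y y' (iota z)) \<le> (\<Sum>y'\<in>UNIV. \<bar>emb_P Q y y'\<bar> * K y y') * norm z" for y
      unfolding sum_distrib_right
    proof (rule sum_norm_le)
      fix y'
      show "norm (emb_P Q y y' *\<^sub>R D1 D 0 y y' (iota z)) \<le> \<bar>emb_P Q y y'\<bar> * K y y' * norm z"
        using mult_left_mono[OF K[of y y' z], of "\<bar>emb_P Q y y'\<bar>"] by (simp add: mult.assoc)
    qed
    have 3: "norm (m1 Q y *\<^sub>R gen J (Gs y) u (iota z) + (\<Sum>y'\<in>UNIV. emb_P Q y y' *\<^sub>R D1 D 0 y y' (iota z)))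
      \<le> (\<bar>m1 Q y\<bar> * CL + (\<Sum>y'\<in>UNIV. \<bar>emb_P Q y y'\<bar> * K y y')) * norm z" for y
      using norm_triangle_mono[OF 1 2] by (simp add: distrib_right)
    show ?thesis unfolding C_def sum_distrib_right Ahat_def
    proof (rule sum_norm_le)
      fix y
      have "norm (rho y *\<^sub>R a_avg J Gs D Q rho y u (iota z)) = \<bar>rho y\<bar> * (\<bar>1 / Mrho Q rho\<bar> *
         norm (m1 Q y *\<^sub>R gen J (Gs y) u (iota z) + (\<Sum>y'\<in>UNIV. emb_P Q y y' *\<^sub>R D1 D 0 y y' (iota z))))"
        unfolding a_avg_def norm_scaleR ..
      also have "\<dots> \<le> \<bar>rho y\<bar> * (\<bar>1 / Mrho Q rho\<bar> * ((\<bar>m1 Q y\<bar> * CL + (\<Sum>y'\<in>UNIV. \<bar>emb_P Q y y'\<bar> * K y y')) * norm z))"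
        by (intro mult_left_mono 3) auto
      finally show "norm (rho y *\<^sub>R a_avg J Gs D Q rho y u (iota z)) \<le>
        \<bar>rho y\<bar> * (\<bar>1 / Mrho Q rho\<bar> * (\<bar>m1 Q y\<bar> * CL + (\<Sum>y'\<in>UNIV. \<bar>emb_P Q y y'\<bar> * K y y'))) * norm z"
        by (simp only: mult.assoc)
    qed
  qed
  then have "norm (Ah u (iota z)) \<le> \<bar>C\<bar> * norm z" if "u \<in> J" for u z
    using that mult_right_mono[of C "\<bar>C\<bar>" "norm z"] by (meson abs_ge_self norm_ge_zero order_trans)
  then show ?thesis by (intro exI[of _ "\<bar>C\<bar>"]) auto
qed

lemma Ahat_cont: "f \<in> Y1 iota \<Longrightarrow> continuous_on J (\<lambda>u. Ah u f)"
  unfolding Ahat_def a_avg_def by (intro continuous_intros gen_cont)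

text \<open>The mean duration of a step under \<open>rho\<close>; on good paths it is the limit of
  \<open>T n / n\<close>.\<close>

definition mu :: real where "mu = Mrho Q rho"

lemma mu_pos: "mu > 0" using Mrho_pos by (simp add: mu_def)

section \<open>Limits of scaled occupation times and jump counts\<close>

context
  fixes \<omega> assumes \<omega>: "\<omega> \<in> space M" and good: "good_path \<omega>"
begin

interpretation renewal_path x T \<omega> by (rule renewal_path[OF \<omega>])

lemma T_rate: "(\<lambda>n. T n \<omega> / real n) \<longlonglongrightarrow> mu"
proof -
  have "(\<lambda>n. \<Sum>a\<in>UNIV. (\<Sum>k<n. of_bool (x k \<omega> = a) * tau k \<omega>) / real n) \<longlonglongrightarrow> (\<Sum>a\<in>UNIV. rho a * m1 Q a)"
    using good by (intro tendsto_sum) (auto simp: good_path_def)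
  moreover have "(\<Sum>a\<in>UNIV. (\<Sum>k<n. of_bool (x k \<omega> = a) * tau k \<omega>) / real n) = T n \<omega> / real n" for n
  proof -
    have "(\<Sum>a\<in>UNIV. (\<Sum>k<n. of_bool (x k \<omega> = a) * tau k \<omega>) / real n) = (\<Sum>k<n. \<Sum>a\<in>UNIV. of_bool (x k \<omega> = a) * tau k \<omega>) / real n"
      unfolding sum_divide_distrib[symmetric] by (subst sum.swap) simp
    also have "\<dots> = (\<Sum>k<n. tau k \<omega>) / real n" by (simp add: sum_distrib_right[symmetric])
    also have "(\<Sum>k<n. tau k \<omega>) = T n \<omega>"
      using sum_lessThan_telescope[of "\<lambda>k. T k \<omega>" n] T_zero by (simp add: tau_def)
    finally show ?thesis .
  qed
  ultimately show ?thesis by (simp add: mu_def Mrho_def)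
qed

lemma N_scaled: "s \<le> u \<Longrightarrow> ((\<lambda>e. e * real (N (s + (u - s) / e))) \<longlongrightarrow> 1 / mu * (u - s)) (at_right 0)"
  by (rule tendsto_scaled_linear_growth[OF N_rate[OF T_rate mu_pos]])

lemma occ_scaled: "s \<le> u \<Longrightarrow> ((\<lambda>e. e * occ a (s + (u - s) / e)) \<longlongrightarrow> rho a * m1 Q a / mu * (u - s)) (at_right 0)"
  using good by (intro tendsto_scaled_linear_growth occ_rate[OF T_rate mu_pos]) (auto simp: good_path_def tau_def)

lemma jumps_scaled: "s \<le> u \<Longrightarrow> ((\<lambda>e. e * jumps a b (s + (u - s) / e)) \<longlongrightarrow> rho a * emb_P Q a b / mu * (u - s)) (at_right 0)"
  unfolding jumps_def
  using good by (intro tendsto_scaled_linear_growth N_time_change[OF T_rate mu_pos]) (auto simp: good_path_def)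

end

end

section \<open>Convergence along almost every path\<close>

lemma eventually_small: "eventually (\<lambda>e::real. 0 < e \<and> e \<le> 1) (at_right 0)"
  by (auto simp: eventually_at_right_field intro!: exI[of _ 1])

text \<open>The telescoping sum needs the exact end points, the passage to uniform convergence needs
  the covering property.\<close>

lemma uniform_partition:
  fixes s t \<delta> :: real
  assumes st: "s < t" and \<delta>: "\<delta> > 0"
  obtains n :: nat and h :: real and u :: "nat \<Rightarrow> real"
  where "0 < h" "h \<le> \<delta>" "real n * h = t - s" "u 0 = s" "u n = t" "\<And>i. s \<le> u i" "\<And>i. u (Suc i) - u i = h"
    "\<And>i. i \<le> n \<Longrightarrow> u i \<le> t" "\<And>v. s \<le> v \<Longrightarrow> v \<le> t \<Longrightarrow> \<exists>i<n. u i \<le> v \<and> v \<le> u (Suc i)"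
proof -
  obtain n :: nat where n: "(t - s) / \<delta> < real n" using reals_Archimedean2 by blast
  have npos: "real n > 0" using n st \<delta> by (smt (verit) divide_pos_pos)
  define h where "h = (t - s) / real n"
  have h: "h > 0" "h \<le> \<delta>" using n st \<delta> npos by (auto simp: h_def field_simps)
  define u where "u i = s + real i * h" for i
  have un: "u n = t" using npos by (simp add: u_def h_def)
  have ut: "u i \<le> t" if "i \<le> n" for i
  proof -
    have "real i * h \<le> real n * h" using that h by (intro mult_right_mono) auto
    then show ?thesis using un unfolding u_def by linarith
  qed
  have ex: "\<exists>i<n. u i \<le> v \<and> v \<le> u (Suc i)" if v: "s \<le> v" "v \<le> t" for v
  proof (cases "v = t")
    case True
    then show ?thesis using npos ut[of "n - 1"] un by (intro exI[of _ "n - 1"]) auto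
  next
    case False
    define k where "k = \<lfloor>(v - s) / h\<rfloor>"
    have k0: "k \<ge> 0" using v h by (simp add: k_def)
    have "of_int k \<le> (v - s) / h" "(v - s) / h < of_int k + 1" by (auto simp: k_def)
    then have k: "of_int k * h \<le> v - s" "v - s < (of_int k + 1) * h" using h by (auto simp: field_simps)
    have ik: "real (nat k) = of_int k" using k0 by simp
    have "real (nat k) * h < real n * h" using k(1) False v npos by (simp add: ik h_def)
    then have "nat k < n" using h by simp
    moreover have "u (nat k) \<le> v" "v \<le> u (Suc (nat k))" using k by (auto simp: u_def ik add.commute)
    ultimately show ?thesis by blast
  qed
  have "real n * h = t - s" "u 0 = s" "s \<le> u i" "u (Suc i) - u i = h" for i
    using npos h by (simp_all add: u_def distrib_right) (simp add: h_def)
  then show ?thesis using that[of h n u] h un ut ex by blast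
qed

context averaged_evolution
begin

lemma Gh_semigroup: "inhom_semigroup J Gh" and Gh_regular: "regular J iota Gh"
  and Gh_gen: "t \<in> J \<Longrightarrow> f \<in> Y1 iota \<Longrightarrow> gen_at J Gh t f (Ah t f)"
  using a3 by (auto simp: A3_def)

text \<open>The clock runs at limiting rate \<open>1 + 1 / mu\<close>; the additional 1 leaves room
  for a bound that holds eventually.\<close>

definition kap :: real where "kap = 2 + 1 / mu"

lemma kap_pos: "kap > 0" using mu_pos by (simp add: kap_def add_pos_pos)

context
  fixes \<omega> assumes \<omega>: "\<omega> \<in> space M" and good: "good_path \<omega>"
begin

interpretation renewal_path x T \<omega> by (rule renewal_path[OF \<omega>])

definition clk :: "real \<Rightarrow> real \<Rightarrow> real \<Rightarrow> real" where
  "clk e s u = u + e * real (N (s + (u - s) / e))"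

lemma clk_bound:
  assumes "s \<le> a" "a < b"
  shows "eventually (\<lambda>e. clk e s b - clk e s a \<le> kap * (b - a)) (at_right 0)"
proof -
  have "((\<lambda>e. (b + e * real (N (s + (b - s) / e))) - (a + e * real (N (s + (a - s) / e))))
     \<longlongrightarrow> (b + 1 / mu * (b - s)) - (a + 1 / mu * (a - s))) (at_right 0)"
    by (intro tendsto_intros N_scaled[OF \<omega> good]) (use assms in auto)
  moreover have "(b + 1 / mu * (b - s)) - (a + 1 / mu * (a - s)) < kap * (b - a)"
    using assms mu_pos by (simp add: kap_def field_simps)
  ultimately have "eventually (\<lambda>e. (b + e * real (N (s + (b - s) / e))) - (a + e * real (N (s + (a - s) / e))) < kap * (b - a)) (at_right 0)"
    by (rule order_tendstoD(2))
  then show ?thesis by eventually_elim (simp add: clk_def)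
qed

lemma V_contr: "s \<in> J \<Longrightarrow> u \<in> J \<Longrightarrow> s \<le> u \<Longrightarrow> 0 < e \<Longrightarrow> e \<le> 1 \<Longrightarrow> norm (V e s u \<omega> y) \<le> norm y"
proof -
  assume a: "s \<in> J" "u \<in> J" "s \<le> u" "0 < e" "e \<le> 1"
  interpret E: smooth_path_evolution x T \<omega> J Gs D e s iota CL by (rule evolution[OF \<omega> a(1,4,5)])
  show ?thesis using E.V_apply_le[OF a(3,2)] by (simp add: E.V_def)
qed

lemma V_lip:
  assumes "s \<in> J" "b \<in> J" "s \<le> a" "a \<le> b" "0 < e" "e \<le> 1"
  shows "norm (V e s b \<omega> (iota z) - V e s a \<omega> (iota z)) \<le> CL * norm z * (clk e s b - clk e s a)"
    and "a \<le> c \<Longrightarrow> c \<le> b \<Longrightarrow> clk e s c \<le> clk e s b"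
proof -
  interpret E: smooth_path_evolution x T \<omega> J Gs D e s iota CL by (rule evolution[OF \<omega> assms(1,5,6)])
  have eq: "clk e s u = E.clock u" for u by (simp add: clk_def E.clock_def E.r_def)
  show "norm (V e s b \<omega> (iota z) - V e s a \<omega> (iota z)) \<le> CL * norm z * (clk e s b - clk e s a)"
    using E.V_lipschitz[OF assms(3,4,2)] by (simp add: eq E.V_def)
  show "clk e s c \<le> clk e s b" if "a \<le> c" "c \<le> b"
    using E.clock_mono[of c b] that assms by (simp add: eq)
qed

lemma drift_limit:
  assumes "s \<le> a" "a \<le> b" "b \<in> J"
  shows "((\<lambda>e. (\<Sum>y\<in>UNIV. (e * occ y (s + (b - s) / e) - e * occ y (s + (a - s) / e)) *\<^sub>R gen J (Gs y) b f)
     + (\<Sum>y\<in>UNIV. \<Sum>y'\<in>UNIV. (e * jumps y y' (s + (b - s) / e) - e * jumps y y' (s + (a - s) / e)) *\<^sub>R D1 D 0 y y' f))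
     \<longlongrightarrow> (b - a) *\<^sub>R Ah b f) (at_right 0)"
proof -
  have "((\<lambda>e. (\<Sum>y\<in>UNIV. (e * occ y (s + (b - s) / e) - e * occ y (s + (a - s) / e)) *\<^sub>R gen J (Gs y) b f)
     + (\<Sum>y\<in>UNIV. \<Sum>y'\<in>UNIV. (e * jumps y y' (s + (b - s) / e) - e * jumps y y' (s + (a - s) / e)) *\<^sub>R D1 D 0 y y' f))
     \<longlongrightarrow> (\<Sum>y\<in>UNIV. (rho y * m1 Q y / mu * (b - s) - rho y * m1 Q y / mu * (a - s)) *\<^sub>R gen J (Gs y) b f)
     + (\<Sum>y\<in>UNIV. \<Sum>y'\<in>UNIV. (rho y * emb_P Q y y' / mu * (b - s) - rho y * emb_P Q y y' / mu * (a - s)) *\<^sub>R D1 D 0 y y' f)) (at_right 0)"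
    using assms by (intro tendsto_add tendsto_sum tendsto_scaleR tendsto_diff tendsto_const occ_scaled[OF \<omega> good] jumps_scaled[OF \<omega> good]) auto
  moreover have "rho y * m1 Q y / mu * (b - s) - rho y * m1 Q y / mu * (a - s) = (b - a) * (rho y * (1 / mu * m1 Q y))" for y
    using mu_pos by (simp add: field_simps)
  moreover have "rho y * emb_P Q y y' / mu * (b - s) - rho y * emb_P Q y y' / mu * (a - s) = (b - a) * (rho y * (1 / mu * emb_P Q y y'))" for y y'
    using mu_pos by (simp add: field_simps)
  moreover have "(b - a) *\<^sub>R Ah b f = (\<Sum>y\<in>UNIV. ((b - a) * (rho y * (1 / mu * m1 Q y))) *\<^sub>R gen J (Gs y) b f)
     + (\<Sum>y\<in>UNIV. \<Sum>y'\<in>UNIV. ((b - a) * (rho y * (1 / mu * emb_P Q y y'))) *\<^sub>R D1 D 0 y y' f)"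
    by (simp add: Ahat_def a_avg_def mu_def[symmetric] scaleR_sum_right scaleR_add_right sum.distrib)
  ultimately show ?thesis by simp
qed

text \<open>The expansion along the path compares the increment with the random drift, and the law
  of large numbers turns the drift into the averaged generator. The mesh is the same for all
  intervals, while the threshold for \<open>e\<close> may depend on \<open>a\<close> and
  \<open>b\<close>; that is enough for a fixed finite partition.\<close>

lemma consistency:
  assumes f: "f \<in> Dhat J iota Gs D" and s: "s \<in> J" and t: "t \<in> J" "s \<le> t" and \<eta>: "\<eta> > 0"
  shows "\<exists>\<delta>>0. \<forall>a b. s \<le> a \<and> a < b \<and> b \<le> t \<and> b - a \<le> \<delta> \<longrightarrow>
     eventually (\<lambda>e. norm (V e s b \<omega> f - V e s a \<omega> f - (b - a) *\<^sub>R V e s a \<omega> (Ah b f)) \<le> \<eta> * (b - a)) (at_right 0)"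
proof -
  have fY: "f \<in> Y1 iota" by (rule Dhat_facts(1)[OF f])
  define z where "z = toZ iota f"
  have fz: "f = iota z" by (simp add: z_def iota_toZ[OF fY])
  define d where "d y y' = toZ iota (D1 D 0 y y' f)" for y y'
  have d: "iota (d y y') = D1 D 0 y y' f" for y y' by (simp add: d_def iota_toZ[OF Dhat_facts(3)[OF f]])
  obtain Cg1 where Cg1: "\<And>u y. u \<in> J \<Longrightarrow> norm (toZ iota (gen J (Gs y) u f)) \<le> Cg1"
    using Dhat_facts(4)[OF f] by blast
  define Cg where "Cg = \<bar>Cg1\<bar> + (\<Sum>y\<in>UNIV. \<Sum>y'\<in>UNIV. norm (d y y'))"
  have Cg2: "norm (d y y') \<le> (\<Sum>y\<in>UNIV. \<Sum>y'\<in>UNIV. norm (d y y'))" for y y'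
  proof -
    have "norm (d y y') \<le> (\<Sum>y'\<in>UNIV. norm (d y y'))" by (rule member_le_sum) auto
    also have "\<dots> \<le> (\<Sum>y\<in>UNIV. \<Sum>y'\<in>UNIV. norm (d y y'))"
      by (rule member_le_sum[of y _ "\<lambda>y. \<Sum>y'\<in>UNIV. norm (d y y')"]) (auto intro!: sum_nonneg)
    finally show ?thesis .
  qed
  have dCg: "norm (d y y') \<le> Cg" for y y' using Cg2[of y y'] unfolding Cg_def by linarith
  have sum0: "(\<Sum>y\<in>UNIV. \<Sum>y'\<in>UNIV. norm (d y y')) \<ge> 0" by (intro sum_nonneg) auto
  have gCg: "norm (toZ iota (gen J (Gs y) u f)) \<le> Cg" if "u \<in> J" for y u
    using Cg1[OF that, of y] sum0 unfolding Cg_def by linarith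
  have Cg0: "Cg \<ge> 0" using sum0 by (simp add: Cg_def)
  \<comment> \<open>Half of \<open>\<eta>\<close> pays for the errors linear in \<open>h\<close>: a
    factor \<open>kap\<close> from the expansion and 1 from the drift limit.\<close>
  define \<eta>0 where "\<eta>0 = \<eta> / (2 * (kap + 1))"
  have \<eta>0: "\<eta>0 > 0" using \<eta> kap_pos by (simp add: \<eta>0_def)
  \<comment> \<open>Coefficient of the quadratic error; the second bound in \<open>\<delta>\<close>
    makes \<open>W * h\<close> at most \<open>\<eta> / 2\<close>.\<close>
  define W where "W = 2 * CL * Cg * kap * kap"
  have W: "W \<ge> 0" using CL_facts(1) Cg0 kap_pos by (simp add: W_def)
  have sub: "{s..t} \<subseteq> J" using time_domain_mem(1)[OF J s t(1)] by auto
  have "\<exists>\<delta>>0. \<forall>u\<in>{s..t}. \<forall>v\<in>{s..t}. dist v u < \<delta> \<longrightarrow> dist (gen J (Gs y) v f) (gen J (Gs y) u f) < \<eta>0" for y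
  proof -
    have "uniformly_continuous_on {s..t} (\<lambda>u. gen J (Gs y) u f)"
      by (rule compact_uniformly_continuous[OF continuous_on_subset[OF gen_cont[OF fY] sub] compact_Icc])
    then show ?thesis using \<eta>0 unfolding uniformly_continuous_on_def by blast
  qed
  then obtain dl where dl: "\<And>y. dl y > 0" "\<And>y u v. u \<in> {s..t} \<Longrightarrow> v \<in> {s..t} \<Longrightarrow> dist v u < dl y \<Longrightarrow> dist (gen J (Gs y) v f) (gen J (Gs y) u f) < \<eta>0"
    by metis
  define \<delta>1 where "\<delta>1 = Min (range dl)"
  have \<delta>1: "\<delta>1 > 0" "\<And>y. \<delta>1 \<le> dl y" using dl(1) by (auto simp: \<delta>1_def)
  define \<delta> where "\<delta> = min (\<delta>1 / 2) (\<eta> / (2 * (W + 1)))"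
  have \<delta>: "\<delta> > 0" using \<delta>1 \<eta> W by (simp add: \<delta>_def)
  show ?thesis
  proof (intro exI[of _ \<delta>] conjI \<delta> allI impI)
    fix a b assume ab: "s \<le> a \<and> a < b \<and> b \<le> t \<and> b - a \<le> \<delta>"
    define h where "h = b - a"
    have h: "h > 0" "h \<le> \<delta>" using ab by (auto simp: h_def)
    have J': "b \<in> J" "a \<in> J" using sub ab by auto
    \<comment> \<open>The generator is frozen at the right end, to match the vector at
      \<open>b\<close> in the later telescoping.\<close>
    define g where "g y = toZ iota (gen J (Gs y) b f)" for y
    have g: "iota (g y) = gen J (Gs y) b f" for y by (simp add: g_def iota_toZ[OF Dhat_facts(2)[OF f J'(1)]])
    define S where "S e = (\<Sum>y\<in>UNIV. (e * occ y (s + (b - s) / e) - e * occ y (s + (a - s) / e)) *\<^sub>R gen J (Gs y) b f)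
     + (\<Sum>y\<in>UNIV. \<Sum>y'\<in>UNIV. (e * jumps y y' (s + (b - s) / e) - e * jumps y y' (s + (a - s) / e)) *\<^sub>R D1 D 0 y y' f)" for e
    have "(S \<longlongrightarrow> h *\<^sub>R Ah b f) (at_right 0)" unfolding S_def h_def by (rule drift_limit) (use ab J' in auto)
    then have evS: "eventually (\<lambda>e. dist (S e) (h *\<^sub>R Ah b f) < \<eta>0 * h) (at_right 0)"
      by (rule tendstoD) (use \<eta>0 h in simp)
    have evC: "eventually (\<lambda>e. clk e s b - clk e s a \<le> kap * h) (at_right 0)"
      unfolding h_def by (rule clk_bound) (use ab in auto)
    show "eventually (\<lambda>e. norm (V e s b \<omega> f - V e s a \<omega> f - (b - a) *\<^sub>R V e s a \<omega> (Ah b f)) \<le> \<eta> * (b - a)) (at_right 0)"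
      using evS evC D_first_order[OF fY \<eta>0] eventually_small
    proof eventually_elim
      case (elim e)
      interpret E: smooth_path_evolution x T \<omega> J Gs D e s iota CL by (rule evolution[OF \<omega> s]) (use elim in auto)
      have clk_eq: "clk e s u = E.clock u" for u by (simp add: clk_def E.clock_def E.r_def)
      have VE: "V e s u \<omega> = E.V u" for u by (simp add: E.V_def)
      define S' where "S' = E.drift (\<lambda>y. iota (g y)) (\<lambda>y y'. iota (d y y'))"
      have SS: "S' b - S' a = S e"
        by (simp add: S'_def E.drift_def S_def E.r_def g d sum_subtractf scaleR_left_diff_distrib)
      define B where "B = E.clock b - E.clock a"
      have B: "B \<le> kap * h" "0 \<le> B"
        using elim(2) E.clock_mono[of a b] ab unfolding B_def clk_eq by auto
      have 1: "norm (E.V b (iota z) - E.V a (iota z) - E.V a (S' b - S' a)) \<le> (\<eta>0 + 2 * CL * Cg * B) * B"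
        unfolding B_def S'_def
      proof (rule E.V_first_order)
        show "norm (gen J (Gs y) w (iota z) - iota (g y)) \<le> \<eta>0" if "a \<le> w" "w \<le> b" for y w
        proof -
          have "dist w b < dl y" using that ab \<delta>1(1) \<delta>1(2)[of y] by (auto simp: dist_real_def \<delta>_def)
          then have "dist (gen J (Gs y) w f) (gen J (Gs y) b f) < \<eta>0" using that ab by (intro dl(2)) auto
          then show ?thesis by (simp add: g fz[symmetric] dist_norm)
        qed
        show "norm (g y) \<le> Cg" for y unfolding g_def by (rule gCg[OF J'(1)])
        show "norm (D e y y' (iota z) - iota z - e *\<^sub>R iota (d y y')) \<le> \<eta>0 * e" for y y'
          using elim(3) by (simp add: d fz[symmetric])
        show "norm (d y y') \<le> Cg" for y y' by (rule dCg)
      qed (use ab J' in auto)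
      have 2: "norm (E.V a (S e - h *\<^sub>R Ah b f)) \<le> \<eta>0 * h"
      proof -
        have "norm (E.V a (S e - h *\<^sub>R Ah b f)) \<le> norm (S e - h *\<^sub>R Ah b f)"
          by (rule E.V_apply_le) (use ab J' in auto)
        then show ?thesis using elim(1) by (simp add: dist_norm)
      qed
      have eq: "E.V b f - E.V a f - h *\<^sub>R E.V a (Ah b f) = (E.V b f - E.V a f - E.V a (S e)) + E.V a (S e - h *\<^sub>R Ah b f)"
        by (simp add: blinfun.diff_right blinfun.scaleR_right)
      have "norm (E.V b f - E.V a f - h *\<^sub>R E.V a (Ah b f)) \<le> (\<eta>0 + 2 * CL * Cg * B) * B + \<eta>0 * h"
        unfolding eq by (rule norm_triangle_mono) (use 1 2 in \<open>simp_all add: SS fz[symmetric]\<close>)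
      also have "\<dots> \<le> (\<eta>0 + 2 * CL * Cg * (kap * h)) * (kap * h) + \<eta>0 * h"
        using B CL_facts(1) Cg0 \<eta>0 kap_pos h by (intro add_mono mult_mono mult_nonneg_nonneg add_nonneg_nonneg) auto
      also have "\<dots> = (\<eta>0 * (kap + 1) + W * h) * h" by (simp add: W_def algebra_simps)
      also have "\<dots> \<le> \<eta> * h"
      proof (rule mult_right_mono)
        have "\<eta>0 * (kap + 1) = \<eta> / 2" using kap_pos by (simp add: \<eta>0_def field_simps)
        moreover have "W * h \<le> \<eta> / 2"
        proof -
          have "W * h \<le> W * (\<eta> / (2 * (W + 1)))" using W h by (intro mult_left_mono) (auto simp: \<delta>_def)
          also have "\<dots> \<le> (W + 1) * (\<eta> / (2 * (W + 1)))" using W \<eta> by (intro mult_right_mono) auto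
          also have "\<dots> = \<eta> / 2" using W by (simp add: field_simps)
          finally show ?thesis .
        qed
        ultimately show "\<eta>0 * (kap + 1) + W * h \<le> \<eta>" by simp
      qed (use h in simp)
      finally show ?case by (simp add: VE h_def)
    qed
  qed
qed

text \<open>On each interval \<open>V\<close> moves the later vector forward and the averaged
  semigroup moves it backward; the two generator terms cancel behind \<open>V e s a\<close>.
  Approximation by a net vector leaves a remainder \<open>w\<close> of small \<open>Y1\<close> norm,
  for which Lipschitz bounds are enough.\<close>

lemma convergence_Y1:
  assumes f: "f \<in> Y1 iota" and s: "s \<in> J" and t: "t \<in> J" "s \<le> t"
  shows "((\<lambda>e. V e s t \<omega> f) \<longlongrightarrow> Gh s t f) (at_right 0)"
proof -
  obtain CH where CH: "CH \<ge> 0" "\<And>u z. u \<in> J \<Longrightarrow> norm (Ah u (iota z)) \<le> CH * norm z"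
    using Ahat_bounded by blast
  have sub: "{s..t} \<subseteq> J" using time_domain_mem(1)[OF J s t(1)] by auto
  define \<phi> where "\<phi> u = Gh u t f" for u
  define z\<phi> where "z\<phi> u = toZ iota (\<phi> u)" for u
  define \<psi> where "\<psi> u = Ah u (\<phi> u)" for u
  have \<phi>Y: "\<phi> u \<in> Y1 iota" if "u \<in> {s..t}" for u
    unfolding \<phi>_def using regular_invariant[OF Gh_regular _ t(1) _ f] that sub by auto
  have \<phi>z: "\<phi> u = iota (z\<phi> u)" if "u \<in> {s..t}" for u
    using iota_toZ[OF \<phi>Y[OF that]] by (simp add: z\<phi>_def)
  have cz: "continuous_on {s..t} z\<phi>" unfolding z\<phi>_def \<phi>_def
    by (rule continuous_on_subset[OF regular_cont_Y1[OF Gh_regular t(1) f]]) (use sub in auto)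
  \<comment> \<open>Operator and argument both move: the first is only strongly continuous, so the
    uniform bound \<open>CH\<close> has to absorb the motion of the second.\<close>
  have c\<psi>: "continuous_on {s..t} \<psi>" unfolding continuous_on_def
  proof
    fix u0 assume u0: "u0 \<in> {s..t}"
    have 1: "((\<lambda>u. Ah u (\<phi> u0)) \<longlongrightarrow> Ah u0 (\<phi> u0)) (at u0 within {s..t})"
      using continuous_on_subset[OF Ahat_cont[OF \<phi>Y[OF u0]] sub] u0 by (simp add: continuous_on_def)
    have 2: "((\<lambda>u. Ah u (iota (z\<phi> u - z\<phi> u0))) \<longlongrightarrow> 0) (at u0 within {s..t})"
    proof (rule Lim_null_comparison)
      show "eventually (\<lambda>u. norm (Ah u (iota (z\<phi> u - z\<phi> u0))) \<le> CH * norm (z\<phi> u - z\<phi> u0)) (at u0 within {s..t})"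
        unfolding eventually_at_filter using CH(2) sub by (intro always_eventually) auto
      have "((\<lambda>u. z\<phi> u) \<longlongrightarrow> z\<phi> u0) (at u0 within {s..t})" using cz u0 by (simp add: continuous_on_def)
      then have "((\<lambda>u. CH * norm (z\<phi> u - z\<phi> u0)) \<longlongrightarrow> CH * norm (z\<phi> u0 - z\<phi> u0)) (at u0 within {s..t})"
        by (intro tendsto_intros)
      then show "((\<lambda>u. CH * norm (z\<phi> u - z\<phi> u0)) \<longlongrightarrow> 0) (at u0 within {s..t})" by simp
    qed
    have "((\<lambda>u. Ah u (\<phi> u0) + Ah u (iota (z\<phi> u - z\<phi> u0))) \<longlongrightarrow> Ah u0 (\<phi> u0) + 0) (at u0 within {s..t})"
      by (rule tendsto_add[OF 1 2])
    moreover have "eventually (\<lambda>u. Ah u (\<phi> u0) + Ah u (iota (z\<phi> u - z\<phi> u0)) = \<psi> u) (at u0 within {s..t})"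
      unfolding eventually_at_filter
    proof (intro always_eventually allI impI)
      fix u assume u: "u \<in> {s..t}"
      have "Ah u (iota (z\<phi> u - z\<phi> u0)) = Ah u (iota (z\<phi> u)) - Ah u (iota (z\<phi> u0))"
        using bounded_linear.linear[OF Ahat_linear, THEN linear_diff, of u "z\<phi> u" "z\<phi> u0"] u sub by auto
      then show "Ah u (\<phi> u0) + Ah u (iota (z\<phi> u - z\<phi> u0)) = \<psi> u"
        using \<phi>z[OF u] \<phi>z[OF u0] by (simp add: \<psi>_def)
    qed
    ultimately show "(\<psi> \<longlongrightarrow> \<psi> u0) (at u0 within {s..t})"
      using Lim_transform_eventually by (fastforce simp: \<psi>_def[of u0])
  qed
  \<comment> \<open>Two units for consistency and the backward expansion; \<open>CL * kap\<close>
    and \<open>CH\<close> for the remainder \<open>w\<close> in the increment of \<open>V\<close>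
    and in the generator.\<close>
  define K where "K = 2 + CL * kap + CH"
  have K: "K > 0" using CL_facts(1) kap_pos CH(1) by (simp add: K_def add_pos_nonneg)
  have main: "eventually (\<lambda>e. norm (V e s t \<omega> f - Gh s t f) \<le> K * \<eta> * (t - s)) (at_right 0)"
    if \<eta>: "\<eta> > 0" and st: "s < t" for \<eta>
  proof -
    have "uniformly_continuous_on {s..t} \<psi>" by (rule compact_uniformly_continuous[OF c\<psi> compact_Icc])
    then obtain \<delta>1 where \<delta>1: "\<delta>1 > 0" "\<And>u v. u \<in> {s..t} \<Longrightarrow> v \<in> {s..t} \<Longrightarrow> dist v u < \<delta>1 \<Longrightarrow> dist (\<psi> v) (\<psi> u) < \<eta>"
      using \<eta> unfolding uniformly_continuous_on_def by metis
    have backw: "norm (\<phi> a - \<phi> b - (b - a) *\<^sub>R \<psi> b) \<le> \<eta> * (b - a)" if ab: "s \<le> a" "a \<le> b" "b \<le> t" "b - a < \<delta>1" for a b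
      unfolding \<phi>_def
    proof (rule backward_first_order[OF J Gh_semigroup Gh_regular Gh_gen])
      show "norm (Ah w (Gh w t f) - \<psi> b) \<le> \<eta>" if "a \<le> w" "w \<le> b" for w
        using \<delta>1(2)[of b w] that ab by (auto simp: \<psi>_def \<phi>_def dist_norm dist_real_def)
    qed (use ab sub t f in auto)
    \<comment> \<open>The admissible mesh depends on the vector, so the compact orbit of f in \<open>Y\<^sub>1\<close> is first
      replaced by a finite net in Dhat and the mesh is chosen afterwards.\<close>
    obtain C where C: "C \<subseteq> Dhat J iota Gs D" "closure (toZ iota ` C) = UNIV" using dense by blast
    have cp: "compact (z\<phi> ` {s..t})" by (rule compact_continuous_image[OF cz compact_Icc])
    have cv: "z\<phi> ` {s..t} \<subseteq> (\<Union>c\<in>C. ball (toZ iota c) \<eta>)"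
    proof
      fix w
      have "w \<in> closure (toZ iota ` C)" using C by simp
      then obtain v where "v \<in> toZ iota ` C" "dist v w < \<eta>" using \<eta> unfolding closure_approachable by blast
      then show "w \<in> (\<Union>c\<in>C. ball (toZ iota c) \<eta>)" by auto
    qed
    obtain C0 where C0: "C0 \<subseteq> C" "finite C0" "z\<phi> ` {s..t} \<subseteq> (\<Union>c\<in>C0. ball (toZ iota c) \<eta>)"
      by (rule compactE_image[OF cp _ cv]) auto
    define P where "P g \<delta> \<longleftrightarrow> \<delta> > 0 \<and> (\<forall>a b. s \<le> a \<and> a < b \<and> b \<le> t \<and> b - a \<le> \<delta> \<longrightarrow>
     eventually (\<lambda>e. norm (V e s b \<omega> g - V e s a \<omega> g - (b - a) *\<^sub>R V e s a \<omega> (Ah b g)) \<le> \<eta> * (b - a)) (at_right 0))" for g \<delta>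
    have "\<exists>\<delta>. P g \<delta>" if "g \<in> C0" for g
      unfolding P_def by (rule consistency[OF _ s t \<eta>]) (use that C0 C in auto)
    then obtain dl where P: "\<And>g. g \<in> C0 \<Longrightarrow> P g (dl g)" by metis
    have dl: "\<And>g. g \<in> C0 \<Longrightarrow> dl g > 0"
      "\<And>g a b. g \<in> C0 \<Longrightarrow> s \<le> a \<Longrightarrow> a < b \<Longrightarrow> b \<le> t \<Longrightarrow> b - a \<le> dl g \<Longrightarrow>
     eventually (\<lambda>e. norm (V e s b \<omega> g - V e s a \<omega> g - (b - a) *\<^sub>R V e s a \<omega> (Ah b g)) \<le> \<eta> * (b - a)) (at_right 0)"
      using P unfolding P_def by auto
    \<comment> \<open>Half of \<open>\<delta>1\<close>, because the modulus of continuity is stated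
      with a strict inequality.\<close>
    define \<delta> where "\<delta> = Min (insert (\<delta>1 / 2) (dl ` C0))"
    have \<delta>: "\<delta> > 0" "\<delta> < \<delta>1" "\<And>g. g \<in> C0 \<Longrightarrow> \<delta> \<le> dl g"
    proof -
      show "\<delta> > 0" unfolding \<delta>_def using dl(1) \<delta>1(1) C0(2) by (subst Min_gr_iff) auto
      have "\<delta> \<le> \<delta>1 / 2" unfolding \<delta>_def using C0(2) by (intro Min_le) auto
      then show "\<delta> < \<delta>1" using \<delta>1(1) by simp
      show "\<And>g. g \<in> C0 \<Longrightarrow> \<delta> \<le> dl g" unfolding \<delta>_def using C0(2) by (intro Min_le) auto
    qed
    have step: "eventually (\<lambda>e. norm (V e s b \<omega> (\<phi> b) - V e s a \<omega> (\<phi> a)) \<le> K * \<eta> * (b - a)) (at_right 0)"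
      if ab: "s \<le> a" "a < b" "b \<le> t" "b - a \<le> \<delta>" for a b
    proof -
      have bst: "b \<in> {s..t}" using ab by auto
      have J': "a \<in> J" "b \<in> J" using ab sub by auto
      have "z\<phi> b \<in> (\<Union>c\<in>C0. ball (toZ iota c) \<eta>)" using C0(3) imageI[OF bst, of z\<phi>] by blast
      then obtain g where g: "g \<in> C0" "dist (toZ iota g) (z\<phi> b) < \<eta>" by auto
      have gY: "g \<in> Y1 iota" using g C0 C Dhat_facts(1) by auto
      define w where "w = z\<phi> b - toZ iota g"
      have w: "norm w \<le> \<eta>" using g(2) by (simp add: w_def dist_norm norm_minus_commute)
      have \<phi>b: "\<phi> b = g + iota w" using \<phi>z[OF bst] iota_toZ[OF gY] by (simp add: w_def blinfun.diff_right)
      have "Ah b (iota (toZ iota g + w)) = Ah b (iota (toZ iota g)) + Ah b (iota w)"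
        using bounded_linear.linear[OF Ahat_linear[OF J'(2)]] by (rule linear_add)
      then have \<psi>b: "\<psi> b = Ah b g + Ah b (iota w)"
        using iota_toZ[OF gY] by (simp add: \<psi>_def \<phi>b blinfun.add_right)
      define h where "h = b - a"
      have h: "h > 0" using ab by (simp add: h_def)
      have "eventually (\<lambda>e. norm (V e s b \<omega> g - V e s a \<omega> g - (b - a) *\<^sub>R V e s a \<omega> (Ah b g)) \<le> \<eta> * (b - a)) (at_right 0)"
        using dl(2)[OF g(1)] ab \<delta>(3)[OF g(1)] by auto
      then show ?thesis using clk_bound[OF ab(1,2)] eventually_small
      proof eventually_elim
        case (elim e)
        define Va where "Va = V e s a \<omega>"
        define Vb where "Vb = V e s b \<omega>"
        have e: "0 < e" "e \<le> 1" using elim by auto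
        have Va_le: "norm (Va y) \<le> norm y" for y unfolding Va_def by (rule V_contr[OF s J'(1) ab(1) e])
        have eq: "Vb (\<phi> b) - Va (\<phi> a) = (Vb g - Va g - h *\<^sub>R Va (Ah b g)) + (Vb (iota w) - Va (iota w))
            - h *\<^sub>R Va (Ah b (iota w)) - Va (\<phi> a - \<phi> b - h *\<^sub>R \<psi> b)"
        proof -
          have "Va (\<phi> a - \<phi> b - h *\<^sub>R \<psi> b) = Va (\<phi> a) - (Va g + Va (iota w)) - h *\<^sub>R (Va (Ah b g) + Va (Ah b (iota w)))"
            by (simp add: \<phi>b \<psi>b blinfun.diff_right blinfun.add_right blinfun.scaleR_right)
          then show ?thesis by (simp add: \<phi>b blinfun.add_right scaleR_add_right)
        qed
        have 1: "norm (Vb g - Va g - h *\<^sub>R Va (Ah b g)) \<le> \<eta> * h"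
          using elim(1) by (simp add: Va_def Vb_def h_def)
        have 2: "norm (Vb (iota w) - Va (iota w)) \<le> CL * \<eta> * (kap * h)"
        proof -
          have "norm (Vb (iota w) - Va (iota w)) \<le> CL * norm w * (clk e s b - clk e s a)"
            unfolding Va_def Vb_def by (rule V_lip(1)[OF s J'(2) ab(1) _ e]) (use ab in auto)
          also have "\<dots> \<le> CL * \<eta> * (kap * h)"
            using w elim(2) CL_facts(1) \<eta> V_lip(2)[OF s J'(2) ab(1) less_imp_le[OF ab(2)] e order_refl less_imp_le[OF ab(2)]]
            by (intro mult_mono) (auto simp: h_def)
          finally show ?thesis .
        qed
        have 3: "norm (h *\<^sub>R Va (Ah b (iota w))) \<le> h * (CH * \<eta>)"
        proof -
          have "norm (Va (Ah b (iota w))) \<le> norm (Ah b (iota w))" by (rule Va_le)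
          also have "\<dots> \<le> CH * norm w" by (rule CH(2)[OF J'(2)])
          also have "\<dots> \<le> CH * \<eta>" using w CH(1) by (rule mult_left_mono)
          finally show ?thesis using h by simp
        qed
        have 4: "norm (Va (\<phi> a - \<phi> b - h *\<^sub>R \<psi> b)) \<le> \<eta> * h"
        proof -
          have "norm (Va (\<phi> a - \<phi> b - h *\<^sub>R \<psi> b)) \<le> norm (\<phi> a - \<phi> b - h *\<^sub>R \<psi> b)" by (rule Va_le)
          also have "\<dots> \<le> \<eta> * h" unfolding h_def by (rule backw) (use ab \<delta> in auto)
          finally show ?thesis .
        qed
        have "norm (Vb (\<phi> b) - Va (\<phi> a)) \<le> \<eta> * h + CL * \<eta> * (kap * h) + h * (CH * \<eta>) + \<eta> * h"
          unfolding eq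
          by (rule order_trans[OF norm_triangle_ineq4], rule add_mono[OF _ 4],
              rule order_trans[OF norm_triangle_ineq4], rule add_mono[OF _ 3], rule norm_triangle_mono[OF 1 2])
        also have "\<dots> = K * \<eta> * (b - a)" by (simp add: K_def h_def[symmetric] algebra_simps)
        finally show ?case by (simp add: Va_def Vb_def)
      qed
    qed
    obtain n :: nat and h u where h: "0 < h" "h \<le> \<delta>" "real n * h = t - s" and un: "u 0 = s" "u n = t"
      and ui: "\<And>i. s \<le> u i" "\<And>i. u (Suc i) - u i = h" and ut: "\<And>i. i \<le> n \<Longrightarrow> u i \<le> t"
      using uniform_partition[OF st \<delta>(1)] by metis
    have "eventually (\<lambda>e. \<forall>i\<in>{..<n}. norm (V e s (u (Suc i)) \<omega> (\<phi> (u (Suc i))) - V e s (u i) \<omega> (\<phi> (u i))) \<le> K * \<eta> * h) (at_right 0)"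
    proof (intro eventually_ball_finite ballI)
      fix i assume "i \<in> {..<n}"
      then show "eventually (\<lambda>e. norm (V e s (u (Suc i)) \<omega> (\<phi> (u (Suc i))) - V e s (u i) \<omega> (\<phi> (u i))) \<le> K * \<eta> * h) (at_right 0)"
        using step[OF ui(1)[of i], of "u (Suc i)"] ut[of "Suc i"] ui(2)[of i] h by simp
    qed simp
    then show ?thesis using eventually_small
    proof eventually_elim
      case (elim e)
      interpret E: smooth_path_evolution x T \<omega> J Gs D e s iota CL by (rule evolution[OF \<omega> s]) (use elim in auto)
      have Vs: "V e s s \<omega> = id_blinfun" using E.V_start by (simp add: E.V_def)
      have Ght: "Gh t t = id_blinfun" using Gh_semigroup t by (simp add: inhom_semigroup_def)
      \<comment> \<open>The end terms are \<open>Gh s t f\<close> and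
        \<open>V e s t \<omega> f\<close>, since both evolutions are the identity on the
        diagonal.\<close>
      define F where "F i = V e s (u i) \<omega> (\<phi> (u i))" for i
      have "norm (V e s t \<omega> f - Gh s t f) = norm (\<Sum>i<n. F (Suc i) - F i)"
        unfolding sum_lessThan_telescope by (simp add: F_def un \<phi>_def Vs Ght)
      also have "\<dots> \<le> (\<Sum>i<n. K * \<eta> * h)" by (rule sum_norm_le) (use elim in \<open>auto simp: F_def\<close>)
      also have "\<dots> = K * \<eta> * (t - s)" unfolding h(3)[symmetric] by simp
      finally show ?case .
    qed
  qed
  show ?thesis
  proof (cases "s = t")
    case True
    have "eventually (\<lambda>e. V e s t \<omega> f = Gh s t f) (at_right 0)"
      using eventually_small
    proof eventually_elim
      case (elim e)
      interpret E: smooth_path_evolution x T \<omega> J Gs D e s iota CL by (rule evolution[OF \<omega> s]) (use elim in auto)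
      have "V e s s \<omega> = id_blinfun" using E.V_start by (simp add: E.V_def)
      moreover have "Gh s s = id_blinfun" using Gh_semigroup s by (simp add: inhom_semigroup_def)
      ultimately show ?case using True by simp
    qed
    then show ?thesis by (rule tendsto_eventually)
  next
    case False
    then have st: "s < t" using t by simp
    show ?thesis
    proof (rule tendstoI)
      fix d :: real assume d: "d > 0"
      define \<eta> where "\<eta> = d / (2 * K * (t - s))"
      have \<eta>: "\<eta> > 0" using d K st by (simp add: \<eta>_def)
      have "K * \<eta> * (t - s) = d / 2" using K st by (simp add: \<eta>_def field_simps)
      then have "K * \<eta> * (t - s) < d" using d by simp
      then show "eventually (\<lambda>e. dist (V e s t \<omega> f) (Gh s t f) < d) (at_right 0)"
        using main[OF \<eta> st] by (auto elim!: eventually_mono simp: dist_norm)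
    qed
  qed
qed

text \<open>Convergence at finitely many grid points is enough: inside a cell \<open>V\<close> moves
  by at most a multiple of the clock increment, and by monotonicity of the clock this is dominated
  by the increment over the whole cell, which is eventually bounded.\<close>

lemma uniform_convergence_Y1:
  assumes s: "s \<in> J" and T0: "T0 \<in> J" "s \<le> T0" and d: "d > 0"
  shows "eventually (\<lambda>e. \<forall>t\<in>{s..T0}. norm (V e s t \<omega> (iota z) - Gh s t (iota z)) < d) (at_right 0)"
proof (cases "s = T0")
  case True
  then show ?thesis
    using tendstoD[OF convergence_Y1[OF iota_in_Y1[of z] s s order_refl] d] by (simp add: dist_norm)
next
  case False
  then have sT: "s < T0" using T0 by simp
  define f where "f = iota z"
  have sub: "{s..T0} \<subseteq> J" using time_domain_mem(1)[OF J s T0(1)] by auto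
  have "continuous_on {s..T0} (\<lambda>u. Gh s u f)"
    by (rule continuous_on_subset[OF regular_cont[OF Gh_regular s]]) (use sub in \<open>auto simp: Jfrom_def\<close>)
  then have "uniformly_continuous_on {s..T0} (\<lambda>u. Gh s u f)"
    by (rule compact_uniformly_continuous[OF _ compact_Icc])
  then obtain \<delta>1 where \<delta>1: "\<delta>1 > 0"
    "\<And>u v. u \<in> {s..T0} \<Longrightarrow> v \<in> {s..T0} \<Longrightarrow> dist v u < \<delta>1 \<Longrightarrow> dist (Gh s v f) (Gh s u f) < d / 3"
    using d unfolding uniformly_continuous_on_def by (metis zero_less_divide_iff zero_less_numeral)
  define L where "L = CL * norm z * kap"
  have L: "L \<ge> 0" using CL_facts(1) kap_pos by (simp add: L_def)
  \<comment> \<open>A third of \<open>d\<close> each is reserved for the motion of \<open>V\<close>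
    in a cell, the error at the grid point and the motion of \<open>Gh\<close>; the summand 1 covers
    \<open>L = 0\<close>.\<close>
  define \<delta> where "\<delta> = min (\<delta>1 / 2) (d / (3 * (L + 1)))"
  have \<delta>: "\<delta> > 0" using \<delta>1 d L by (simp add: \<delta>_def)
  obtain n :: nat and h u where h: "0 < h" "h \<le> \<delta>" and ui: "\<And>i. s \<le> u i" "\<And>i. u (Suc i) - u i = h"
    and ut: "\<And>i. i \<le> n \<Longrightarrow> u i \<le> T0"
    and cover: "\<And>t. s \<le> t \<Longrightarrow> t \<le> T0 \<Longrightarrow> \<exists>i<n. u i \<le> t \<and> t \<le> u (Suc i)"
    using uniform_partition[OF sT \<delta>] by metis
  have Lh: "L * h < d / 3"
  proof -
    have "L * h \<le> L * (d / (3 * (L + 1)))" using L h by (intro mult_left_mono) (auto simp: \<delta>_def)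
    also have "\<dots> < (L + 1) * (d / (3 * (L + 1)))" using L d by (intro mult_strict_right_mono) auto
    also have "\<dots> = d / 3" using L by (simp add: field_simps)
    finally show ?thesis .
  qed
  have "eventually (\<lambda>e. \<forall>i\<in>{..n}. dist (V e s (u i) \<omega> f) (Gh s (u i) f) < d / 3) (at_right 0)"
  proof (intro eventually_ball_finite ballI)
    fix i assume "i \<in> {..n}"
    then have "u i \<in> J" using ut[of i] ui(1)[of i] sub by auto
    then have "((\<lambda>e. V e s (u i) \<omega> f) \<longlongrightarrow> Gh s (u i) f) (at_right 0)"
      unfolding f_def by (intro convergence_Y1 iota_in_Y1 s ui)
    then show "eventually (\<lambda>e. dist (V e s (u i) \<omega> f) (Gh s (u i) f) < d / 3) (at_right 0)"
      by (rule tendstoD) (use d in simp)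
  qed simp
  moreover have "eventually (\<lambda>e. \<forall>i\<in>{..<n}. clk e s (u (Suc i)) - clk e s (u i) \<le> kap * h) (at_right 0)"
  proof (intro eventually_ball_finite ballI)
    fix i show "eventually (\<lambda>e. clk e s (u (Suc i)) - clk e s (u i) \<le> kap * h) (at_right 0)"
      using clk_bound[OF ui(1)[of i], of "u (Suc i)"] ui(2)[of i] h by simp
  qed simp
  ultimately show ?thesis using eventually_small
  proof eventually_elim
    case (elim e)
    have e: "0 < e" "e \<le> 1" using elim by auto
    show ?case
    proof
      fix t assume t: "t \<in> {s..T0}"
      have "\<exists>i<n. u i \<le> t \<and> t \<le> u (Suc i)" using cover t by simp
      then obtain i where i: "i < n" "u i \<le> t" "t \<le> u (Suc i)" by blast
      have J': "t \<in> J" "u i \<in> J" "u (Suc i) \<in> J"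
        using sub t ut[of i] ut[of "Suc i"] i ui(1)[of i] ui(1)[of "Suc i"] by auto
      have 1: "norm (V e s t \<omega> f - V e s (u i) \<omega> f) < d / 3"
      proof -
        have "norm (V e s t \<omega> f - V e s (u i) \<omega> f) \<le> CL * norm z * (clk e s t - clk e s (u i))"
          unfolding f_def by (rule V_lip(1)[OF s J'(1) ui(1) i(2) e])
        also have "\<dots> \<le> CL * norm z * (kap * h)"
        proof (rule mult_left_mono)
          have "clk e s t \<le> clk e s (u (Suc i))"
            by (rule V_lip(2)[OF s J'(3) ui(1)[of i] _ e]) (use i in auto)
          then show "clk e s t - clk e s (u i) \<le> kap * h" using elim(2) i(1) by force
        qed (use CL_facts(1) in simp)
        also have "\<dots> = L * h" by (simp add: L_def)
        finally show ?thesis using Lh by simp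
      qed
      have 2: "norm (V e s (u i) \<omega> f - Gh s (u i) f) < d / 3" using elim(1) i by (simp add: dist_norm)
      have "dist (u i) t < \<delta>1" using i ui(2)[of i] h \<delta>1(1) by (auto simp: dist_real_def \<delta>_def)
      then have 3: "norm (Gh s (u i) f - Gh s t f) < d / 3"
        using \<delta>1(2)[of t "u i"] t i ut[of i] ui(1)[of i] by (simp add: dist_norm)
      show "norm (V e s t \<omega> (iota z) - Gh s t (iota z)) < d"
        using norm_triangle_lt[of "V e s t \<omega> f - V e s (u i) \<omega> f" "V e s (u i) \<omega> f - Gh s (u i) f" "2 * d / 3"]
          norm_triangle_lt[of "V e s t \<omega> f - Gh s (u i) f" "Gh s (u i) f - Gh s t f" d] 1 2 3
        by (simp add: f_def)
    qed
  qed
qed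

end

section \<open>Contractivity and extension from \<open>Y1\<close> to \<open>Y\<close>\<close>

lemma Y1_dense: "closure (Y1 iota) = UNIV"
proof -
  obtain C where "C \<subseteq> Dhat J iota Gs D" "closure C = UNIV" using dense by blast
  moreover then have "C \<subseteq> Y1 iota" using Dhat_facts(1) by auto
  ultimately show ?thesis using closure_mono by blast
qed

lemma AE_good: "AE \<omega> in M. good_path \<omega>"
  using AE_good_path by (auto elim!: eventually_mono)

text \<open>A single good path suffices, and one exists because good paths have full measure. The
  norm bound passes to the limit on \<open>Y1\<close> and then to \<open>Y\<close> by density, as
  \<open>Gh s t\<close> is continuous.\<close>

lemma Gh_contraction:
  assumes "s \<in> J" "t \<in> J" "s \<le> t"
  shows "norm (Gh s t) \<le> 1"
proof -
  obtain \<omega> where \<omega>: "\<omega> \<in> space M" "good_path \<omega>"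
  proof (rule ccontr)
    assume no: "\<not> thesis"
    have "AE \<omega> in M. False" using AE_good AE_space
      by eventually_elim (use no that in blast)
    then show False by simp
  qed
  have Y1: "norm (Gh s t f) \<le> norm f" if f: "f \<in> Y1 iota" for f
  proof (rule tendsto_upperbound[OF tendsto_norm[OF convergence_Y1[OF \<omega> f assms]]])
    show "eventually (\<lambda>e. norm (V e s t \<omega> f) \<le> norm f) (at_right 0)"
      using eventually_small by eventually_elim (rule V_contr[OF \<omega> assms], auto)
  qed simp
  have "closed {f. norm (Gh s t f) \<le> norm f}"
    by (intro closed_Collect_le continuous_intros)
  then have "closure (Y1 iota) \<subseteq> {f. norm (Gh s t f) \<le> norm f}"
    by (intro closure_minimal) (use Y1 in auto)
  then have "norm (Gh s t f) \<le> 1 * norm f" for f using Y1_dense by auto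
  then show ?thesis by (intro norm_blinfun_bound) auto
qed

text \<open>Contractivity of both \<open>V\<close> and \<open>Gh\<close> makes the error of
  approximating \<open>f\<close> from \<open>Y1\<close> uniform in \<open>t\<close> and
  \<open>e\<close>.\<close>

lemma uniform_convergence:
  assumes \<omega>: "\<omega> \<in> space M" "good_path \<omega>" and s: "s \<in> J" and T0: "T0 \<in> J" "s \<le> T0" and d: "d > 0"
  shows "eventually (\<lambda>e. \<forall>t\<in>{s..T0}. dist (V e s t \<omega> f) (Gh s t f) < d) (at_right 0)"
proof -
  have "f \<in> closure (Y1 iota)" using Y1_dense by simp
  then obtain f' where f': "f' \<in> Y1 iota" "dist f' f < d / 3"
    using d unfolding closure_approachable by (meson zero_less_divide_iff zero_less_numeral)
  then obtain z where z: "f' = iota z" by (auto simp: Y1_def)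
  have "eventually (\<lambda>e. \<forall>t\<in>{s..T0}. norm (V e s t \<omega> (iota z) - Gh s t (iota z)) < d / 3) (at_right 0)"
    by (rule uniform_convergence_Y1[OF \<omega> s T0]) (use d in simp)
  then show ?thesis using eventually_small
  proof eventually_elim
    case (elim e)
    show ?case
    proof
      fix t assume t: "t \<in> {s..T0}"
      have tJ: "t \<in> J" "s \<le> t" using time_domain_mem(1)[OF J s T0(1)] t by auto
      have "norm (V e s t \<omega> (f - f')) \<le> norm (f - f')" using V_contr[OF \<omega> s tJ] elim by blast
      then have 1: "norm (V e s t \<omega> f - V e s t \<omega> f') < d / 3"
        using f' by (simp add: blinfun.diff_right dist_norm norm_minus_commute)
      have "norm (Gh s t (f - f')) \<le> norm (f - f')" by (rule norm_blinfun_le1[OF Gh_contraction[OF s tJ]])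
      then have 2: "norm (Gh s t f' - Gh s t f) < d / 3"
        using f' by (simp add: blinfun.diff_right dist_norm norm_minus_commute)
      have 3: "norm (V e s t \<omega> f' - Gh s t f') < d / 3" using elim t z by blast
      show "dist (V e s t \<omega> f) (Gh s t f) < d"
        using norm_triangle_lt[of "V e s t \<omega> f - V e s t \<omega> f'" "V e s t \<omega> f' - Gh s t f'" "2 * d / 3"]
          norm_triangle_lt[of "V e s t \<omega> f - Gh s t f'" "Gh s t f' - Gh s t f" d] 1 2 3
        by (simp add: dist_norm)
    qed
  qed
qed

end

section \<open>Convergence in distribution\<close>

lemma lprod_cong: "(\<And>k. 1 \<le> k \<Longrightarrow> k \<le> n \<Longrightarrow> A k = B k) \<Longrightarrow> lprod A n = lprod B n"
  by (induction n) auto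

lemma rcll_fun:
  fixes p :: "real \<Rightarrow> 'i \<Rightarrow> 'a::topological_space"
  assumes "\<And>k. rcll I (\<lambda>t. p t k)"
  shows "rcll I p"
  unfolding rcll_def
proof (intro ballI conjI)
  fix t assume t: "t \<in> I"
  show "continuous (at t within (I \<inter> {t..})) p"
    using assms t unfolding rcll_def continuous_within tendsto_fun_iff[of p] by auto
  have "\<forall>k. \<exists>l. ((\<lambda>t. p t k) \<longlongrightarrow> l) (at t within (I \<inter> {..<t}))"
    using assms t unfolding rcll_def by blast
  then obtain l where "\<And>k. ((\<lambda>t. p t k) \<longlongrightarrow> l k) (at t within (I \<inter> {..<t}))" by metis
  then show "\<exists>l. (p \<longlongrightarrow> l) (at t within (I \<inter> {..<t}))" unfolding tendsto_fun_iff[of p] by blast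
qed

lemma rcll_continuous_on:
  assumes "continuous_on I p"
  shows "rcll I p"
  unfolding rcll_def
proof (intro ballI conjI)
  fix t assume t: "t \<in> I"
  then have lim: "(p \<longlongrightarrow> p t) (at t within I)" using assms by (auto simp: continuous_on_def)
  show "continuous (at t within (I \<inter> {t..})) p"
    unfolding continuous_within by (rule tendsto_within_subset[OF lim]) auto
  have "(p \<longlongrightarrow> p t) (at t within (I \<inter> {..<t}))" by (rule tendsto_within_subset[OF lim]) auto
  then show "\<exists>l. (p \<longlongrightarrow> l) (at t within (I \<inter> {..<t}))" by blast
qed

lemma Jfrom_cases:
  assumes "time_domain J" "s \<in> J"
  shows "Jfrom J s = {s..} \<or> (\<exists>b\<ge>s. Jfrom J s = {s..b})"
proof -
  from assms(1) consider "J = {0..}" | b where "J = {0..b}" by (auto simp: time_domain_def)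
  then show ?thesis
  proof cases
    case 1 then show ?thesis using assms(2) by (intro disjI1) (auto simp: Jfrom_def)
  next
    case 2 then show ?thesis using assms(2) by (intro disjI2 exI[of _ b]) (auto simp: Jfrom_def)
  qed
qed

context averaged_evolution
begin

text \<open>On each path the supremum equals \<open>k\<close> exactly from the jump \<open>k\<close>
  up to the next one, which makes the event explicit.\<close>

lemma Ncount_measurable: "0 \<le> t \<Longrightarrow> (\<lambda>\<omega>. Ncount T t \<omega>) \<in> measurable M (count_space UNIV)"
  unfolding measurable_count_space_eq2_countable
proof (intro conjI ballI)
  assume t: "0 \<le> t"
  fix k
  have "(\<lambda>\<omega>. Ncount T t \<omega>) -` {k} \<inter> space M = {\<omega> \<in> space M. T k \<omega> \<le> t \<and> t < T (Suc k) \<omega>}"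
  proof (intro set_eqI iffI)
    fix \<omega> assume w: "\<omega> \<in> (\<lambda>\<omega>. Ncount T t \<omega>) -` {k} \<inter> space M"
    interpret renewal_path x T \<omega> by (rule renewal_path) (use w in auto)
    show "\<omega> \<in> {\<omega> \<in> space M. T k \<omega> \<le> t \<and> t < T (Suc k) \<omega>}" using N_bracket[OF t] w by (auto simp: N_def)
  next
    fix \<omega> assume w: "\<omega> \<in> {\<omega> \<in> space M. T k \<omega> \<le> t \<and> t < T (Suc k) \<omega>}"
    interpret renewal_path x T \<omega> by (rule renewal_path) (use w in auto)
    show "\<omega> \<in> (\<lambda>\<omega>. Ncount T t \<omega>) -` {k} \<inter> space M" using N_eqI[of k t] w by (auto simp: N_def)
  qed
  also have "\<dots> \<in> sets M" by measurable
  finally show "(\<lambda>\<omega>. Ncount T t \<omega>) -` {k} \<inter> space M \<in> sets M" .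
qed auto

text \<open>For fixed numbers of jumps the product is a finite composition of jointly measurable
  maps; the random numbers, which take countably many values, are substituted afterwards.\<close>

lemma V_measurable:
  assumes s: "s \<in> J" and t: "t \<in> J" "s \<le> t" and e: "0 < e" "e \<le> 1"
  shows "(\<lambda>\<omega>. V e s t \<omega> f) \<in> borel_measurable M"
proof -
  \<comment> \<open>Joint measurability is given on \<open>DeltaJ\<close> only, so the random times
    must satisfy this constraint at every sample point.\<close>
  have Gsm: "(\<lambda>\<omega>. Gs (y \<omega>) (r \<omega>) (q \<omega>) (g \<omega>)) \<in> borel_measurable M"
    if [measurable]: "r \<in> borel_measurable M" "q \<in> borel_measurable M" "y \<in> measurable M (count_space UNIV)" "g \<in> borel_measurable M"
      and dom: "\<And>\<omega>. \<omega> \<in> space M \<Longrightarrow> (r \<omega>, q \<omega>) \<in> DeltaJ J" for r q y g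
  proof -
    have "(\<lambda>\<omega>. (r \<omega>, q \<omega>, y \<omega>, g \<omega>)) \<in> measurable M (restrict_space (borel \<Otimes>\<^sub>M borel \<Otimes>\<^sub>M count_space UNIV \<Otimes>\<^sub>M borel)
           {(r, t, y, f). (r, t) \<in> DeltaJ J})"
      by (rule measurable_restrict_space2) (use dom in auto)
    from measurable_compose[OF this Gs_meas] show ?thesis by simp
  qed
  have Dm: "(\<lambda>\<omega>. D e (y \<omega>) (y' \<omega>) (g \<omega>)) \<in> borel_measurable M"
    if [measurable]: "y \<in> measurable M (count_space UNIV)" "y' \<in> measurable M (count_space UNIV)" "g \<in> borel_measurable M" for y y' g
  proof -
    have "(\<lambda>\<omega>. (y \<omega>, y' \<omega>, g \<omega>)) \<in> measurable M (count_space UNIV \<Otimes>\<^sub>M count_space UNIV \<Otimes>\<^sub>M borel)" by measurable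
    from measurable_compose[OF this D_meas] e show ?thesis by simp
  qed
  \<comment> \<open>Clipping the jump times to [s, t] keeps all arguments of Gs in DeltaJ for every sample point;
    on the factors that occur in V it has no effect.\<close>
  define clip where "clip i k \<omega> = (if k = 0 then s else max s (min t (s + e * (T (i + k) \<omega> - s))))" for i k \<omega>
  have clip_meas: "clip i k \<in> borel_measurable M" for i k
    unfolding clip_def by (cases "k = 0") simp_all
  have clip_st: "s \<le> clip i k \<omega>" "clip i k \<omega> \<le> t" for i k \<omega> using t by (auto simp: clip_def)
  have clip_J: "clip i k \<omega> \<in> J" for i k \<omega> using time_domain_mem(1)[OF J s t(1)] clip_st by auto
  have clip_mono: "clip i k \<omega> \<le> clip i (Suc k) \<omega>" if "\<omega> \<in> space M" for i k \<omega>
  proof (cases "k = 0")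
    case True then show ?thesis using clip_st by (simp add: clip_def)
  next
    case False
    have "T (i + k) \<omega> \<le> T (i + Suc k) \<omega>" using T_less[OF that, of "i + k"] by simp
    then have "e * (T (i + k) \<omega> - s) \<le> e * (T (i + Suc k) \<omega> - s)" using e by (intro mult_left_mono) auto
    then show ?thesis using False by (auto simp: clip_def)
  qed
  define B where "B i \<omega> k = Gs (x (i + (k - 1)) \<omega>) (clip i (k - 1) \<omega>) (clip i k \<omega>) o\<^sub>L D e (x (i + (k - 1)) \<omega>) (x (i + k) \<omega>)" for i \<omega> k
  \<comment> \<open>The last factor acts first, so the induction has to carry an arbitrary
    measurable random vector \<open>g\<close>.\<close>
  have lm: "(\<lambda>\<omega>. lprod (B i \<omega>) n (g \<omega>)) \<in> borel_measurable M" if "g \<in> borel_measurable M" for i n g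
    using that
  proof (induction n arbitrary: g)
    case (Suc n)
    have "(\<lambda>\<omega>. B i \<omega> (Suc n) (g \<omega>)) \<in> borel_measurable M"
      unfolding B_def blinfun_apply_blinfun_compose
      by (intro Gsm Dm clip_meas Suc.prems x_meas) (use clip_J clip_mono in \<open>auto simp: DeltaJ_def\<close>)
    from Suc.IH[OF this] show ?case by simp
  qed simp
  define F where "F i j \<omega> = lprod (B i \<omega>) (j - i) (Gs (x j \<omega>) (clip i (j - i) \<omega>) t f)" for i j \<omega>
  have Fm: "F i j \<in> borel_measurable M" for i j
    unfolding F_def
    by (intro lm Gsm clip_meas x_meas borel_measurable_const) (use clip_J clip_st t in \<open>auto simp: DeltaJ_def\<close>)
  define q where "q = s + (t - s) / e"
  have s0: "0 \<le> s" using time_domain_mem(2)[OF J s s] by simp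
  have q0: "0 \<le> q" using s0 t e by (simp add: q_def)
  have Nq: "(\<lambda>\<omega>. F i (Ncount T q \<omega>) \<omega>) \<in> borel_measurable M" for i
    by (rule measurable_compose_countable[OF Fm Ncount_measurable[OF q0]])
  have Ns: "(\<lambda>\<omega>. F (Ncount T s \<omega>) (Ncount T q \<omega>) \<omega>) \<in> borel_measurable M"
    by (rule measurable_compose_countable[OF Nq Ncount_measurable[OF s0]])
  have "V e s t \<omega> f = F (Ncount T s \<omega>) (Ncount T q \<omega>) \<omega>" if w: "\<omega> \<in> space M" for \<omega>
  proof -
    interpret E: smooth_path_evolution x T \<omega> J Gs D e s iota CL by (rule evolution[OF w s e])
    obtain n where n: "E.N (E.r t) = E.N s + n" using E.N_r_split[OF t(2)] by blast
    have clipT: "clip (E.N s) k \<omega> = E.Te k" if "k \<le> n" for k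
    proof (cases "k = 0")
      case False
      have "T (E.N s + k) \<omega> \<le> T (E.N (E.r t)) \<omega>" using that n by (intro E.T_mono) simp
      also have "\<dots> \<le> E.r t" by (rule E.N_bracket(1)[OF E.r_nonneg[OF t(2)]])
      finally have 1: "E.th (E.N s + k) \<le> t" by (simp add: E.th_le_iff)
      have "s < T (Suc (E.N s)) \<omega>" by (rule E.N_bracket(2)[OF s0])
      also have "\<dots> \<le> T (E.N s + k) \<omega>" using False by (intro E.T_mono) simp
      finally have "s \<le> E.th (E.N s + k)" using e by (simp add: E.th_def)
      then show ?thesis using 1 False by (simp add: clip_def E.Te_def E.th_def)
    qed (simp add: clip_def E.Te_def)
    have l: "lprod (B (E.N s) \<omega>) n = lprod E.factor n"
      by (rule lprod_cong) (simp add: B_def E.factor_def clipT)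
    have "V e s t \<omega> f = lprod E.factor n (Gs (x (E.N s + n) \<omega>) (E.Te n) t f)"
      using E.V_eq[OF t(2) n] by (simp add: E.V_def)
    also have "\<dots> = F (E.N s) (E.N s + n) \<omega>" by (simp add: F_def l clipT)
    finally show ?thesis using n by (simp add: E.N_def E.r_def q_def)
  qed
  then show ?thesis using Ns by (subst measurable_cong) auto
qed

lemma conv_distr:
  fixes f :: "nat \<Rightarrow> 'y"
  assumes s: "s \<in> J"
  shows "conv_distr_skorohod M (Jfrom J s) (\<lambda>e \<omega> t k. V e s t \<omega> (f k)) (\<lambda>\<omega> t k. Gh s t (f k))"
proof -
  define I where "I = Jfrom J s"
  have I: "I = {s..} \<or> (\<exists>b\<ge>s. I = {s..b})" unfolding I_def by (rule Jfrom_cases[OF J s])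
  have IJ: "t \<in> J" "s \<le> t" if "t \<in> I" for t using that by (auto simp: I_def Jfrom_def)
  have rcV: "rcll I (\<lambda>t k. V e s t \<omega> (f k))" if "\<omega> \<in> space M" "0 < e" "e \<le> 1" for e \<omega>
  proof (rule rcll_fun)
    fix k
    interpret E: smooth_path_evolution x T \<omega> J Gs D e s iota CL by (rule evolution[OF that(1) s that(2,3)])
    show "rcll I (\<lambda>t. V e s t \<omega> (f k))" using E.V_rcll[of "f k"] by (simp add: E.V_def I_def)
  qed
  have rcG: "rcll I (\<lambda>t k. Gh s t (f k))"
    by (rule rcll_fun, rule rcll_continuous_on, unfold I_def, rule regular_cont[OF Gh_regular s])
  have conv: "((\<lambda>e. \<integral>\<omega>. F (\<lambda>t k. V e s t \<omega> (f k)) \<partial>M) \<longlongrightarrow> (\<integral>\<omega>. F (\<lambda>t k. Gh s t (f k)) \<partial>M)) (at_right 0)"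
    if Bd: "\<And>p. rcll I p \<Longrightarrow> \<bar>F p\<bar> \<le> Bd" and F: "skorohod_continuous I F" for F and Bd :: real
    unfolding tendsto_at_iff_sequentially
  proof (intro allI impI)
    \<comment> \<open>Dominated convergence and \<open>skorohod_conv\<close> speak about sequences,
      so the limit in \<open>e\<close> is tested along an arbitrary one.\<close>
    fix X :: "nat \<Rightarrow> real" assume X: "\<forall>i. X i \<in> {0<..} - {0}" "X \<longlonglongrightarrow> 0"
    obtain n0 where n0: "\<And>n. n \<ge> n0 \<Longrightarrow> X n < 1"
      using order_tendstoD(2)[OF X(2), of 1] by (auto simp: eventually_sequentially)
    \<comment> \<open>Shifted so that every term is at most 1, the range in which the evolution is
      known to be contractive and measurable.\<close>
    define Y where "Y n = X (n + n0)" for n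
    have Y: "0 < Y n" "Y n \<le> 1" for n using X(1) n0[of "n + n0"] by (auto simp: Y_def less_imp_le)
    have Y0: "Y \<longlonglongrightarrow> 0" unfolding Y_def by (rule LIMSEQ_ignore_initial_segment[OF X(2)])
    have Yr: "filterlim Y (at_right 0) sequentially"
    proof -
      have "Y n \<noteq> 0" for n using Y(1)[of n] by simp
      then show ?thesis using Y0 Y(1) by (simp add: filterlim_at)
    qed
    have meas: "(\<lambda>\<omega>. F (\<lambda>t k. V (Y n) s t \<omega> (f k))) \<in> borel_measurable M" for n
    proof (rule borel_measurable_skorohod_continuous[OF I _ _ F])
      show "(\<lambda>\<omega>. \<lambda>k. V (Y n) s t \<omega> (f k)) \<in> borel_measurable M" if "t \<in> I" for t
        by (rule measurable_coordinatewise_then_product, rule V_measurable[OF s IJ[OF that]])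
          (use Y in auto)
      show "rcll I (\<lambda>t k. V (Y n) s t \<omega> (f k))" if "\<omega> \<in> space M" for \<omega> by (rule rcV[OF that Y])
    qed
    have "(\<lambda>n. \<integral>\<omega>. F (\<lambda>t k. V (Y n) s t \<omega> (f k)) \<partial>M) \<longlonglongrightarrow> (\<integral>\<omega>. F (\<lambda>t k. Gh s t (f k)) \<partial>M)"
    proof (rule integral_dominated_convergence[where w="\<lambda>_. Bd"])
      show "AE \<omega> in M. (\<lambda>n. F (\<lambda>t k. V (Y n) s t \<omega> (f k))) \<longlonglongrightarrow> F (\<lambda>t k. Gh s t (f k))"
        using AE_good AE_space
      proof eventually_elim
        case (elim \<omega>)
        have "skorohod_conv I (\<lambda>n t k. V (Y n) s t \<omega> (f k)) (\<lambda>t k. Gh s t (f k))"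
        proof (rule skorohod_conv_uniform)
          fix T' d :: real assume d: "d > 0"
          \<comment> \<open>The horizon has to lie in \<open>J\<close>; on a compact interval its
            right end serves for every \<open>T'\<close>.\<close>
          obtain T0 where T0: "T0 \<in> J" "s \<le> T0" "\<And>t. t \<in> I \<Longrightarrow> t \<le> T' \<Longrightarrow> t \<le> T0"
          proof (cases "I = {s..}")
            case True
            then have "max s T' \<in> I" by simp
            then show ?thesis using that[of "max s T'"] IJ by auto
          next
            case False
            then obtain b where b: "b \<ge> s" "I = {s..b}" using I by auto
            then have "b \<in> I" by simp
            then show ?thesis using that[of b] IJ b by auto
          qed
          have uc: "eventually (\<lambda>n. \<forall>t\<in>{s..T0}. dist (V (Y n) s t \<omega> (f k)) (Gh s t (f k)) < d') sequentially" if "d' > 0" for k d'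
            using filterlim_iff[THEN iffD1, OF Yr] uniform_convergence[OF elim(2,1) s T0(1,2) that, of "f k"] by blast
          have "eventually (\<lambda>n. \<forall>t\<in>{s..T0}. dist (\<lambda>k. V (Y n) s t \<omega> (f k)) (\<lambda>k. Gh s t (f k)) < d) sequentially"
            by (rule eventually_uniformly_dist_fun_less[OF uc d])
          then show "eventually (\<lambda>n. \<forall>t\<in>I. t \<le> T' \<longrightarrow> dist (\<lambda>k. V (Y n) s t \<omega> (f k)) (\<lambda>k. Gh s t (f k)) < d) sequentially"
            by eventually_elim (use T0 IJ in auto)
        qed
        then show ?case by (rule skorohod_continuousD[OF F rcV[OF elim(2) Y] rcG])
      qed
      show "AE \<omega> in M. norm (F (\<lambda>t k. V (Y n) s t \<omega> (f k))) \<le> Bd" for n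
        using AE_space by eventually_elim (use Bd rcV Y in auto)
    qed (use meas in auto)
    then show "((\<lambda>e. \<integral>\<omega>. F (\<lambda>t k. V e s t \<omega> (f k)) \<partial>M) \<circ> X) \<longlonglongrightarrow> (\<integral>\<omega>. F (\<lambda>t k. Gh s t (f k)) \<partial>M)"
      unfolding Y_def comp_def by (rule LIMSEQ_offset)
  qed
  show ?thesis unfolding conv_distr_skorohod_def I_def[symmetric]
    using rcV rcG conv by auto
qed

end

theorem theorem4p19:
  fixes J :: "real set"
    and iota :: "'z::{banach, second_countable_topology} \<Rightarrow>\<^sub>L 'y::{banach, second_countable_topology}"
    and M :: "'w measure"
    and x :: "nat \<Rightarrow> 'w \<Rightarrow> 'x::finite" and T :: "nat \<Rightarrow> 'w \<Rightarrow> real"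
    and Q :: "'x \<Rightarrow> 'x \<Rightarrow> real \<Rightarrow> real" and rho :: "'x \<Rightarrow> real"
    and Gs :: "'x \<Rightarrow> real \<Rightarrow> real \<Rightarrow> 'y \<Rightarrow>\<^sub>L 'y"
    and D :: "real \<Rightarrow> 'x \<Rightarrow> 'x \<Rightarrow> 'y \<Rightarrow>\<^sub>L 'y"
    and Gh :: "real \<Rightarrow> real \<Rightarrow> 'y \<Rightarrow>\<^sub>L 'y"
  assumes J: "time_domain J"
    and emb: "inj (blinfun_apply iota)"
    and prob: "prob_space M" and compl: "complete_measure M"
    and kernel: "semi_markov_kernel Q"
    and mrp: "markov_renewal_process M x T Q"
    and ergodic: "embedded_chain_ergodic (emb_P Q) rho"
    and semigroups: "\<forall>y. inhom_semigroup J (Gs y)"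
    and Gs_meas: "(\<lambda>(r, t, y, f). blinfun_apply (Gs y r t) f) \<in> borel_measurable
        (restrict_space (borel \<Otimes>\<^sub>M borel \<Otimes>\<^sub>M count_space UNIV \<Otimes>\<^sub>M borel)
           {(r, t, y, f). (r, t) \<in> DeltaJ J})"
    and D0: "\<forall>y z. D 0 y z = id_blinfun"
    and D_meas: "\<forall>e\<in>{0<..1}. (\<lambda>(y, z, f). blinfun_apply (D e y z) f) \<in> borel_measurable
        (count_space UNIV \<Otimes>\<^sub>M count_space UNIV \<Otimes>\<^sub>M borel)"
    and dense: "\<exists>C. countable C \<and> C \<subseteq> Dhat J iota Gs D \<and>
                  closure C = UNIV \<and> closure (toZ iota ` C) = UNIV"
    and a0: "A0 J iota Gs D Q"
    and a1: "A1 J iota M Gs D x T"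
    and a2: "A2 J iota M Gs D x T Q rho"
    and a3: "A3 J iota Gs D Q rho Gh"
  shows "inhom_semigroup J Gh \<and> contraction_semigroup J Gh \<and> regular J iota Gh \<and>
         (\<forall>f :: nat \<Rightarrow> 'y. \<forall>s\<in>J.
            conv_distr_skorohod M (Jfrom J s)
              (\<lambda>e \<omega> t k. Veps Gs D x T e s t \<omega> (f k))
              (\<lambda>\<omega> t k. Gh s t (f k)))"
proof -
  obtain taubar where tb: "taubar > 0" "\<And>a b. Q a b taubar = emb_P Q a b"
    using a0 by (auto simp: A0_def)
  interpret prob_space M by (rule prob)
  interpret averaged_evolution M x T Q rho taubar J iota Gs D Gh
    by unfold_locales (use assms tb in blast)+
  have "contraction_semigroup J Gh"
    using Gh_contraction by (auto simp: contraction_semigroup_def DeltaJ_def)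
  moreover have "conv_distr_skorohod M (Jfrom J s) (\<lambda>e \<omega> t k. Veps Gs D x T e s t \<omega> (f k)) (\<lambda>\<omega> t k. Gh s t (f k))"
    if "s \<in> J" for f :: "nat \<Rightarrow> 'y" and s
    by (rule conv_distr[OF that])
  ultimately show ?thesis using Gh_semigroup Gh_regular by blast
qed

end
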